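(* Fix an integer $S\ge1$, let $\Sigma=\{0,\pm1,\dots,\pm S\}$ and $\Sigma_N=\Sigma^N$. For $\beta\ge0$, $D\in\mathbb{R}$, $h\in\mathbb{R}$ and i.i.d. standard Gaussian $(g_{ij})_{1\le i<j\le N}$, let \[H_N(\sigma)=\frac{\beta}{\sqrt N}\sum_{1\le i<j\le N}g_{ij}\sigma_i\sigma_j+D\sum_{i=1}^N\sigma_i^2+h\sum_{i=1}^N\sigma_i,\qquad \sigma\in\Sigma_N,\] and let $\langle\cdot\rangle$ denote the average with respect to the Gibbs measure $G_N(\{\sigma\})=\exp(H_N(\sigma))/Z_N$, $Z_N=\sum_{\sigma\in\Sigma_N}\exp(H_N(\sigma))$. There exist $K>0$ and $\hat\beta>0$ such that for all $0\le\beta<\hat\beta$ (with also $\beta<\tilde\beta$), $h\ge0$, $D\in\mathbb{R}$ and all $N\ge1$, \[ \mathbb{E}\left[\langle\sigma_N\rangle-\frac{\sum_{\gamma=1}^S\gamma\cdot2\sinh[\gamma(\beta\xi_N+h)]\exp(\gamma^2\Delta)}{1+\sum_{\gamma=1}^S2\cosh[\gamma(\beta\xi_N+h)]\exp(\gamma^2\Delta)}\right]^2\le\frac{K}{\sqrt N}, \] \[ \mathbb{E}\left[\langle\sigma_N^2\rangle-\frac{\sum_{\gamma=1}^S\gamma^2\cdot2\cosh[\gamma(\beta\xi_N+h)]\exp(\gamma^2\Delta)}{1+\sum_{\gamma=1}^S2\cosh[\gamma(\beta\xi_N+h)]\exp(\gamma^2\Delta)}\right]^2\le\frac{K}{\sqrt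 N}, \] where \[\xi_N=\frac{1}{\sqrt N}\sum_{i\le N-1}g_{iN}\langle\sigma_i\rangle-\beta(p-q)\langle\sigma_N\rangle,\qquad \Delta=D+\tfrac12\beta^2(p-q).\]
   Context: $\mathbb{E}$ denotes expectation over the Gaussian disorder. $X$ is a standard Gaussian. There is $\tilde\beta>0$ such that for $0\le\beta<\tilde\beta$, $h\ge0$, $D\in\mathbb{R}$ the system $p=\mathbb{E}\big[\frac{\sum_{\gamma=1}^{S}\gamma^2\, 2\cosh[\gamma(\sqrt{q}\beta X+h)]e^{\gamma^2[D+\frac{\beta^2}{2}(p-q)]}}{1+\sum_{\gamma=1}^{S}2\cosh[\gamma(\sqrt{q}\beta X+h)]e^{\gamma^2[D+\frac{\beta^2}{2}(p-q)]}}\big]$, $q=\mathbb{E}\big[\big(\frac{\sum_{\gamma=1}^{S}\gamma\, 2\sinh[\gamma(\sqrt{q}\beta X+h)]e^{\gamma^2[D+\frac{\beta^2}{2}(p-q)]}}{1+\sum_{\gamma=1}^{S}2\cosh[\gamma(\sqrt{q}\beta X+h)]e^{\gamma^2[D+\frac{\beta^2}{2}(p-q)]}}\big)^2\big]$ has a unique solution; $(p,q)$ denotes this solution, and $\beta<\tilde\beta$ is assumed throughout. *)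

theory Defs
  imports "HOL-Probability.Probability"
begin

definition stdN :: "real measure" where
  "stdN = density lborel std_normal_density"

definition pairs :: "nat \<Rightarrow> (nat \<times> nat) set" where
  "pairs N = {(i, j). 1 \<le> i \<and> i < j \<and> j \<le> N}"

definition disorder :: "nat \<Rightarrow> ((nat \<times> nat) \<Rightarrow> real) measure" where
  "disorder N = PiM (pairs N) (\<lambda>_. stdN)"

definition configs :: "nat \<Rightarrow> nat \<Rightarrow> (nat \<Rightarrow> int) set" where
  "configs S N = PiE {1..N} (\<lambda>_. {- int S..int S})"

definition hamiltonian ::
  "nat \<Rightarrow> real \<Rightarrow> real \<Rightarrow> real \<Rightarrow> (nat \<times> nat \<Rightarrow> real) \<Rightarrow> (nat \<Rightarrow> int) \<Rightarrow> real" where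
  "hamiltonian N \<beta> D h g \<sigma> =
     \<beta> / sqrt (real N) * (\<Sum>(i, j)\<in>pairs N. g (i, j) * of_int (\<sigma> i) * of_int (\<sigma> j))
     + D * (\<Sum>i=1..N. (of_int (\<sigma> i))\<^sup>2) + h * (\<Sum>i=1..N. of_int (\<sigma> i))"

definition partition_fn ::
  "nat \<Rightarrow> nat \<Rightarrow> real \<Rightarrow> real \<Rightarrow> real \<Rightarrow> (nat \<times> nat \<Rightarrow> real) \<Rightarrow> real" where
  "partition_fn S N \<beta> D h g = (\<Sum>\<sigma>\<in>configs S N. exp (hamiltonian N \<beta> D h g \<sigma>))"

definition gibbs_avg ::
  "nat \<Rightarrow> nat \<Rightarrow> real \<Rightarrow> real \<Rightarrow> real \<Rightarrow> (nat \<times> nat \<Rightarrow> real) \<Rightarrow> ((nat \<Rightarrow> int) \<Rightarrow> real) \<Rightarrow> real" where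
  "gibbs_avg S N \<beta> D h g f =
     (\<Sum>\<sigma>\<in>configs S N. f \<sigma> * exp (hamiltonian N \<beta> D h g \<sigma>)) / partition_fn S N \<beta> D h g"

definition den1 :: "nat \<Rightarrow> real \<Rightarrow> real \<Rightarrow> real" where
  "den1 S a d = 1 + (\<Sum>\<gamma>=1..S. 2 * cosh (real \<gamma> * a) * exp ((real \<gamma>)\<^sup>2 * d))"

definition num_mag :: "nat \<Rightarrow> real \<Rightarrow> real \<Rightarrow> real" where
  "num_mag S a d = (\<Sum>\<gamma>=1..S. real \<gamma> * (2 * sinh (real \<gamma> * a)) * exp ((real \<gamma>)\<^sup>2 * d))"

definition num_sq :: "nat \<Rightarrow> real \<Rightarrow> real \<Rightarrow> real" where
  "num_sq S a d = (\<Sum>\<gamma>=1..S. (real \<gamma>)\<^sup>2 * (2 * cosh (real \<gamma> * a)) * exp ((real \<gamma>)\<^sup>2 * d))"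

definition is_pq :: "nat \<Rightarrow> real \<Rightarrow> real \<Rightarrow> real \<Rightarrow> real \<Rightarrow> real \<Rightarrow> bool" where
  "is_pq S \<beta> D h p q \<longleftrightarrow>
     p = (\<integral>x. num_sq S (sqrt q * \<beta> * x + h) (D + \<beta>\<^sup>2 / 2 * (p - q))
              / den1 S (sqrt q * \<beta> * x + h) (D + \<beta>\<^sup>2 / 2 * (p - q)) \<partial>stdN)
   \<and> q = (\<integral>x. (num_mag S (sqrt q * \<beta> * x + h) (D + \<beta>\<^sup>2 / 2 * (p - q))
              / den1 S (sqrt q * \<beta> * x + h) (D + \<beta>\<^sup>2 / 2 * (p - q)))\<^sup>2 \<partial>stdN)"

end

theory Submission
  imports Defs
begin

text \<open>The proof removes one site at a time. Given the remaining spins, the field on the removed site is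
  Gaussian in the removed couplings, so second moments of its Gibbs exponentials are explicit in the
  overlaps \<open>R\<close> of the remaining spins. They differ from those of a field with conditional variance
  \<open>p - q\<close> by the mean square of \<open>R\<^sub>1\<^sub>2 - q\<close> and \<open>R\<^sub>1\<^sub>1 - p\<close>; there is no term of first order because centred
  overlaps have mean zero. With the Cameron--Martin shift this gives
  \<open>E \<langle>(\<sigma>\<^sub>k\<^sup>1 \<sigma>\<^sub>k\<^sup>2 - q) (R\<^sub>1\<^sub>2 - q)\<rangle> \<le> C \<beta> W + C / N\<close> with \<open>W\<close> that mean square, and likewise for
  \<open>R\<^sub>1\<^sub>1\<close>. Averaging over \<open>k\<close> bounds \<open>W\<close> by itself times a small constant, up to \<open>C / N\<close>, so that
  \<open>W\<close> is of order \<open>1 / N\<close>. The same second moment formulas then compare \<open>\<langle>\<sigma>\<^sub>N\<rangle>\<close> and the field with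
  their values in the Gaussian picture.\<close>

section \<open>Gaussian integrals over finite products\<close>

text \<open>There is no induction on N. The one-site estimates hold for arbitrary probability
  weights on the remaining configurations, so the remaining system keeps the normalisation of the
  full one and the same \<open>p\<close>, \<open>q\<close> serve as centres. The price: in these
  estimates \<open>W\<close> is taken under the weights of the remaining spins, while the average
  over sites closes only under the full Gibbs measure. A separate comparison of the two measures
  bridges this.

  All constants may depend on S only. D and h are unbounded, but they enter a one-site average only
  through positive weights, and the bounds on such averages and on their derivatives use nothing but
  the range of the spin and the strength of the field. Small \<beta> has two roles: \<beta> S^2
  \<le> 1 keeps Gaussian exponents below absolute constants, and a stronger condition makes the
  bound of \<open>W\<close> by itself a contraction.

  Random denominators are controlled for every disorder: by Jensen, the centred part of the field
  can only increase each term of the partition function.\<close>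

definition lin :: "'j set \<Rightarrow> ('j \<Rightarrow> real) \<Rightarrow> ('j \<Rightarrow> real) \<Rightarrow> real" where
  "lin J u v = (\<Sum>e\<in>J. u e * v e)"

lemma prob_space_stdN: "prob_space stdN"
  unfolding stdN_def by (rule prob_space_normal_density) simp

lemma sets_stdN [measurable_cong, simp]: "sets stdN = sets borel"
  by (simp add: stdN_def)

lemma space_stdN [simp]: "space stdN = UNIV"
  by (simp add: stdN_def)

interpretation stdN: prob_space stdN
  by (rule prob_space_stdN)

interpretation stdN_prod: product_sigma_finite "\<lambda>_. stdN"
  by unfold_locales

lemma prob_space_PiM_stdN: "prob_space (PiM J (\<lambda>_. stdN))"
  by (rule prob_space_PiM) (rule prob_space_stdN)

lemma lin_measurable [measurable]:
  "(\<lambda>g. lin J g v) \<in> borel_measurable (PiM J (\<lambda>_. stdN))"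
proof -
  have *: "(\<lambda>g. g e) \<in> borel_measurable (PiM J (\<lambda>_. stdN))" if "e \<in> J" for e
    using measurable_component_singleton[OF that, of "\<lambda>_. stdN"]
    by (simp add: measurable_cong_sets[OF refl sets_stdN])
  then show ?thesis unfolding lin_def by (intro borel_measurable_sum borel_measurable_times) auto
qed

lemma lin_commute: "lin J u v = lin J v u"
  by (simp add: lin_def mult.commute)

lemma lin_add_left: "lin J (\<lambda>e. u e + w e) v = lin J u v + lin J w v"
  by (simp add: lin_def sum.distrib algebra_simps)

lemma lin_diff_left: "lin J (\<lambda>e. u e - w e) v = lin J u v - lin J w v"
  by (simp add: lin_def sum_subtractf algebra_simps)

lemma lin_scale_left: "lin J (\<lambda>e. c * u e) v = c * lin J u v"
  by (simp add: lin_def sum_distrib_left algebra_simps)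

lemma lin_add_right: "lin J v (\<lambda>e. u e + w e) = lin J v u + lin J v w"
  by (simp add: lin_def sum.distrib algebra_simps)

lemma lin_diff_right: "lin J v (\<lambda>e. u e - w e) = lin J v u - lin J v w"
  by (simp add: lin_def sum_subtractf algebra_simps)

lemma lin_scale_right: "lin J v (\<lambda>e. c * u e) = c * lin J v u"
  by (simp add: lin_def sum_distrib_left algebra_simps)

lemma lin_sum_right: "lin J v (\<lambda>e. \<Sum>i\<in>I. c i * u i e) = (\<Sum>i\<in>I. c i * lin J v (u i))"
  unfolding lin_def sum_distrib_left
  by (subst sum.swap) (simp add: algebra_simps)

lemmas lin_simps = lin_add_left lin_diff_left lin_scale_left lin_add_right lin_diff_right lin_scale_right

lemma lin_self_nonneg: "lin J u u \<ge> 0"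
  by (simp add: lin_def sum_nonneg)

text \<open>Completing the square turns the tilted standard normal density into the normal density
  with mean \<open>u\<close>.\<close>

lemma stdN_shift:
  "density stdN (\<lambda>x. ennreal (exp (x * u - u\<^sup>2 / 2))) = distr stdN borel (\<lambda>x. x + u)"
proof -
  have d0: "distributed stdN lborel (\<lambda>x. x) (normal_density 0 1)"
    unfolding distributed_def stdN_def
    by (auto simp: distr_id2)
  have "distributed stdN lborel (\<lambda>x. u + 1 * x) (normal_density (u + 1 * 0) (\<bar>1\<bar> * 1))"
    by (rule stdN.normal_density_affine) (use d0 in auto)
  then have "distr stdN borel (\<lambda>x. x + u) = density lborel (normal_density u 1)"
    by (auto simp: distributed_def add.commute cong: distr_cong)
  moreover have "density stdN (\<lambda>x. ennreal (exp (x * u - u\<^sup>2 / 2))) = density lborel (normal_density u 1)"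
    unfolding stdN_def
    apply (subst density_density_eq)
    apply (auto intro!: density_cong AE_I2 simp: normal_density_def ennreal_mult[symmetric] exp_add[symmetric])
    apply (simp add: power2_eq_square field_simps)
    done
  ultimately show ?thesis by simp
qed

lemma shift_measurable [measurable]:
  "(\<lambda>g. \<lambda>e\<in>J. g e + u e) \<in> measurable (PiM J (\<lambda>_. stdN)) (PiM J (\<lambda>_. stdN))"
proof (rule measurable_restrict)
  fix e assume "e \<in> J"
  then have "(\<lambda>g. g e) \<in> measurable (PiM J (\<lambda>_. stdN)) stdN" by (rule measurable_component_singleton)
  then show "(\<lambda>g. g e + u e) \<in> measurable (PiM J (\<lambda>_. stdN)) stdN"
    by (simp add: measurable_cong_sets[OF refl sets_stdN])
qed

text \<open>Both sides equal the product of the tilted one-dimensional laws, called \<open>N\<close>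
  in the proof, because they agree with it on rectangles: the density and the translation act on
  each coordinate separately. The translated point is restricted to \<open>J\<close> since points of
  the product space are extensional.\<close>

lemma PiM_stdN_shift:
  fixes J :: "'j set"
  assumes J: "finite J"
  shows "density (PiM J (\<lambda>_. stdN)) (\<lambda>g. ennreal (exp (lin J g u - lin J u u / 2)))
       = distr (PiM J (\<lambda>_. stdN)) (PiM J (\<lambda>_. stdN)) (\<lambda>g. \<lambda>e\<in>J. g e + u e)"
    (is "?L = ?R")
proof -
  let ?P = "PiM J (\<lambda>_. stdN)"
  let ?d = "\<lambda>e x. ennreal (exp (x * u e - (u e)\<^sup>2 / 2))"
  have prob: "prob_space (density stdN (?d e))" for e
    unfolding stdN_shift by (rule stdN.prob_space_distr) simp
  define N where "N e = density stdN (?d e)" for e :: 'j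
  interpret N: product_prob_space N J
    unfolding N_def using prob by (intro product_prob_spaceI)
  have setsN: "sets (N e) = sets borel" for e by (simp add: N_def)
  have setsP: "sets ?P = sets (PiM J N)"
    by (rule sets_PiM_cong) (auto simp: setsN)
  have "?L = PiM J N"
  proof (rule N.PiM_eqI[OF J])
    show "sets ?L = sets (PiM J N)" using setsP by simp
  next
    fix A assume A: "\<And>i. i \<in> J \<Longrightarrow> A i \<in> sets (N i)"
    then have A': "\<And>i. i \<in> J \<Longrightarrow> A i \<in> sets borel" by (simp add: setsN)
    have "Pi\<^sub>E J A \<in> sets ?P"
      using A' by (intro sets_PiM_I_finite J) auto
    then have "emeasure ?L (Pi\<^sub>E J A)
      = (\<integral>\<^sup>+g. ennreal (exp (lin J g u - lin J u u / 2)) * indicator (Pi\<^sub>E J A) g \<partial>?P)"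
      by (subst emeasure_density) auto
    also have "\<dots> = (\<integral>\<^sup>+g. (\<Prod>e\<in>J. ?d e (g e) * indicator (A e) (g e)) \<partial>?P)"
    proof (rule nn_integral_cong)
      fix g assume g: "g \<in> space ?P"
      have "exp (lin J g u - lin J u u / 2) = (\<Prod>e\<in>J. exp (g e * u e - (u e)\<^sup>2 / 2))"
        by (simp add: lin_def exp_sum[OF J, symmetric] sum_subtractf sum_divide_distrib power2_eq_square)
      then have 1: "ennreal (exp (lin J g u - lin J u u / 2)) = (\<Prod>e\<in>J. ?d e (g e))"
        by (simp add: prod_ennreal)
      have 2: "(indicator (Pi\<^sub>E J A) g :: ennreal) = (\<Prod>e\<in>J. indicator (A e) (g e))"
        using g J by (auto simp: indicator_def space_PiM PiE_iff prod_zero_iff)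
      show "ennreal (exp (lin J g u - lin J u u / 2)) * indicator (Pi\<^sub>E J A) g
        = (\<Prod>e\<in>J. ?d e (g e) * indicator (A e) (g e))"
        unfolding 1 2 by (simp add: prod.distrib)
    qed
    also have "\<dots> = (\<Prod>e\<in>J. \<integral>\<^sup>+x. ?d e x * indicator (A e) x \<partial>stdN)"
      using A' by (intro stdN_prod.product_nn_integral_prod J) auto
    also have "\<dots> = (\<Prod>e\<in>J. emeasure (N e) (A e))"
      using A' by (intro prod.cong refl) (simp add: N_def emeasure_density)
    finally show "emeasure ?L (Pi\<^sub>E J A) = (\<Prod>e\<in>J. emeasure (N e) (A e))" .
  qed
  moreover have "?R = PiM J N"
  proof (rule N.PiM_eqI[OF J])
    show "sets ?R = sets (PiM J N)" using setsP by simp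
  next
    fix A assume A: "\<And>i. i \<in> J \<Longrightarrow> A i \<in> sets (N i)"
    then have A': "\<And>i. i \<in> J \<Longrightarrow> A i \<in> sets borel" by (simp add: setsN)
    have "Pi\<^sub>E J A \<in> sets ?P"
      using A' by (intro sets_PiM_I_finite J) auto
    then have "emeasure ?R (Pi\<^sub>E J A)
      = emeasure ?P ((\<lambda>g. \<lambda>e\<in>J. g e + u e) -` Pi\<^sub>E J A \<inter> space ?P)"
      by (subst emeasure_distr) auto
    also have "(\<lambda>g. \<lambda>e\<in>J. g e + u e) -` Pi\<^sub>E J A \<inter> space ?P
        = Pi\<^sub>E J (\<lambda>e. (\<lambda>x. x + u e) -` A e)"
      by (auto simp: space_PiM PiE_iff extensional_def)
    also have "emeasure ?P \<dots> = (\<Prod>e\<in>J. emeasure stdN ((\<lambda>x. x + u e) -` A e))"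
    proof (intro stdN_prod.emeasure_PiM J)
      fix e assume "e \<in> J"
      then have "(\<lambda>x. x + u e) -` A e \<inter> space borel \<in> sets borel"
        by (intro measurable_sets[of _ borel borel]) (use A' in auto)
      then show "(\<lambda>x. x + u e) -` A e \<in> sets stdN" by simp
    qed
    also have "\<dots> = (\<Prod>e\<in>J. emeasure (N e) (A e))"
      using A' by (intro prod.cong refl) (auto simp: N_def stdN_shift emeasure_distr)
    finally show "emeasure ?R (Pi\<^sub>E J A) = (\<Prod>e\<in>J. emeasure (N e) (A e))" .
  qed
  ultimately show ?thesis by simp
qed

lemma lin_cong: "(\<And>e. e \<in> J \<Longrightarrow> u e = u' e) \<Longrightarrow> (\<And>e. e \<in> J \<Longrightarrow> v e = v' e) \<Longrightarrow> lin J u v = lin J u' v'"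
  unfolding lin_def by (intro sum.cong) auto

text \<open>Up to the factor \<open>exp (lin J u u / 2)\<close> the exponential is the density of
  the translated measure, so an exponential tilt can be traded for a shift of the argument.\<close>

lemma cameron_martin:
  fixes G :: "('j \<Rightarrow> real) \<Rightarrow> real"
  assumes J: "finite J" and [measurable]: "G \<in> borel_measurable (PiM J (\<lambda>_. stdN))"
  shows "(\<integral>g. G g * exp (lin J g u) \<partial>PiM J (\<lambda>_. stdN))
       = exp (lin J u u / 2) * (\<integral>g. G (\<lambda>e\<in>J. g e + u e) \<partial>PiM J (\<lambda>_. stdN))" (is ?A)
   and "integrable (PiM J (\<lambda>_. stdN)) (\<lambda>g. G g * exp (lin J g u))
     \<longleftrightarrow> integrable (PiM J (\<lambda>_. stdN)) (\<lambda>g. G (\<lambda>e\<in>J. g e + u e))" (is ?B)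
proof -
  let ?P = "PiM J (\<lambda>_. stdN)"
  have e: "G g * exp (lin J g u) = exp (lin J u u / 2) * (exp (lin J g u - lin J u u / 2) * G g)" for g
    by (simp add: exp_diff)
  have "(\<integral>g. exp (lin J g u - lin J u u / 2) * G g \<partial>?P)
    = (\<integral>g. G g \<partial>density ?P (\<lambda>g. ennreal (exp (lin J g u - lin J u u / 2))))"
    by (subst integral_density) auto
  also have "\<dots> = (\<integral>g. G (\<lambda>e\<in>J. g e + u e) \<partial>?P)"
    unfolding PiM_stdN_shift[OF J] by (rule integral_distr) auto
  finally show ?A unfolding e by simp
  have "integrable ?P (\<lambda>g. exp (lin J g u - lin J u u / 2) * G g)
    \<longleftrightarrow> integrable (density ?P (\<lambda>g. ennreal (exp (lin J g u - lin J u u / 2)))) G"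
    by (subst integrable_density) auto
  also have "\<dots> \<longleftrightarrow> integrable ?P (\<lambda>g. G (\<lambda>e\<in>J. g e + u e))"
    unfolding PiM_stdN_shift[OF J] by (rule integrable_distr_eq) auto
  finally show ?B unfolding e by simp
qed

lemma gauss_exp:
  assumes J: "finite J"
  shows "(\<integral>g. exp (lin J g u) \<partial>PiM J (\<lambda>_. stdN)) = exp (lin J u u / 2)"
    and "integrable (PiM J (\<lambda>_. stdN)) (\<lambda>g. exp (lin J g u))"
proof -
  interpret P: prob_space "PiM J (\<lambda>_. stdN)" by (rule prob_space_PiM_stdN)
  show "(\<integral>g. exp (lin J g u) \<partial>PiM J (\<lambda>_. stdN)) = exp (lin J u u / 2)"
    and "integrable (PiM J (\<lambda>_. stdN)) (\<lambda>g. exp (lin J g u))"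
    using cameron_martin[OF J, of "\<lambda>_. 1" u] by (auto simp: P.prob_space)
qed

text \<open>Both laws have the characteristic function of a centred Gaussian with variance
  \<open>lin J u u\<close>. Writing the law as an image of \<open>stdN\<close>, not by a density,
  includes variance 0.\<close>

lemma distr_lin_stdN:
  fixes J :: "'j set"
  assumes J: "finite J"
  shows "distr (PiM J (\<lambda>_. stdN)) borel (\<lambda>g. lin J g u) = distr stdN borel (\<lambda>x. sqrt (lin J u u) * x)"
proof (rule Levy_uniqueness)
  let ?P = "PiM J (\<lambda>_. stdN)"
  interpret P: prob_space ?P by (rule prob_space_PiM_stdN)
  show "real_distribution (distr ?P borel (\<lambda>g. lin J g u))"
    by (rule P.real_distribution_distr) simp
  show "real_distribution (distr stdN borel (\<lambda>x. sqrt (lin J u u) * x))"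
    by (rule stdN.real_distribution_distr) simp
  have ch: "(\<integral>x. iexp (t * x) \<partial>stdN) = complex_of_real (exp (- (t\<^sup>2) / 2))" for t
    using fun_cong[OF char_std_normal_distribution, of t] by (simp add: char_def stdN_def)
  show "char (distr ?P borel (\<lambda>g. lin J g u)) = char (distr stdN borel (\<lambda>x. sqrt (lin J u u) * x))"
  proof
    fix t :: real
    have "char (distr ?P borel (\<lambda>g. lin J g u)) t = (\<integral>g. iexp (t * lin J g u) \<partial>?P)"
      unfolding char_def by (subst integral_distr) auto
    also have "\<dots> = (\<integral>g. (\<Prod>e\<in>J. iexp ((t * u e) * g e)) \<partial>?P)"
      by (intro Bochner_Integration.integral_cong refl)
         (simp add: lin_def sum_distrib_left exp_sum[OF J, symmetric] mult_ac)
    also have "\<dots> = (\<Prod>e\<in>J. \<integral>x. iexp ((t * u e) * x) \<partial>stdN)"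
    proof (rule stdN_prod.product_integral_prod[OF J])
      fix e
      show "integrable stdN (\<lambda>x. iexp ((t * u e) * x))"
        by (rule stdN.integrable_const_bound[of _ 1]) auto
    qed
    also have "\<dots> = (\<Prod>e\<in>J. complex_of_real (exp (- ((t * u e)\<^sup>2) / 2)))"
      by (simp only: ch)
    also have "\<dots> = complex_of_real (exp (\<Sum>e\<in>J. - ((t * u e)\<^sup>2) / 2))"
      by (simp add: exp_sum[OF J])
    also have "(\<Sum>e\<in>J. - ((t * u e)\<^sup>2) / 2) = - ((t * sqrt (lin J u u))\<^sup>2) / 2"
      by (simp add: power_mult_distrib lin_self_nonneg real_sqrt_pow2)
         (simp add: lin_def sum_distrib_left sum_divide_distrib sum_negf power2_eq_square algebra_simps)
    also have "complex_of_real (exp \<dots>) = (\<integral>x. iexp ((t * sqrt (lin J u u)) * x) \<partial>stdN)"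
      by (simp only: ch)
    also have "\<dots> = char (distr stdN borel (\<lambda>x. sqrt (lin J u u) * x)) t"
      unfolding char_def by (subst integral_distr) (auto simp: mult_ac)
    finally show "char (distr ?P borel (\<lambda>g. lin J g u)) t = \<dots>" .
  qed
qed

lemma integral_lin_stdN:
  fixes \<phi> :: "real \<Rightarrow> real"
  assumes "finite J" and [measurable]: "\<phi> \<in> borel_measurable borel"
  shows "(\<integral>g. \<phi> (lin J g u) \<partial>PiM J (\<lambda>_. stdN)) = (\<integral>x. \<phi> (sqrt (lin J u u) * x) \<partial>stdN)"
    and "integrable (PiM J (\<lambda>_. stdN)) (\<lambda>g. \<phi> (lin J g u))
      \<longleftrightarrow> integrable stdN (\<lambda>x. \<phi> (sqrt (lin J u u) * x))"
proof -
  have "(\<integral>g. \<phi> (lin J g u) \<partial>PiM J (\<lambda>_. stdN)) = (\<integral>x. \<phi> x \<partial>distr (PiM J (\<lambda>_. stdN)) borel (\<lambda>g. lin J g u))"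
    by (subst integral_distr) auto
  also have "\<dots> = (\<integral>x. \<phi> (sqrt (lin J u u) * x) \<partial>stdN)"
    unfolding distr_lin_stdN[OF assms(1)] by (subst integral_distr) auto
  finally show "(\<integral>g. \<phi> (lin J g u) \<partial>PiM J (\<lambda>_. stdN)) = (\<integral>x. \<phi> (sqrt (lin J u u) * x) \<partial>stdN)" .
  have "integrable (PiM J (\<lambda>_. stdN)) (\<lambda>g. \<phi> (lin J g u)) \<longleftrightarrow>
     integrable (distr (PiM J (\<lambda>_. stdN)) borel (\<lambda>g. lin J g u)) \<phi>"
    by (subst integrable_distr_eq) auto
  also have "\<dots> \<longleftrightarrow> integrable stdN (\<lambda>x. \<phi> (sqrt (lin J u u) * x))"
    unfolding distr_lin_stdN[OF assms(1)] by (subst integrable_distr_eq) auto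
  finally show "integrable (PiM J (\<lambda>_. stdN)) (\<lambda>g. \<phi> (lin J g u)) \<longleftrightarrow> \<dots>" .
qed

lemma stdN_moments:
  "integrable stdN (\<lambda>x. x)" "(\<integral>x. x \<partial>stdN) = 0"
  "integrable stdN (\<lambda>x. x\<^sup>2)" "(\<integral>x. x\<^sup>2 \<partial>stdN) = 1"
proof -
  show "integrable stdN (\<lambda>x. x)" "(\<integral>x. x \<partial>stdN) = 0"
    using integrable_normal_moment_nz_1[of 1 0] integral_normal_moment_nz_1[of 1 0]
    by (simp_all add: stdN_def integrable_density integral_density)
  show "integrable stdN (\<lambda>x. x\<^sup>2)" "(\<integral>x. x\<^sup>2 \<partial>stdN) = 1"
    using integrable_normal_moment[of 1 0 2] integral_normal_moment_even[of 1 0 1]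
    by (simp_all add: stdN_def integrable_density integral_density)
qed

lemma gauss_linear:
  assumes J: "finite J"
  shows "integrable (PiM J (\<lambda>_. stdN)) (\<lambda>g. lin J g u)"
    and "(\<integral>g. lin J g u \<partial>PiM J (\<lambda>_. stdN)) = 0"
    and "integrable (PiM J (\<lambda>_. stdN)) (\<lambda>g. (lin J g u)\<^sup>2)"
    and "(\<integral>g. (lin J g u)\<^sup>2 \<partial>PiM J (\<lambda>_. stdN)) = lin J u u"
  using integral_lin_stdN[OF J, of "\<lambda>x. x" u] integral_lin_stdN[OF J, of "\<lambda>x. x\<^sup>2" u]
  by (simp_all add: stdN_moments power_mult_distrib lin_self_nonneg)

text \<open>Polarisation of the second moment. Thus \<open>lin\<close> plays two roles: with the
  Gaussian argument \<open>g\<close> it is a field, with two deterministic arguments the covariance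
  of two fields.\<close>

lemma gauss_product:
  assumes J: "finite J"
  shows "integrable (PiM J (\<lambda>_. stdN)) (\<lambda>g. lin J g u * lin J g v)"
    and "(\<integral>g. lin J g u * lin J g v \<partial>PiM J (\<lambda>_. stdN)) = lin J u v"
proof -
  have *: "lin J g u * lin J g v =
     ((lin J g (\<lambda>e. u e + v e))\<^sup>2 - (lin J g (\<lambda>e. u e - v e))\<^sup>2) / 4" for g
    by (simp add: lin_simps power2_eq_square algebra_simps)
  show "integrable (PiM J (\<lambda>_. stdN)) (\<lambda>g. lin J g u * lin J g v)"
    unfolding * by (auto intro!: gauss_linear J Bochner_Integration.integrable_diff)
  show "(\<integral>g. lin J g u * lin J g v \<partial>PiM J (\<lambda>_. stdN)) = lin J u v"
    unfolding * by (simp add: gauss_linear J) (simp add: lin_simps lin_commute[of J v u])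
qed

text \<open>\<open>sqrt Q * x\<close> has the law of \<open>sqrt q * x \<plusminus> sqrt (Q - q) * x'\<close>; averaging both signs removes the first order.\<close>

lemma gauss_second_difference:
  fixes \<phi> :: "real \<Rightarrow> real"
  assumes [measurable]: "\<phi> \<in> borel_measurable borel" and bdd: "\<And>x. \<bar>\<phi> x\<bar> \<le> B"
    and sd: "\<And>x y. \<bar>\<phi> (x + y) + \<phi> (x - y) - 2 * \<phi> x\<bar> \<le> M * y\<^sup>2"
    and q: "0 \<le> q" "0 \<le> Q"
  shows "\<bar>(\<integral>x. \<phi> (sqrt Q * x) \<partial>stdN) - (\<integral>x. \<phi> (sqrt q * x) \<partial>stdN)\<bar> \<le> M / 2 * \<bar>Q - q\<bar>"
proof -
  have main: "\<bar>(\<integral>x. \<phi> (sqrt Q * x) \<partial>stdN) - (\<integral>x. \<phi> (sqrt q * x) \<partial>stdN)\<bar> \<le> M / 2 * (Q - q)"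
    if "0 \<le> q" "q \<le> Q" for q Q
  proof -
    \<comment> \<open>Two independent Gaussians: the coordinate \<open>False\<close> carries the
      common part of variance \<open>q\<close>, the coordinate \<open>True\<close> the excess
      \<open>Q - q\<close>.\<close>
    let ?J = "{False, True}"
    let ?P = "PiM ?J (\<lambda>_. stdN)"
    \<comment> \<open>The signs \<open>s = 1\<close> and \<open>s = -1\<close> both give variance
      \<open>Q\<close>, while \<open>s = 0\<close> gives \<open>q\<close>; one family supplies the
      three terms of the second difference.\<close>
    define u where "u s x = (if x then s * sqrt (Q - q) else sqrt q)" for s x
    interpret P: prob_space ?P by (rule prob_space_PiM_stdN)
    have lu: "lin ?J (u s) (u s) = q + s\<^sup>2 * (Q - q)" for s
      using that by (simp add: lin_def u_def power2_eq_square[symmetric] power_mult_distrib)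
    have X: "(\<integral>g. \<phi> (lin ?J g (u s)) \<partial>?P) = (\<integral>x. \<phi> (sqrt (q + s\<^sup>2 * (Q - q)) * x) \<partial>stdN)" for s
      by (subst integral_lin_stdN) (auto simp: lu)
    have I: "integrable ?P (\<lambda>g. \<phi> (lin ?J g (u s)))" for s
      by (rule P.integrable_const_bound[of _ B]) (use bdd in auto)
    define w where "w x = (if x then sqrt (Q - q) else 0)" for x
    have lw: "lin ?J w w = Q - q" using that by (simp add: lin_def w_def)
    have us: "lin ?J g (u s) = lin ?J g (u 0) + s * lin ?J g w" for s g
      by (simp add: lin_def u_def w_def)
    let ?D = "\<lambda>g. \<phi> (lin ?J g (u 1)) + \<phi> (lin ?J g (u (-1))) - 2 * \<phi> (lin ?J g (u 0))"
    have ID: "integrable ?P ?D"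
      by (intro Bochner_Integration.integrable_add Bochner_Integration.integrable_diff integrable_mult_right I)
    have 1: "2 * ((\<integral>x. \<phi> (sqrt Q * x) \<partial>stdN) - (\<integral>x. \<phi> (sqrt q * x) \<partial>stdN)) = (\<integral>g. ?D g \<partial>?P)"
      using X[of 1] X[of "-1"] X[of 0] I by simp
    have 2: "(\<integral>g. \<bar>?D g\<bar> \<partial>?P) \<le> (\<integral>g. M * (lin ?J g w)\<^sup>2 \<partial>?P)"
    proof (rule integral_mono)
      show "integrable ?P (\<lambda>g. M * (lin ?J g w)\<^sup>2)"
        by (rule integrable_mult_right, rule gauss_linear) simp
      show "\<bar>?D g\<bar> \<le> M * (lin ?J g w)\<^sup>2" for g
        using sd[of "lin ?J g (u 0)" "lin ?J g w"] unfolding us[of g 1] us[of g "-1"] by simp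
      show "integrable ?P (\<lambda>g. \<bar>?D g\<bar>)"
        by (rule integrable_abs[OF ID])
    qed
    have 3: "(\<integral>g. M * (lin ?J g w)\<^sup>2 \<partial>?P) = M * (Q - q)"
      using gauss_linear(4)[of ?J w] lw by simp
    have "\<bar>\<integral>g. ?D g \<partial>?P\<bar> \<le> M * (Q - q)"
      using integral_abs_bound[of ?P ?D] 2 3 by linarith
    then show ?thesis unfolding 1[symmetric] by (simp only: abs_mult) simp
  qed
  show ?thesis
    using main[of q Q] main[of Q q] q by (cases "q \<le> Q") (auto simp: abs_minus_commute)
qed

section \<open>Finite exponential families\<close>

text \<open>A one-spin Gibbs mean as a function of the external field \<open>x\<close>. The weights
  stay arbitrary so that later D, h and the Gaussian correction can all be hidden in them.\<close>

definition eavg :: "'e set \<Rightarrow> ('e \<Rightarrow> real) \<Rightarrow> ('e \<Rightarrow> real) \<Rightarrow> ('e \<Rightarrow> real) \<Rightarrow> real \<Rightarrow> real" where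
  "eavg E w c F x = (\<Sum>e\<in>E. F e * (w e * exp (c e * x))) / (\<Sum>e\<in>E. w e * exp (c e * x))"

text \<open>A vanishing total weight is allowed: the quotient is then 0 by convention, and
  \<open>0 \<le> B\<close> covers that case.\<close>

lemma weighted_mean_bound:
  fixes w F :: "'e \<Rightarrow> real"
  assumes "finite E" "\<And>e. e \<in> E \<Longrightarrow> 0 \<le> w e" "\<And>e. e \<in> E \<Longrightarrow> \<bar>F e\<bar> \<le> B" "0 \<le> B"
  shows "\<bar>(\<Sum>e\<in>E. F e * w e) / (\<Sum>e\<in>E. w e)\<bar> \<le> B"
proof (cases "(\<Sum>e\<in>E. w e) = 0")
  case False
  then have pos: "0 < (\<Sum>e\<in>E. w e)" using sum_nonneg[of E w] assms by force
  have "\<bar>\<Sum>e\<in>E. F e * w e\<bar> \<le> (\<Sum>e\<in>E. \<bar>F e * w e\<bar>)" by (rule sum_abs)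
  also have "\<dots> \<le> (\<Sum>e\<in>E. B * w e)"
    using assms by (intro sum_mono) (auto simp: abs_mult intro!: mult_right_mono)
  also have "\<dots> = B * (\<Sum>e\<in>E. w e)" by (simp add: sum_distrib_left)
  finally show ?thesis using pos by (simp add: field_simps)
qed (use assms in simp)

locale expfam =
  fixes E :: "'e set" and w c :: "'e \<Rightarrow> real" and C :: real
  assumes E: "finite E" "E \<noteq> {}" and w: "\<And>e. e \<in> E \<Longrightarrow> 0 < w e"
    and c: "\<And>e. e \<in> E \<Longrightarrow> \<bar>c e\<bar> \<le> C"
begin

abbreviation "Z x \<equiv> \<Sum>e\<in>E. w e * exp (c e * x)"

lemma C_nonneg: "0 \<le> C"
  using E c by (meson abs_ge_zero all_not_in_conv order_trans)

lemma Z_pos: "0 < Z x"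
  using E w by (intro sum_pos) auto

lemma eavg_bound: "0 \<le> B \<Longrightarrow> (\<And>e. e \<in> E \<Longrightarrow> \<bar>F e\<bar> \<le> B) \<Longrightarrow> \<bar>eavg E w c F x\<bar> \<le> B"
  unfolding eavg_def
  by (rule weighted_mean_bound) (use E in \<open>auto intro!: mult_nonneg_nonneg less_imp_le[OF w]\<close>)

text \<open>The derivative of a Gibbs mean in the field is the covariance of the observable with the
  conjugate variable \<open>c\<close>.\<close>

lemma eavg_deriv:
  "(eavg E w c F has_real_derivative
     eavg E w c (\<lambda>e. F e * c e) x - eavg E w c F x * eavg E w c c x) (at x)"
proof -
  have num: "((\<lambda>x. \<Sum>e\<in>E. G e * (w e * exp (c e * x))) has_real_derivative
      (\<Sum>e\<in>E. G e * c e * (w e * exp (c e * x)))) (at x)" for G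
    by (rule DERIV_sum) (auto intro!: derivative_eq_intros)
  show ?thesis
    using DERIV_divide[OF num[of F] num[of "\<lambda>_. 1"]] Z_pos[of x]
    unfolding eavg_def by (simp add: diff_divide_distrib)
qed

text \<open>The covariance is at most \<open>2 * B * C\<close> whatever the weights are; this is the
  source of uniformity in D and h.\<close>

lemma eavg_lipschitz:
  assumes B: "0 \<le> B" "\<And>e. e \<in> E \<Longrightarrow> \<bar>F e\<bar> \<le> B"
  shows "\<bar>eavg E w c F x - eavg E w c F y\<bar> \<le> 2 * B * C * \<bar>x - y\<bar>"
proof -
  have "norm (eavg E w c F x - eavg E w c F y) \<le> 2 * B * C * norm (x - y)"
  proof (rule field_differentiable_bound[OF convex_UNIV])
    fix z
    show "(eavg E w c F has_field_derivative
     eavg E w c (\<lambda>e. F e * c e) z - eavg E w c F z * eavg E w c c z) (at z within UNIV)"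
      using eavg_deriv by simp
    have "\<bar>eavg E w c (\<lambda>e. F e * c e) z\<bar> \<le> B * C"
      using B c C_nonneg by (intro eavg_bound) (auto simp: abs_mult intro!: mult_mono)
    moreover have "\<bar>eavg E w c F z * eavg E w c c z\<bar> \<le> B * C"
      using B c C_nonneg by (auto simp: abs_mult intro!: mult_mono eavg_bound)
    ultimately show "norm (eavg E w c (\<lambda>e. F e * c e) z - eavg E w c F z * eavg E w c c z) \<le> 2 * B * C"
      by simp
  qed auto
  then show ?thesis by simp
qed

text \<open>The derivative, a covariance, is Lipschitz with constant
  \<open>6 * B * C\<^sup>2\<close>: 2 from the mean of the product and 4 from the product of the
  means. The mean value theorem on both sides of \<open>x\<close> gives two points at distance at
  most \<open>2 * \<bar>y\<bar>\<close>, hence 12.\<close>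

lemma eavg_second_difference:
  assumes B: "0 \<le> B" "\<And>e. e \<in> E \<Longrightarrow> \<bar>F e\<bar> \<le> B"
  shows "\<bar>eavg E w c F (x + y) + eavg E w c F (x - y) - 2 * eavg E w c F x\<bar> \<le> 12 * B * C\<^sup>2 * y\<^sup>2"
proof -
  let ?f = "eavg E w c F"
  define f' where "f' z = eavg E w c (\<lambda>e. F e * c e) z - ?f z * eavg E w c c z" for z
  have lip: "\<bar>f' u - f' v\<bar> \<le> 6 * B * C\<^sup>2 * \<bar>u - v\<bar>" for u v
  proof -
    have 1: "\<bar>eavg E w c (\<lambda>e. F e * c e) u - eavg E w c (\<lambda>e. F e * c e) v\<bar> \<le> 2 * (B * C) * C * \<bar>u - v\<bar>"
      using B c C_nonneg by (intro eavg_lipschitz) (auto simp: abs_mult intro!: mult_mono)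
    have "?f u * eavg E w c c u - ?f v * eavg E w c c v
      = ?f u * (eavg E w c c u - eavg E w c c v) + (?f u - ?f v) * eavg E w c c v"
      by (simp add: algebra_simps)
    then have "\<bar>?f u * eavg E w c c u - ?f v * eavg E w c c v\<bar>
      \<le> \<bar>?f u\<bar> * \<bar>eavg E w c c u - eavg E w c c v\<bar> + \<bar>?f u - ?f v\<bar> * \<bar>eavg E w c c v\<bar>"
      by (metis abs_mult abs_triangle_ineq)
    also have "\<dots> \<le> B * (2 * C * C * \<bar>u - v\<bar>) + (2 * B * C * \<bar>u - v\<bar>) * C"
      using B c C_nonneg by (intro add_mono mult_mono eavg_bound eavg_lipschitz) auto
    finally have "\<bar>?f u * eavg E w c c u - ?f v * eavg E w c c v\<bar> \<le> 4 * B * C\<^sup>2 * \<bar>u - v\<bar>"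
      by (simp add: power2_eq_square algebra_simps)
    with 1 show ?thesis unfolding f'_def by (simp add: power2_eq_square algebra_simps)
  qed
  have mvt: "\<exists>z. \<bar>z - x\<bar> \<le> \<bar>y\<bar> \<and> ?f (x + y) - ?f x = y * f' z" for x y
  proof -
    have d: "(?f has_real_derivative f' z) (at z)" for z
      unfolding f'_def by (rule eavg_deriv)
    consider "y = 0" | "y > 0" | "y < 0" by linarith
    then show ?thesis
    proof cases
      case 2
      then have "x < x + y" by simp
      from MVT2[OF this d] obtain z where "x < z" "z < x + y" "?f (x + y) - ?f x = (x + y - x) * f' z" by blast
      then show ?thesis by (intro exI[of _ z]) auto
    next
      case 3
      then have "x + y < x" by simp
      from MVT2[OF this d] obtain z where "x + y < z" "z < x" "?f x - ?f (x + y) = (x - (x + y)) * f' z" by blast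
      then show ?thesis by (intro exI[of _ z]) (auto simp: algebra_simps)
    qed auto
  qed
  obtain z1 where z1: "\<bar>z1 - x\<bar> \<le> \<bar>y\<bar>" "?f (x + y) - ?f x = y * f' z1" using mvt by blast
  obtain z2 where z2: "\<bar>z2 - x\<bar> \<le> \<bar>y\<bar>" "?f (x - y) - ?f x = - y * f' z2"
    using mvt[of x "- y"] by auto
  have "\<bar>?f (x + y) + ?f (x - y) - 2 * ?f x\<bar> = \<bar>y\<bar> * \<bar>f' z1 - f' z2\<bar>"
    using z1(2) z2(2) by (simp add: abs_mult[symmetric] algebra_simps)
  also have "\<dots> \<le> \<bar>y\<bar> * (6 * B * C\<^sup>2 * \<bar>z1 - z2\<bar>)"
    by (intro mult_left_mono lip) auto
  also have "\<dots> \<le> \<bar>y\<bar> * (6 * B * C\<^sup>2 * (2 * \<bar>y\<bar>))"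
    using z1(1) z2(1) B by (intro mult_left_mono) auto
  also have "\<dots> = 12 * B * C\<^sup>2 * y\<^sup>2"
    by (simp add: power2_eq_square algebra_simps abs_mult_self_eq)
  finally show ?thesis .
qed

lemma eavg_measurable [measurable]: "eavg E w c F \<in> borel_measurable borel"
  unfolding eavg_def by measurable

end

section \<open>Elementary inequalities\<close>

lemma abs_exp_minus_one_le: "\<bar>exp x - 1\<bar> \<le> \<bar>x\<bar> * exp \<bar>x\<bar>" for x :: real
proof (cases "x \<ge> 0")
  case True
  have "1 - x \<le> exp (- x)" using exp_ge_add_one_self[of "- x"] by simp
  then have "(1 - x) * exp x \<le> 1" using mult_right_mono[of "1 - x" "exp (- x)" "exp x"] by (simp add: exp_minus)
  with True show ?thesis by (simp add: algebra_simps)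
next
  case False
  have "1 - exp x \<le> - x" using exp_ge_add_one_self[of x] by linarith
  moreover have "- x \<le> - x * exp (- x)" using False by (simp add: mult_le_cancel_left1)
  moreover have "\<bar>exp x - 1\<bar> = 1 - exp x" "\<bar>x\<bar> * exp \<bar>x\<bar> = - x * exp (- x)" using False by auto
  ultimately show ?thesis by linarith
qed

lemma abs_exp_minus_one_minus_le: "\<bar>exp x - 1 - x\<bar> \<le> x\<^sup>2 * exp \<bar>x\<bar>" for x :: real
proof -
  obtain t where t: "\<bar>t\<bar> \<le> \<bar>x\<bar>" "exp x = (\<Sum>m<2. x ^ m / fact m) + exp t / fact 2 * x ^ 2"
    using Maclaurin_exp_le[of x 2] by blast
  then have "exp x - 1 - x = exp t / 2 * x\<^sup>2" by (simp add: numeral_2_eq_2)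
  moreover have "exp t \<le> exp \<bar>x\<bar>" using t by simp
  ultimately have "\<bar>exp x - 1 - x\<bar> = x\<^sup>2 * (exp t / 2)" by (simp only: abs_mult) simp
  also have "\<dots> \<le> x\<^sup>2 * exp \<bar>x\<bar>"
    using \<open>exp t \<le> exp \<bar>x\<bar>\<close> exp_gt_zero[of t]
    by (intro mult_left_mono) (linarith, simp)
  finally show ?thesis .
qed

text \<open>The difference of the two sides is the sum of the 15 squares of pairwise differences.
  Six is the number of terms in the error bound \<open>\<eta>\<close> below.\<close>

lemma square_sum6: "(x1 + x2 + x3 + x4 + x5 + x6 :: real)\<^sup>2 \<le> 6 * (x1\<^sup>2 + x2\<^sup>2 + x3\<^sup>2 + x4\<^sup>2 + x5\<^sup>2 + x6\<^sup>2)"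
proof -
  have "0 \<le> (x1-x2)\<^sup>2 + (x1-x3)\<^sup>2 + (x1-x4)\<^sup>2 + (x1-x5)\<^sup>2 + (x1-x6)\<^sup>2 + (x2-x3)\<^sup>2 + (x2-x4)\<^sup>2
    + (x2-x5)\<^sup>2 + (x2-x6)\<^sup>2 + (x3-x4)\<^sup>2 + (x3-x5)\<^sup>2 + (x3-x6)\<^sup>2 + (x4-x5)\<^sup>2 + (x4-x6)\<^sup>2 + (x5-x6)\<^sup>2"
    by (intro add_nonneg_nonneg) auto
  then show ?thesis by (simp add: power2_eq_square algebra_simps)
qed

lemma exp_abs_le: "exp \<bar>x\<bar> \<le> exp x + exp (- x)" for x :: real
  by (cases "0 \<le> x") auto

lemma sum_abs_square_le: "finite I \<Longrightarrow> (\<Sum>i\<in>I. \<bar>a i\<bar> :: real)\<^sup>2 \<le> real (card I) * (\<Sum>i\<in>I. (a i)\<^sup>2)"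
  using Cauchy_Schwarz_ineq_sum[of "\<lambda>_. 1" "\<lambda>i. \<bar>a i\<bar>" I] by simp

section \<open>Cavity fields\<close>

locale finite_mean =
  fixes \<Omega> :: "'s set" and \<mu> :: "'s \<Rightarrow> real"
  assumes fin_Omega: "finite \<Omega>" and mu_nonneg: "\<And>s. s \<in> \<Omega> \<Longrightarrow> 0 \<le> \<mu> s" and mu_sum: "(\<Sum>s\<in>\<Omega>. \<mu> s) = 1"
begin

definition avg :: "('s \<Rightarrow> real) \<Rightarrow> real" where "avg f = (\<Sum>s\<in>\<Omega>. \<mu> s * f s)"

abbreviation "avg2 f \<equiv> avg (\<lambda>s. avg (\<lambda>t. f s t))"

lemma avg_const [simp]: "avg (\<lambda>_. c) = c"
  by (simp add: avg_def sum_distrib_right[symmetric] mu_sum)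

lemma avg_add: "avg (\<lambda>s. f s + g s) = avg f + avg g"
  by (simp add: avg_def algebra_simps sum.distrib)

lemma avg_diff: "avg (\<lambda>s. f s - g s) = avg f - avg g"
  by (simp add: avg_def algebra_simps sum_subtractf)

lemma avg_cmult: "avg (\<lambda>s. c * f s) = c * avg f"
  by (simp add: avg_def sum_distrib_left mult_ac)

lemma avg_multc: "avg (\<lambda>s. f s * c) = avg f * c"
  by (simp add: avg_def sum_distrib_right mult.assoc)

lemma avg_sum: "avg (\<lambda>s. \<Sum>i\<in>I. f i s) = (\<Sum>i\<in>I. avg (f i))"
  unfolding avg_def sum_distrib_left by (rule sum.swap)

lemma avg_mono: "(\<And>s. s \<in> \<Omega> \<Longrightarrow> f s \<le> g s) \<Longrightarrow> avg f \<le> avg g"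
  unfolding avg_def by (intro sum_mono mult_left_mono mu_nonneg) auto

lemma avg_cong: "(\<And>s. s \<in> \<Omega> \<Longrightarrow> f s = g s) \<Longrightarrow> avg f = avg g"
  unfolding avg_def by (intro sum.cong) auto

lemma avg_abs: "\<bar>avg f\<bar> \<le> avg (\<lambda>s. \<bar>f s\<bar>)"
  unfolding avg_def by (rule order_trans[OF sum_abs]) (auto simp: abs_mult mu_nonneg intro!: sum_mono)

lemma avg_nonneg: "(\<And>s. s \<in> \<Omega> \<Longrightarrow> 0 \<le> f s) \<Longrightarrow> 0 \<le> avg f"
  using avg_mono[of "\<lambda>_. 0" f] by simp

lemma avg_abs_le: "(\<And>s. s \<in> \<Omega> \<Longrightarrow> \<bar>f s\<bar> \<le> B) \<Longrightarrow> \<bar>avg f\<bar> \<le> B"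
  using avg_abs[of f] avg_mono[of "\<lambda>s. \<bar>f s\<bar>" "\<lambda>_. B"] by simp

lemma avg_square: "(avg f)\<^sup>2 \<le> avg (\<lambda>s. (f s)\<^sup>2)"
proof -
  have "0 \<le> avg (\<lambda>s. (f s - avg f)\<^sup>2)" by (rule avg_nonneg) simp
  also have "\<dots> = avg (\<lambda>s. (f s)\<^sup>2 - 2 * avg f * f s + (avg f)\<^sup>2)"
    by (rule avg_cong) (simp add: power2_eq_square algebra_simps)
  also have "\<dots> = avg (\<lambda>s. (f s)\<^sup>2) - (avg f)\<^sup>2"
    by (simp add: avg_add avg_diff avg_cmult power2_eq_square)
  finally show ?thesis by simp
qed

lemma avg_mult_avg: "avg f * avg g = avg2 (\<lambda>s t. f s * g t)"
  by (simp add: avg_cmult avg_multc)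

text \<open>Jensen's inequality, from the tangent of \<open>exp\<close> at the mean.\<close>

lemma avg_exp: "exp (avg f) \<le> avg (\<lambda>s. exp (f s))"
proof -
  have "avg (\<lambda>s. exp (avg f) * (1 + (f s - avg f))) \<le> avg (\<lambda>s. exp (f s))"
  proof (rule avg_mono)
    fix s
    have "exp (avg f) * (1 + (f s - avg f)) \<le> exp (avg f) * exp (f s - avg f)"
      by (intro mult_left_mono exp_ge_add_one_self) auto
    then show "exp (avg f) * (1 + (f s - avg f)) \<le> exp (f s)"
      by (simp add: exp_add[symmetric])
  qed
  then show ?thesis by (simp add: avg_cmult avg_add avg_diff)
qed

end

text \<open>\<open>\<Omega>\<close> are the configurations of the remaining sites, with their Gibbs weights \<open>\<mu>\<close>; \<open>v s\<close> is the
  configuration \<open>s\<close> divided by \<open>sqrt N\<close>, so that the field on the removed site is \<open>lin J g (v s)\<close>; \<open>\<Gamma>\<close> are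
  the values of the removed spin and \<open>w\<close> its weights without that field.\<close>

locale cavity = finite_mean \<Omega> \<mu> for \<Omega> :: "'s set" and \<mu> +
  fixes J :: "'j set" and v :: "'s \<Rightarrow> 'j \<Rightarrow> real" and \<Gamma> :: "int set" and w :: "int \<Rightarrow> real"
    and L b p q :: real
  assumes fin_J: "finite J"
    and lin_v: "\<And>s t. s \<in> \<Omega> \<Longrightarrow> t \<in> \<Omega> \<Longrightarrow> \<bar>lin J (v s) (v t)\<bar> \<le> L\<^sup>2"
    and fin_Gamma: "finite \<Gamma>" and Gamma_ne: "\<Gamma> \<noteq> {}"
    and Gamma_bound: "\<And>\<gamma>. \<gamma> \<in> \<Gamma> \<Longrightarrow> \<bar>real_of_int \<gamma>\<bar> \<le> L"
    and w_pos: "\<And>\<gamma>. \<gamma> \<in> \<Gamma> \<Longrightarrow> 0 < w \<gamma>"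
    and L1: "1 \<le> L" and b0: "0 \<le> b" and bL: "b * L\<^sup>2 \<le> 1"
    and p_bounds: "0 \<le> p" "p \<le> L\<^sup>2" and q_bounds: "0 \<le> q" "q \<le> L\<^sup>2"
begin

abbreviation "P \<equiv> PiM J (\<lambda>_. stdN)"
text \<open>The variance predicted for the field under \<open>\<mu>\<close> after centring:
  self-overlap minus overlap of two replicas.\<close>

definition "r = p - q"
text \<open>The vector of magnetisations of the remaining spins; \<open>lin J g vb\<close> is the
  mean field on the removed site, and \<open>vd s\<close> carries the fluctuation around it.\<close>

definition "vb e = avg (\<lambda>s. v s e)"
definition "vd s e = v s e - vb e"
abbreviation "t \<gamma> \<equiv> b * real_of_int \<gamma>"
definition "d s s' = lin J (v s) (v s') - q"
definition "\<epsilon> s = lin J (v s) (v s) - p"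
definition "D1 s = avg (\<lambda>s'. \<bar>d s s'\<bar>)"
definition "D0 = avg D1"
text \<open>One symmetric majorant for all overlap errors. Centring the configurations brings in
  averages of \<open>d\<close> over one or both replicas, which accounts for \<open>D1\<close> and
  \<open>D0\<close>.\<close>

definition "\<eta> s s' = \<bar>d s s'\<bar> + D1 s + D1 s' + D0 + \<bar>\<epsilon> s\<bar> + \<bar>\<epsilon> s'\<bar>"
definition "W = avg2 (\<lambda>s s'. (d s s')\<^sup>2) + avg (\<lambda>s. (\<epsilon> s)\<^sup>2)"

sublocale P: prob_space P by (rule prob_space_PiM_stdN)

lemma r_bound: "\<bar>r\<bar> \<le> L\<^sup>2"
  using p_bounds q_bounds by (simp add: r_def)

lemma lin_vb: "lin J u vb = avg (\<lambda>s. lin J u (v s))"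
  unfolding vb_def avg_def by (rule lin_sum_right)

lemma lin_vb': "lin J vb u = avg (\<lambda>s. lin J (v s) u)"
  by (simp add: lin_commute[of J _ u] lin_vb)

lemma vd_eq: "vd s = (\<lambda>e. v s e - vb e)"
  by (simp add: vd_def fun_eq_iff)

lemma d_sym: "d s s' = d s' s" by (simp add: d_def lin_commute)

lemma vb_vb: "lin J vb vb = q + avg2 d"
  by (subst lin_vb') (simp add: lin_vb d_def[abs_def] avg_diff)

lemma v_vb: "lin J (v s) vb = q + avg (d s)"
  by (simp add: lin_vb d_def[abs_def] avg_diff)

lemma vd_vb: "lin J (vd s) vb = avg (d s) - avg2 d"
  by (simp add: vd_eq lin_diff_left v_vb vb_vb)

lemma vd_vd: "lin J (vd s) (vd s') = d s s' - avg (d s) - avg (d s') + avg2 d"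
proof -
  have "lin J (vd s) (vd s') = lin J (vd s) (v s') - lin J (vd s) vb"
    by (subst vd_eq[of s']) (simp add: lin_diff_right)
  also have "lin J (vd s) (v s') = lin J (v s) (v s') - lin J (v s') vb"
    by (simp add: vd_eq lin_diff_left lin_commute[of J vb])
  finally show ?thesis by (simp add: v_vb vd_vb d_def)
qed

lemma vd_self: "lin J (vd s) (vd s) - r = \<epsilon> s - 2 * avg (d s) + avg2 d"
  by (simp add: vd_vd r_def \<epsilon>_def d_def)

text \<open>A centred vector has mean zero over the second replica. This is the cancellation that
  removes the first order from the second moments of \<open>y\<close> and \<open>z\<close>.\<close>

lemma avg_vd_vd: "avg (\<lambda>s'. lin J (vd s) (vd s')) = 0"
  by (simp add: vd_vd avg_diff avg_add)

lemma abs_avg_d: "\<bar>avg (d s)\<bar> \<le> D1 s"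
  unfolding D1_def by (rule avg_abs)

lemma abs_avg2_d: "\<bar>avg2 d\<bar> \<le> D0"
  unfolding D0_def by (rule order_trans[OF avg_abs]) (intro avg_mono abs_avg_d)

lemma D1_nonneg: "0 \<le> D1 s" unfolding D1_def by (rule avg_nonneg) simp
lemma D0_nonneg: "0 \<le> D0" unfolding D0_def by (rule avg_nonneg) (rule D1_nonneg)
lemma \<eta>_nonneg: "0 \<le> \<eta> s s'" unfolding \<eta>_def using D1_nonneg D0_nonneg by (auto intro!: add_nonneg_nonneg)

lemma \<eta>_sym: "\<eta> s s' = \<eta> s' s" by (simp add: \<eta>_def d_sym)

lemma vd_self_le: "\<bar>lin J (vd s) (vd s) - r\<bar> \<le> 2 * \<eta> s s'"
  using vd_self[of s] abs_avg_d[of s] abs_avg2_d D1_nonneg[of s] D1_nonneg[of s'] D0_nonneg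
  unfolding \<eta>_def by (smt (verit))

lemma vd_vd_le: "\<bar>lin J (vd s) (vd s')\<bar> \<le> \<eta> s s'"
  using vd_vd[of s s'] abs_avg_d[of s] abs_avg_d[of s'] abs_avg2_d D1_nonneg[of s] D1_nonneg[of s'] D0_nonneg
  unfolding \<eta>_def by (smt (verit))

lemma vd_vb_le: "\<bar>lin J (vd s) vb\<bar> \<le> \<eta> s s'"
  using vd_vb[of s] abs_avg_d[of s] abs_avg2_d D1_nonneg[of s] D1_nonneg[of s'] D0_nonneg
  unfolding \<eta>_def by (smt (verit))

lemma vb_vb_le: "\<bar>lin J vb vb - q\<bar> \<le> \<eta> s s'"
  using vb_vb abs_avg2_d D1_nonneg[of s] D1_nonneg[of s'] D0_nonneg
  unfolding \<eta>_def by (smt (verit))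

lemma d_le: "\<bar>d s s'\<bar> \<le> \<eta> s s'" "\<bar>\<epsilon> s\<bar> \<le> \<eta> s s'"
  using D1_nonneg[of s] D1_nonneg[of s'] D0_nonneg unfolding \<eta>_def by auto

text \<open>Four overlaps, each at most \<open>L\<^sup>2\<close>. This crude companion of
  \<open>vd_vd_le\<close> serves to keep exponents bounded, so that exponentials can be expanded;
  the small bound then measures the remainder.\<close>

lemma vd_vd_size: "s \<in> \<Omega> \<Longrightarrow> s' \<in> \<Omega> \<Longrightarrow> \<bar>lin J (vd s) (vd s')\<bar> \<le> 4 * L\<^sup>2"
proof -
  assume s: "s \<in> \<Omega>" "s' \<in> \<Omega>"
  have 1: "\<bar>lin J (v s) vb\<bar> \<le> L\<^sup>2" if "s \<in> \<Omega>" for s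
    unfolding lin_vb by (intro avg_abs_le lin_v that)
  have 2: "\<bar>lin J vb vb\<bar> \<le> L\<^sup>2"
    unfolding lin_vb' by (intro avg_abs_le 1)
  have "lin J (vd s) (vd s') = lin J (v s) (v s') - lin J (v s) vb - lin J (v s') vb + lin J vb vb"
    by (simp add: vd_eq lin_diff_left lin_diff_right lin_commute[of J vb "v s'"])
  then show ?thesis using 1[OF s(1)] 1[OF s(2)] 2 lin_v[OF s] by linarith
qed

lemma W_nonneg: "0 \<le> W"
  unfolding W_def by (intro add_nonneg_nonneg avg_nonneg) auto

text \<open>By Jensen the squares of \<open>D1\<close> and \<open>D0\<close> are dominated by the
  mean square of \<open>d\<close>. So the six squares contribute four times that of \<open>d\<close>
  and twice that of \<open>\<epsilon>\<close>, and 24 is 6 times 4.\<close>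

lemma avg2_eta_square: "avg2 (\<lambda>s s'. (\<eta> s s')\<^sup>2) \<le> 24 * W"
proof -
  let ?V = "avg2 (\<lambda>s s'. (d s s')\<^sup>2)"
  have D1: "(D1 s)\<^sup>2 \<le> avg (\<lambda>s'. (d s s')\<^sup>2)" for s
    unfolding D1_def using avg_square[of "\<lambda>s'. \<bar>d s s'\<bar>"] by simp
  then have D1': "avg (\<lambda>s. (D1 s)\<^sup>2) \<le> ?V" by (intro avg_mono) auto
  have D0: "D0\<^sup>2 \<le> ?V" unfolding D0_def using avg_square[of D1] D1' by linarith
  have "avg2 (\<lambda>s s'. (\<eta> s s')\<^sup>2) \<le> avg2 (\<lambda>s s'. 6 * ((d s s')\<^sup>2 + (D1 s)\<^sup>2 + (D1 s')\<^sup>2 + D0\<^sup>2 + (\<epsilon> s)\<^sup>2 + (\<epsilon> s')\<^sup>2))"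
    unfolding \<eta>_def by (intro avg_mono order_trans[OF square_sum6]) simp
  also have "\<dots> = 6 * (?V + 2 * avg (\<lambda>s. (D1 s)\<^sup>2) + D0\<^sup>2 + 2 * avg (\<lambda>s. (\<epsilon> s)\<^sup>2))"
    by (simp add: avg_cmult avg_add)
  also have "\<dots> \<le> 6 * (?V + 2 * ?V + ?V + 2 * avg (\<lambda>s. (\<epsilon> s)\<^sup>2))"
    using D1' D0 by simp
  also have "\<dots> \<le> 24 * W"
    unfolding W_def using avg_nonneg[of "\<lambda>s. (\<epsilon> s)\<^sup>2"] by simp
  finally show ?thesis .
qed

text \<open>Everything follows from \<open>b * L\<^sup>2 \<le> 1\<close>. The product of
  \<open>(t \<gamma>)\<^sup>2\<close> with a covariance of order \<open>L\<^sup>2\<close> is then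
  bounded by an absolute constant, while \<open>(t \<gamma>)\<^sup>2 \<le> b\<close> provides the
  gain of one power of \<open>b\<close>.\<close>

lemma t_bounds:
  assumes "\<gamma> \<in> \<Gamma>"
  shows "\<bar>t \<gamma>\<bar> \<le> b * L" "(t \<gamma>)\<^sup>2 * L\<^sup>2 \<le> 1" "(t \<gamma>)\<^sup>2 \<le> b" "(t \<gamma>)\<^sup>2 \<le> 1" "b \<le> 1"
proof -
  show 1: "\<bar>t \<gamma>\<bar> \<le> b * L" using Gamma_bound[OF assms] b0 by (simp add: abs_mult mult_left_mono)
  have "(t \<gamma>)\<^sup>2 \<le> (b * L)\<^sup>2" using 1 by (rule abs_le_square_iff[THEN iffD1, OF order_trans]) simp
  then have 2: "(t \<gamma>)\<^sup>2 \<le> b * (b * L\<^sup>2)" by (simp add: power2_eq_square mult_ac)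
  have "b * (b * L\<^sup>2) \<le> b * 1" using b0 bL by (intro mult_left_mono) auto
  with 2 show 3: "(t \<gamma>)\<^sup>2 \<le> b" by simp
  then have "(t \<gamma>)\<^sup>2 * L\<^sup>2 \<le> b * L\<^sup>2" by (rule mult_right_mono) simp
  with bL show "(t \<gamma>)\<^sup>2 * L\<^sup>2 \<le> 1" by simp
  have "b * 1 \<le> b * L\<^sup>2" using b0 L1 by (intro mult_left_mono) auto
  with bL show "b \<le> 1" by simp
  with 3 show "(t \<gamma>)\<^sup>2 \<le> 1" by simp
qed

text \<open>If the centred field \<open>lin J g (vd s)\<close> were Gaussian with variance \<open>r\<close> under \<open>\<mu>\<close>, both of the
  following quantities would vanish.\<close>

definition "y \<gamma> g = avg (\<lambda>s. exp (t \<gamma> * lin J g (vd s))) - exp ((t \<gamma>)\<^sup>2 * r / 2)"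

definition "z \<gamma> g = avg (\<lambda>s. (lin J g (vd s) - t \<gamma> * r) * exp (t \<gamma> * lin J g (vd s)))"

end

text \<open>This combination appears when the square of \<open>y\<close> is integrated. Its terms
  linear in \<open>x\<close> and \<open>x'\<close> cancel and only \<open>k\<close>, the covariance
  of the two replicas, survives to first order. The three products in the final identity cost 1, 1
  and 2 times \<open>exp 12 * m\<^sup>2\<close>.\<close>

lemma exp_quadratic_remainder:
  fixes x x' k m :: real
  assumes x: "\<bar>x\<bar> \<le> m" "\<bar>x'\<bar> \<le> m" "\<bar>k\<bar> \<le> m" and b: "\<bar>x\<bar> \<le> 4" "\<bar>x'\<bar> \<le> 4" "\<bar>k\<bar> \<le> 4"
  shows "\<bar>exp (x + x' + k) - exp x - exp x' + 1 - k\<bar> \<le> 4 * exp 12 * m\<^sup>2"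
proof -
  have m: "0 \<le> m" using x by linarith
  have e1: "\<bar>exp x - 1\<bar> \<le> m * exp 4" if "\<bar>x\<bar> \<le> m" "\<bar>x\<bar> \<le> 4" for x :: real
    using order_trans[OF abs_exp_minus_one_le[of x]] that m by (meson exp_le_cancel_iff mult_mono abs_ge_zero exp_ge_zero)
  have "\<bar>exp x - 1\<bar> * \<bar>exp x' - 1\<bar> \<le> (m * exp 4) * (m * exp 4)"
    using m by (intro mult_mono e1 x b) auto
  also have "\<dots> = exp 8 * m\<^sup>2" by (simp add: power2_eq_square exp_add[symmetric] mult_ac)
  also have "\<dots> \<le> exp 12 * m\<^sup>2" by (intro mult_right_mono) auto
  finally have 1: "\<bar>(exp x - 1) * (exp x' - 1)\<bar> \<le> exp 12 * m\<^sup>2" by (simp add: abs_mult)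
  have "\<bar>exp k - 1 - k\<bar> \<le> k\<^sup>2 * exp \<bar>k\<bar>" by (rule abs_exp_minus_one_minus_le)
  also have "\<dots> \<le> m\<^sup>2 * exp 4"
    using x b m abs_le_square_iff[of k m] by (intro mult_mono) auto
  finally have "exp (x + x') * \<bar>exp k - 1 - k\<bar> \<le> exp 8 * (m\<^sup>2 * exp 4)"
    using b by (intro mult_mono) auto
  also have "\<dots> = exp 12 * m\<^sup>2" by (simp add: exp_add[symmetric] mult_ac)
  finally have 2: "\<bar>exp (x + x') * (exp k - 1 - k)\<bar> \<le> exp 12 * m\<^sup>2" by (simp add: abs_mult)
  have "\<bar>exp (x + x') - 1\<bar> \<le> \<bar>x + x'\<bar> * exp \<bar>x + x'\<bar>" by (rule abs_exp_minus_one_le)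
  also have "\<dots> \<le> (2 * m) * exp 8" using x b by (intro mult_mono) auto
  finally have "\<bar>k\<bar> * \<bar>exp (x + x') - 1\<bar> \<le> m * ((2 * m) * exp 8)"
    using x m by (intro mult_mono) auto
  also have "\<dots> = 2 * (exp 8 * m\<^sup>2)" by (simp add: power2_eq_square)
  also have "\<dots> \<le> 2 * (exp 12 * m\<^sup>2)" by (intro mult_left_mono mult_right_mono) auto
  finally have 3: "\<bar>k * (exp (x + x') - 1)\<bar> \<le> 2 * (exp 12 * m\<^sup>2)" by (simp add: abs_mult)
  have "exp (x + x' + k) - exp x - exp x' + 1 - k
    = (exp x - 1) * (exp x' - 1) + exp (x + x') * (exp k - 1 - k) + k * (exp (x + x') - 1)"
    by (simp add: exp_add algebra_simps)
  then show ?thesis using 1 2 3 by linarith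
qed

context finite_mean
begin

lemma avg_measurable [measurable (raw)]:
  "(\<And>s. f s \<in> borel_measurable M) \<Longrightarrow> (\<lambda>g. avg (\<lambda>s. f s g)) \<in> borel_measurable M"
  unfolding avg_def by measurable

lemma avg_integrable:
  "(\<And>s. s \<in> \<Omega> \<Longrightarrow> integrable M (f s)) \<Longrightarrow> integrable M (\<lambda>g. avg (\<lambda>s. f s g))"
  unfolding avg_def by (intro Bochner_Integration.integrable_sum integrable_mult_right) auto

lemma avg_integral:
  "(\<And>s. s \<in> \<Omega> \<Longrightarrow> integrable M (f s)) \<Longrightarrow> (\<integral>g. avg (\<lambda>s. f s g) \<partial>M) = avg (\<lambda>s. \<integral>g. f s g \<partial>M)"
  unfolding avg_def by (subst Bochner_Integration.integral_sum) auto

end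

section \<open>Second moments of the deviations from the Gaussian picture\<close>

context cavity
begin

text \<open>Two replicas linearise the square, and each Gaussian integral is the exponential of a
  quadratic form in overlaps. In the constant, 96 is 4 times the 24 of
  \<open>avg2_eta_square\<close>, and \<open>exp 13\<close> contains a factor \<open>exp 1\<close>
  bounding \<open>exp (T\<^sup>2 * r)\<close>.\<close>

lemma
  assumes g: "\<gamma> \<in> \<Gamma>"
  shows y_square_integrable: "integrable P (\<lambda>g. (y \<gamma> g)\<^sup>2)"
    and y_square_le: "(\<integral>g. (y \<gamma> g)\<^sup>2 \<partial>P) \<le> 96 * exp 13 * b\<^sup>2 * W"
proof -
  define T where "T = t \<gamma>"
  define K where "K = exp (T\<^sup>2 * r / 2)"
  define u1 where "u1 s = (\<lambda>e. T * vd s e)" for s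
  define u where "u s s' = (\<lambda>e. T * (vd s e + vd s' e))" for s s'
  define I where "I s s' g = exp (lin J g (u s s')) - K * exp (lin J g (u1 s)) - K * exp (lin J g (u1 s')) + K\<^sup>2" for s s' g
  note tb = t_bounds[OF g, folded T_def]
  have y: "(y \<gamma> g)\<^sup>2 = avg2 (\<lambda>s s'. I s s' g)" for g
  proof -
    have "y \<gamma> g = avg (\<lambda>s. exp (lin J g (u1 s)) - K)"
      by (simp add: y_def T_def[symmetric] K_def u1_def lin_scale_right avg_diff)
    then have "(y \<gamma> g)\<^sup>2 = avg2 (\<lambda>s s'. (exp (lin J g (u1 s)) - K) * (exp (lin J g (u1 s')) - K))"
      by (simp only: power2_eq_square avg_mult_avg)
    also have "\<dots> = avg2 (\<lambda>s s'. I s s' g)"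
      by (intro avg_cong) (simp add: I_def u_def u1_def lin_simps power2_eq_square exp_add[symmetric] algebra_simps)
    finally show ?thesis .
  qed
  have intI: "integrable P (\<lambda>g. I s s' g)" for s s'
    unfolding I_def by (intro Bochner_Integration.integrable_add Bochner_Integration.integrable_diff
       integrable_mult_right gauss_exp fin_J P.integrable_const)
  show "integrable P (\<lambda>g. (y \<gamma> g)\<^sup>2)"
    unfolding y by (intro avg_integrable intI)
  have EI: "(\<integral>g. I s s' g \<partial>P) \<le> exp (T\<^sup>2 * r) * (T\<^sup>2 * lin J (vd s) (vd s')) + 4 * exp 13 * (b\<^sup>2 * (\<eta> s s')\<^sup>2)"
    if s: "s \<in> \<Omega>" "s' \<in> \<Omega>" for s s'
  proof -
    \<comment> \<open>The excess of a replica's exponent over the predicted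
      \<open>T\<^sup>2 * r / 2\<close>. Once \<open>exp (T\<^sup>2 * r)\<close> is factored out, the
      combination of \<open>exp_quadratic_remainder\<close> is left.\<close>
    define x where "x s = T\<^sup>2 * (lin J (vd s) (vd s) - r) / 2" for s
    define k where "k = T\<^sup>2 * lin J (vd s) (vd s')"
    define m where "m = T\<^sup>2 * \<eta> s s'"
    have "(\<integral>g. I s s' g \<partial>P) = exp (lin J (u s s') (u s s') / 2) - K * exp (lin J (u1 s) (u1 s) / 2)
       - K * exp (lin J (u1 s') (u1 s') / 2) + K\<^sup>2"
      unfolding I_def by (simp add: gauss_exp fin_J P.prob_space)
    also have "lin J (u s s') (u s s') / 2 = T\<^sup>2 * r + (x s + x s' + k)"
      by (simp add: u_def x_def k_def lin_simps lin_commute[of J "vd s'" "vd s"] power2_eq_square field_simps)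
    also have "lin J (u1 s) (u1 s) / 2 = T\<^sup>2 * r / 2 + x s"
      by (simp add: u1_def x_def lin_simps power2_eq_square field_simps)
    also have "lin J (u1 s') (u1 s') / 2 = T\<^sup>2 * r / 2 + x s'"
      by (simp add: u1_def x_def lin_simps power2_eq_square field_simps)
    also have "exp (T\<^sup>2 * r + (x s + x s' + k)) - K * exp (T\<^sup>2 * r / 2 + x s) - K * exp (T\<^sup>2 * r / 2 + x s') + K\<^sup>2
      = exp (T\<^sup>2 * r) * (exp (x s + x s' + k) - exp (x s) - exp (x s') + 1)"
      by (simp add: K_def power2_eq_square exp_add[symmetric] algebra_simps)
    finally have eq: "(\<integral>g. I s s' g \<partial>P) = exp (T\<^sup>2 * r) * (exp (x s + x s' + k) - exp (x s) - exp (x s') + 1)" .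
    have xb: "\<bar>x s\<bar> \<le> 4" if "s \<in> \<Omega>" for s
    proof -
      have "\<bar>lin J (vd s) (vd s) - r\<bar> \<le> 5 * L\<^sup>2"
        using vd_vd_size[OF that that] r_bound by linarith
      then have "T\<^sup>2 * \<bar>lin J (vd s) (vd s) - r\<bar> \<le> T\<^sup>2 * (5 * L\<^sup>2)"
        by (rule mult_left_mono) simp
      then show ?thesis using tb(2) unfolding x_def by (simp add: abs_mult)
    qed
    have kb: "\<bar>k\<bar> \<le> 4"
    proof -
      have "T\<^sup>2 * \<bar>lin J (vd s) (vd s')\<bar> \<le> T\<^sup>2 * (4 * L\<^sup>2)"
        using vd_vd_size[OF s] by (rule mult_left_mono) simp
      then show ?thesis using tb(2) unfolding k_def by (simp add: abs_mult)
    qed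
    have xm: "\<bar>x s\<bar> \<le> m" "\<bar>x s'\<bar> \<le> m" "\<bar>k\<bar> \<le> m"
      using mult_left_mono[OF vd_self_le[of s s'], of "T\<^sup>2"] mult_left_mono[OF vd_self_le[of s' s], of "T\<^sup>2"]
        mult_left_mono[OF vd_vd_le[of s s'], of "T\<^sup>2"]
      by (auto simp: x_def k_def m_def abs_mult \<eta>_sym[of s' s])
    have "exp (x s + x s' + k) - exp (x s) - exp (x s') + 1 \<le> k + 4 * exp 12 * m\<^sup>2"
      using exp_quadratic_remainder[OF xm xb[OF s(1)] xb[OF s(2)] kb] by linarith
    then have "(\<integral>g. I s s' g \<partial>P) \<le> exp (T\<^sup>2 * r) * (k + 4 * exp 12 * m\<^sup>2)"
      unfolding eq by (intro mult_left_mono) auto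
    also have "\<dots> = exp (T\<^sup>2 * r) * k + exp (T\<^sup>2 * r) * (4 * exp 12 * m\<^sup>2)" by (simp add: algebra_simps)
    also have "exp (T\<^sup>2 * r) * (4 * exp 12 * m\<^sup>2) \<le> exp 1 * (4 * exp 12 * (b\<^sup>2 * (\<eta> s s')\<^sup>2))"
    proof (intro mult_mono)
      have "T\<^sup>2 * r \<le> T\<^sup>2 * L\<^sup>2" using r_bound by (intro mult_left_mono) auto
      then show "exp (T\<^sup>2 * r) \<le> exp 1" using tb(2) by simp
      show "m\<^sup>2 \<le> b\<^sup>2 * (\<eta> s s')\<^sup>2"
        unfolding m_def power_mult_distrib by (intro mult_right_mono power_mono tb) auto
    qed auto
    also have "exp 1 * (4 * exp 12 * (b\<^sup>2 * (\<eta> s s')\<^sup>2)) = 4 * exp 13 * (b\<^sup>2 * (\<eta> s s')\<^sup>2)"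
      using exp_add[of 1 "12::real"] by simp
    finally show ?thesis unfolding k_def by simp
  qed
  have "(\<integral>g. (y \<gamma> g)\<^sup>2 \<partial>P) = avg2 (\<lambda>s s'. \<integral>g. I s s' g \<partial>P)"
    unfolding y by (subst avg_integral; intro avg_integrable avg_cong avg_integral intI)
  also have "\<dots> \<le> avg2 (\<lambda>s s'. exp (T\<^sup>2 * r) * (T\<^sup>2 * lin J (vd s) (vd s')) + 4 * exp 13 * (b\<^sup>2 * (\<eta> s s')\<^sup>2))"
    by (intro avg_mono EI)
  \<comment> \<open>The covariance term vanishes by \<open>avg_vd_vd\<close>, which leaves only the
    part quadratic in \<open>\<eta>\<close>.\<close>
  also have "\<dots> = 4 * exp 13 * (b\<^sup>2 * avg2 (\<lambda>s s'. (\<eta> s s')\<^sup>2))"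
    by (simp add: avg_add avg_cmult avg_vd_vd)
  also have "\<dots> \<le> 4 * exp 13 * (b\<^sup>2 * (24 * W))"
    by (intro mult_left_mono avg2_eta_square) auto
  finally show "(\<integral>g. (y \<gamma> g)\<^sup>2 \<partial>P) \<le> 96 * exp 13 * b\<^sup>2 * W" by simp
qed

text \<open>The exponential weight of the two replicas is a Cameron--Martin tilt, so the linear
  factors are shifted; what remains is their covariance plus a product of two means, each of first
  order. The covariance carries no factor \<open>T\<close>, hence no power of \<open>b\<close> in
  the bound.\<close>

lemma
  assumes g: "\<gamma> \<in> \<Gamma>"
  shows z_square_integrable: "integrable P (\<lambda>g. (z \<gamma> g)\<^sup>2)"
    and z_square_le: "(\<integral>g. (z \<gamma> g)\<^sup>2 \<partial>P) \<le> 288 * exp 13 * W"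
proof -
  define T where "T = t \<gamma>"
  define u where "u s s' = (\<lambda>e. T * (vd s e + vd s' e))" for s s'
  define Q where "Q s s' g = (lin J g (vd s) - T * r) * (lin J g (vd s') - T * r)" for s s' g
  note tb = t_bounds[OF g, folded T_def]
  have z: "(z \<gamma> g)\<^sup>2 = avg2 (\<lambda>s s'. Q s s' g * exp (lin J g (u s s')))" for g
    unfolding z_def T_def[symmetric] power2_eq_square avg_mult_avg Q_def u_def
    by (intro avg_cong) (simp add: lin_simps exp_add algebra_simps)
  have Qm[measurable]: "Q s s' \<in> borel_measurable P" for s s'
    unfolding Q_def by measurable
  have Qs: "Q s s' (\<lambda>e\<in>J. g e + u s s' e)
     = (lin J g (vd s) + (lin J (u s s') (vd s) - T * r)) * (lin J g (vd s') + (lin J (u s s') (vd s') - T * r))" for s s' g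
  proof -
    have "lin J (\<lambda>e\<in>J. g e + u s s' e) v = lin J g v + lin J (u s s') v" for v
      by (subst lin_add_left[symmetric]) (auto intro: lin_cong)
    then show ?thesis by (simp add: Q_def algebra_simps)
  qed
  have expand: "(lin J g (vd s) + A) * (lin J g (vd s') + A') = lin J g (vd s) * lin J g (vd s')
     + A' * lin J g (vd s) + A * lin J g (vd s') + A * A'" for g s s' A A'
    by (simp add: algebra_simps)
  have intQ': "integrable P (\<lambda>g. (lin J g (vd s) + A) * (lin J g (vd s') + A'))" for s s' A A'
    unfolding expand
    by (intro Bochner_Integration.integrable_add integrable_mult_right gauss_linear gauss_product fin_J P.integrable_const)
  have intQ: "integrable P (\<lambda>g. Q s s' g * exp (lin J g (u s s')))" for s s'
    by (subst cameron_martin(2)[OF fin_J Qm]) (unfold Qs, rule intQ')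
  have EQ: "(\<integral>g. Q s s' g * exp (lin J g (u s s')) \<partial>P) = exp (lin J (u s s') (u s s') / 2) *
     (lin J (vd s) (vd s') + (lin J (u s s') (vd s) - T * r) * (lin J (u s s') (vd s') - T * r))" for s s'
    by (subst cameron_martin(1)[OF fin_J Qm], unfold Qs expand)
       (simp add: gauss_linear gauss_product fin_J P.prob_space)
  show "integrable P (\<lambda>g. (z \<gamma> g)\<^sup>2)"
    unfolding z by (intro avg_integrable intQ)
  have EI: "(\<integral>g. Q s s' g * exp (lin J g (u s s')) \<partial>P) \<le> exp (T\<^sup>2 * r) * lin J (vd s) (vd s') + 12 * exp 13 * (\<eta> s s')\<^sup>2"
    if s: "s \<in> \<Omega>" "s' \<in> \<Omega>" for s s'
  proof -
    define k where "k = lin J (vd s) (vd s')"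
    define A where "A s = lin J (vd s) (vd s) - r" for s
    define x where "x = T\<^sup>2 * (A s + A s' + 2 * k) / 2"
    have T1: "T\<^sup>2 \<le> 1" by (rule tb)
    have e: "\<bar>k\<bar> \<le> \<eta> s s'" "\<bar>A s\<bar> \<le> 2 * \<eta> s s'" "\<bar>A s'\<bar> \<le> 2 * \<eta> s s'"
      using vd_self_le[of s s'] vd_self_le[of s' s] vd_vd_le[of s s']
      by (auto simp: k_def A_def \<eta>_sym[of s' s])
    have \<eta>0: "0 \<le> \<eta> s s'" by (rule \<eta>_nonneg)
    have "\<bar>A s + A s' + 2 * k\<bar> \<le> 6 * \<eta> s s'" using e by linarith
    then have "T\<^sup>2 * \<bar>A s + A s' + 2 * k\<bar> \<le> 1 * (6 * \<eta> s s')"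
      using T1 \<eta>0 by (intro mult_mono) auto
    then have x1: "\<bar>x\<bar> \<le> 3 * \<eta> s s'" unfolding x_def by (simp add: abs_mult)
    have "\<bar>A s + A s' + 2 * k\<bar> \<le> 18 * L\<^sup>2"
      using vd_vd_size[OF s(1) s(1)] vd_vd_size[OF s(2) s(2)] vd_vd_size[OF s] r_bound
      unfolding A_def k_def by linarith
    then have "T\<^sup>2 * \<bar>A s + A s' + 2 * k\<bar> \<le> T\<^sup>2 * (18 * L\<^sup>2)"
      by (rule mult_left_mono) simp
    then have x2: "\<bar>x\<bar> \<le> 9" using tb(2) unfolding x_def by (simp add: abs_mult)
    have uu: "lin J (u s s') (u s s') / 2 = T\<^sup>2 * r + x"
      by (simp add: u_def x_def k_def A_def lin_simps lin_commute[of J "vd s'" "vd s"] power2_eq_square field_simps)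
    have u1: "lin J (u s s') (vd s) - T * r = T * (A s + k)"
      by (simp add: u_def k_def A_def lin_simps lin_commute[of J "vd s'" "vd s"] algebra_simps)
    have u2: "lin J (u s s') (vd s') - T * r = T * (A s' + k)"
      by (simp add: u_def k_def A_def lin_simps algebra_simps)
    \<comment> \<open>Only \<open>k\<close> is of first order, and it will average to zero; the
      other two terms are products of two quantities of order \<open>\<eta>\<close>, with constants
      3 and 9 that add up to 12.\<close>
    have 1: "(\<integral>g. Q s s' g * exp (lin J g (u s s')) \<partial>P)
       = exp (T\<^sup>2 * r) * (k + ((exp x - 1) * k + exp x * (T\<^sup>2 * ((A s + k) * (A s' + k)))))"
      unfolding EQ uu u1 u2 k_def[symmetric] by (simp add: exp_add power2_eq_square algebra_simps)
    have 2: "\<bar>(exp x - 1) * k\<bar> \<le> (3 * \<eta> s s' * exp 12) * \<eta> s s'"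
    proof -
      have "\<bar>exp x - 1\<bar> \<le> \<bar>x\<bar> * exp \<bar>x\<bar>" by (rule abs_exp_minus_one_le)
      also have "\<dots> \<le> 3 * \<eta> s s' * exp 12" using x1 x2 by (intro mult_mono) auto
      finally show ?thesis unfolding abs_mult using e \<eta>0 by (intro mult_mono) auto
    qed
    have 3: "\<bar>exp x * (T\<^sup>2 * ((A s + k) * (A s' + k)))\<bar> \<le> exp 12 * (1 * ((3 * \<eta> s s') * (3 * \<eta> s s')))"
      unfolding abs_mult using e \<eta>0 T1 x2 by (intro mult_mono) auto
    have "(exp x - 1) * k + exp x * (T\<^sup>2 * ((A s + k) * (A s' + k))) \<le> 12 * exp 12 * (\<eta> s s')\<^sup>2"
    proof -
      have "3 * \<eta> s s' * exp 12 * \<eta> s s' + exp 12 * (1 * ((3 * \<eta> s s') * (3 * \<eta> s s'))) = 12 * exp 12 * (\<eta> s s')\<^sup>2"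
        by (simp add: power2_eq_square)
      then show ?thesis using order_trans[OF abs_ge_self 2] order_trans[OF abs_ge_self 3] by linarith
    qed
    then have "(\<integral>g. Q s s' g * exp (lin J g (u s s')) \<partial>P)
       \<le> exp (T\<^sup>2 * r) * (k + 12 * exp 12 * (\<eta> s s')\<^sup>2)"
      unfolding 1 by (intro mult_left_mono add_left_mono) auto
    also have "\<dots> = exp (T\<^sup>2 * r) * k + exp (T\<^sup>2 * r) * (12 * exp 12 * (\<eta> s s')\<^sup>2)" by (simp add: algebra_simps)
    also have "exp (T\<^sup>2 * r) * (12 * exp 12 * (\<eta> s s')\<^sup>2) \<le> exp 1 * (12 * exp 12 * (\<eta> s s')\<^sup>2)"
    proof (intro mult_right_mono)
      have "T\<^sup>2 * r \<le> T\<^sup>2 * L\<^sup>2" using r_bound by (intro mult_left_mono) auto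
      then show "exp (T\<^sup>2 * r) \<le> exp 1" using tb(2) by simp
    qed auto
    also have "exp 1 * (12 * exp 12 * (\<eta> s s')\<^sup>2) = 12 * exp 13 * (\<eta> s s')\<^sup>2"
      using exp_add[of 1 "12::real"] by simp
    finally show ?thesis unfolding k_def by simp
  qed
  have "(\<integral>g. (z \<gamma> g)\<^sup>2 \<partial>P) = avg2 (\<lambda>s s'. \<integral>g. Q s s' g * exp (lin J g (u s s')) \<partial>P)"
    unfolding z by (subst avg_integral; intro avg_integrable avg_cong avg_integral intQ)
  also have "\<dots> \<le> avg2 (\<lambda>s s'. exp (T\<^sup>2 * r) * lin J (vd s) (vd s') + 12 * exp 13 * (\<eta> s s')\<^sup>2)"
    by (intro avg_mono EI)
  also have "\<dots> = 12 * exp 13 * avg2 (\<lambda>s s'. (\<eta> s s')\<^sup>2)"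
    by (simp add: avg_add avg_cmult avg_vd_vd)
  also have "\<dots> \<le> 12 * exp 13 * (24 * W)"
    by (intro mult_left_mono avg2_eta_square) auto
  finally show "(\<integral>g. (z \<gamma> g)\<^sup>2 \<partial>P) \<le> 288 * exp 13 * W" by simp
qed

section \<open>The full system expressed through the remaining spins\<close>

definition "Wt s \<gamma> g = w \<gamma> * exp (t \<gamma> * lin J g (v s))"
definition "Zg g = avg (\<lambda>s. \<Sum>\<gamma>\<in>\<Gamma>. Wt s \<gamma> g)"
text \<open>The Gibbs average over two replicas of the full system: \<open>s\<close>,
  \<open>s'\<close> are the remaining configurations and \<open>e\<close> is the pair of values of
  the removed spin.\<close>

definition full2 :: "('s \<Rightarrow> 's \<Rightarrow> int \<times> int \<Rightarrow> real) \<Rightarrow> ('j \<Rightarrow> real) \<Rightarrow> real" where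
  "full2 F g = avg2 (\<lambda>s s'. \<Sum>e\<in>\<Gamma>\<times>\<Gamma>. F s s' e * (Wt s (fst e) g * Wt s' (snd e) g)) / (Zg g)\<^sup>2"

lemma Wt_pos: "\<gamma> \<in> \<Gamma> \<Longrightarrow> 0 < Wt s \<gamma> g"
  by (simp add: Wt_def w_pos)

lemma Wt_measurable [measurable]: "Wt s \<gamma> \<in> borel_measurable P"
  unfolding Wt_def by measurable

lemma Zg_measurable [measurable]: "Zg \<in> borel_measurable P"
  unfolding Zg_def by measurable

lemma full2_measurable [measurable]: "full2 F \<in> borel_measurable P"
  unfolding full2_def by measurable

lemma avg_exp_vd: "1 \<le> avg (\<lambda>s. exp (a * lin J g (vd s)))"
proof -
  have "avg (\<lambda>s. a * lin J g (vd s)) = 0"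
    unfolding vd_eq lin_diff_right lin_vb by (simp add: avg_cmult avg_diff)
  then show ?thesis using avg_exp[of "\<lambda>s. a * lin J g (vd s)"] by simp
qed

lemma Zg_eq: "Zg g = (\<Sum>\<gamma>\<in>\<Gamma>. w \<gamma> * exp (t \<gamma> * lin J g vb) * avg (\<lambda>s. exp (t \<gamma> * lin J g (vd s))))"
  unfolding Zg_def avg_sum Wt_def
  by (intro sum.cong refl, subst avg_cmult[symmetric], intro avg_cong)
     (simp add: vd_eq lin_diff_right mult.assoc exp_add[symmetric] algebra_simps)

text \<open>Jensen's inequality for the centred field, term by term. It holds for every
  \<open>g\<close>, so division by \<open>Zg\<close> is harmless without excluding any exceptional
  set.\<close>

lemma Zg_ge: "(\<Sum>\<gamma>\<in>\<Gamma>. w \<gamma> * exp (t \<gamma> * lin J g vb)) \<le> Zg g"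
  unfolding Zg_eq
proof (intro sum_mono)
  fix \<gamma> assume "\<gamma> \<in> \<Gamma>"
  then have "w \<gamma> * exp (t \<gamma> * lin J g vb) * 1
      \<le> w \<gamma> * exp (t \<gamma> * lin J g vb) * avg (\<lambda>s. exp (t \<gamma> * lin J g (vd s)))"
    using w_pos[of \<gamma>] by (intro mult_left_mono avg_exp_vd) auto
  then show "w \<gamma> * exp (t \<gamma> * lin J g vb)
      \<le> w \<gamma> * exp (t \<gamma> * lin J g vb) * avg (\<lambda>s. exp (t \<gamma> * lin J g (vd s)))" by simp
qed

lemma Zg_pos: "0 < Zg g"
proof -
  have "0 < (\<Sum>\<gamma>\<in>\<Gamma>. w \<gamma> * exp (t \<gamma> * lin J g vb))"
    using fin_Gamma Gamma_ne w_pos by (intro sum_pos) auto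
  then show ?thesis using Zg_ge[of g] by linarith
qed

lemma Zg_square: "(Zg g)\<^sup>2 = avg2 (\<lambda>s s'. \<Sum>e\<in>\<Gamma>\<times>\<Gamma>. Wt s (fst e) g * Wt s' (snd e) g)"
  unfolding power2_eq_square Zg_def avg_mult_avg
  by (intro avg_cong) (simp add: sum_product sum.cartesian_product case_prod_beta)

lemma full2_bound:
  assumes "\<And>s s' e. s \<in> \<Omega> \<Longrightarrow> s' \<in> \<Omega> \<Longrightarrow> e \<in> \<Gamma>\<times>\<Gamma> \<Longrightarrow> \<bar>F s s' e\<bar> \<le> B"
  shows "\<bar>full2 F g\<bar> \<le> B"
proof -
  let ?S = "\<lambda>s s'. \<Sum>e\<in>\<Gamma>\<times>\<Gamma>. F s s' e * (Wt s (fst e) g * Wt s' (snd e) g)"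
  have "\<bar>avg2 ?S\<bar> \<le> avg (\<lambda>s. \<bar>avg (?S s)\<bar>)" by (rule avg_abs)
  also have "\<dots> \<le> avg2 (\<lambda>s s'. \<bar>?S s s'\<bar>)" by (intro avg_mono avg_abs)
  also have "\<dots> \<le> avg2 (\<lambda>s s'. B * (\<Sum>e\<in>\<Gamma>\<times>\<Gamma>. Wt s (fst e) g * Wt s' (snd e) g))"
  proof (intro avg_mono)
    fix s s' assume s: "s \<in> \<Omega>" "s' \<in> \<Omega>"
    have "\<bar>?S s s'\<bar> \<le> (\<Sum>e\<in>\<Gamma>\<times>\<Gamma>. \<bar>F s s' e * (Wt s (fst e) g * Wt s' (snd e) g)\<bar>)"
      by (rule sum_abs)
    also have "\<dots> \<le> (\<Sum>e\<in>\<Gamma>\<times>\<Gamma>. B * (Wt s (fst e) g * Wt s' (snd e) g))"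
      using assms[OF s] Wt_pos by (intro sum_mono) (auto simp: abs_mult less_imp_le intro!: mult_right_mono)
    finally show "\<bar>?S s s'\<bar> \<le> B * (\<Sum>e\<in>\<Gamma>\<times>\<Gamma>. Wt s (fst e) g * Wt s' (snd e) g)"
      by (simp add: sum_distrib_left)
  qed
  also have "\<dots> = B * (Zg g)\<^sup>2" by (simp add: avg_cmult Zg_square)
  finally show ?thesis using Zg_pos[of g] by (simp add: full2_def field_simps)
qed

lemma full2_integrable: "integrable P (full2 F)"
proof (rule P.integrable_const_bound)
  let ?B = "\<Sum>s\<in>\<Omega>. \<Sum>s'\<in>\<Omega>. \<Sum>e\<in>\<Gamma>\<times>\<Gamma>. \<bar>F s s' e\<bar>"
  have "\<bar>full2 F g\<bar> \<le> ?B" for g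
  proof (rule full2_bound)
    fix s s' e assume s: "s \<in> \<Omega>" "s' \<in> \<Omega>" "e \<in> \<Gamma>\<times>\<Gamma>"
    have "\<bar>F s s' e\<bar> \<le> (\<Sum>e\<in>\<Gamma>\<times>\<Gamma>. \<bar>F s s' e\<bar>)"
      using s fin_Gamma by (intro member_le_sum) auto
    also have "\<dots> \<le> (\<Sum>s'\<in>\<Omega>. \<Sum>e\<in>\<Gamma>\<times>\<Gamma>. \<bar>F s s' e\<bar>)"
      using s fin_Omega by (intro member_le_sum[of s' _ "\<lambda>s'. \<Sum>e\<in>\<Gamma>\<times>\<Gamma>. \<bar>F s s' e\<bar>"]) (auto intro!: sum_nonneg)
    also have "\<dots> \<le> ?B"
      using s fin_Omega by (intro member_le_sum[of s _ "\<lambda>s. \<Sum>s'\<in>\<Omega>. \<Sum>e\<in>\<Gamma>\<times>\<Gamma>. \<bar>F s s' e\<bar>"]) (auto intro!: sum_nonneg)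
    finally show "\<bar>F s s' e\<bar> \<le> ?B" .
  qed
  then show "AE g in P. norm (full2 F g) \<le> ?B" by simp
qed simp

text \<open>The density of the full average is at least the inverse of an exponential functional with bounded mean.\<close>
lemma cavity_le_full:
  assumes f: "\<And>s s'. s \<in> \<Omega> \<Longrightarrow> s' \<in> \<Omega> \<Longrightarrow> 0 \<le> f s s'"
  shows "avg2 f \<le> 6 * exp 8 * (\<integral>g. full2 (\<lambda>s s' e. f s s') g \<partial>P)"
proof -
  define a where "a = b * L"
  have a0: "0 \<le> a" using b0 L1 by (simp add: a_def)
  have aL: "a\<^sup>2 * L\<^sup>2 \<le> 1"
    using bL b0 power_mono[of "b * L\<^sup>2" 1 2] L1 by (simp add: a_def power_mult_distrib power2_eq_square mult_ac)
  define X where "X s g = lin J g (v s)" for s g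
  define Tl where "Tl s g = (\<Sum>\<gamma>\<in>\<Gamma>. Wt s \<gamma> g) / Zg g" for s g
  define \<Lambda> where "\<Lambda> g = avg (\<lambda>s. exp (a * \<bar>X s g\<bar>))" for g
  \<comment> \<open>The inverse density is at most a product of four exponentials, one for each of
    \<open>s\<close>, \<open>s'\<close> and two from the square of \<open>\<Lambda>\<close>. A
    product of four is at most the fourth power of the largest, hence the 4 and the sum.\<close>
  define u where "u s s' g = exp (4 * a * \<bar>X s g\<bar>) + exp (4 * a * \<bar>X s' g\<bar>) + avg (\<lambda>s. exp (4 * a * \<bar>X s g\<bar>))" for s s' g
  \<comment> \<open>An upper bound for the mean of \<open>u\<close>: each of the three terms has
    mean at most \<open>2 * exp 8\<close>, since the exponent \<open>4 * a\<close> produces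
    \<open>8 * a\<^sup>2 * L\<^sup>2 \<le> 8\<close>.\<close>
  define \<kappa> :: real where "\<kappa> = 6 * exp 8"
  have \<kappa>: "0 < \<kappa>" by (simp add: \<kappa>_def)
  have full: "full2 (\<lambda>s s' e. f s s') g = avg2 (\<lambda>s s'. f s s' * (Tl s g * Tl s' g))" for g
  proof -
    have 1: "Tl s g * Tl s' g = (\<Sum>e\<in>\<Gamma>\<times>\<Gamma>. Wt s (fst e) g * Wt s' (snd e) g) * inverse ((Zg g)\<^sup>2)" for s s'
      by (simp add: Tl_def sum_product sum.cartesian_product case_prod_beta divide_inverse power2_eq_square)
    show ?thesis
      unfolding full2_def divide_inverse avg_multc[symmetric] 1
      by (intro avg_cong) (simp add: sum_distrib_left[symmetric] mult.assoc)
  qed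
  have Xm[measurable]: "X s \<in> borel_measurable P" for s unfolding X_def by measurable
  have \<Lambda>1: "0 < \<Lambda> g" for g
  proof -
    have "1 \<le> \<Lambda> g" unfolding \<Lambda>_def using avg_mono[of "\<lambda>_. 1" "\<lambda>s. exp (a * \<bar>X s g\<bar>)"] a0 by simp
    then show ?thesis by simp
  qed
  have ta: "\<bar>t \<gamma> * X s g\<bar> \<le> a * \<bar>X s g\<bar>" if "\<gamma> \<in> \<Gamma>" for \<gamma> s g
    using t_bounds(1)[OF that] unfolding abs_mult[of "t \<gamma>" "X s g"] a_def by (rule mult_right_mono) simp
  have Tl_lower: "exp (- (a * \<bar>X s g\<bar>)) / \<Lambda> g \<le> Tl s g" for s g
  proof -
    have "Zg g \<le> avg (\<lambda>s. (\<Sum>\<gamma>\<in>\<Gamma>. w \<gamma>) * exp (a * \<bar>X s g\<bar>))"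
      unfolding Zg_def Wt_def X_def[symmetric] sum_distrib_right
      using w_pos by (intro avg_mono sum_mono mult_left_mono) (auto simp: less_imp_le intro!: abs_le_D1[OF ta])
    also have "\<dots> = (\<Sum>\<gamma>\<in>\<Gamma>. w \<gamma>) * \<Lambda> g" by (simp add: avg_cmult \<Lambda>_def)
    finally have 1: "Zg g \<le> (\<Sum>\<gamma>\<in>\<Gamma>. w \<gamma>) * \<Lambda> g" .
    have 2: "(\<Sum>\<gamma>\<in>\<Gamma>. w \<gamma>) * exp (- (a * \<bar>X s g\<bar>)) \<le> (\<Sum>\<gamma>\<in>\<Gamma>. Wt s \<gamma> g)"
      unfolding Wt_def X_def[symmetric] sum_distrib_right
    proof (intro sum_mono mult_left_mono)
      fix \<gamma> assume "\<gamma> \<in> \<Gamma>"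
      then show "exp (- (a * \<bar>X s g\<bar>)) \<le> exp (t \<gamma> * X s g)" using ta[of \<gamma> s g] by (simp add: abs_le_iff)
    qed (use w_pos less_imp_le in auto)
    have "exp (- (a * \<bar>X s g\<bar>)) * Zg g \<le> exp (- (a * \<bar>X s g\<bar>)) * ((\<Sum>\<gamma>\<in>\<Gamma>. w \<gamma>) * \<Lambda> g)"
      using 1 by (rule mult_left_mono) simp
    also have "\<dots> = ((\<Sum>\<gamma>\<in>\<Gamma>. w \<gamma>) * exp (- (a * \<bar>X s g\<bar>))) * \<Lambda> g" by simp
    also have "\<dots> \<le> (\<Sum>\<gamma>\<in>\<Gamma>. Wt s \<gamma> g) * \<Lambda> g" using 2 \<Lambda>1[of g] by (intro mult_right_mono) auto
    finally show ?thesis using \<Lambda>1[of g] Zg_pos[of g] by (simp add: Tl_def field_simps)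
  qed
  have u_pos: "0 < u s s' g" for s s' g
    unfolding u_def by (intro add_pos_nonneg avg_nonneg) (auto intro: add_pos_pos)
  \<comment> \<open>The left side is the tangent of the convex function \<open>1 / u\<close> at
    \<open>\<kappa>\<close>. A lower bound affine in \<open>u\<close> can be integrated knowing only
    the mean of \<open>u\<close>.\<close>
  have prod_lower: "(2 * \<kappa> - u s s' g) / \<kappa>\<^sup>2 \<le> Tl s g * Tl s' g" for s s' g
  proof -
    have conv: "exp (x + y + 2 * z) \<le> exp (4 * x) + exp (4 * y) + exp (4 * z)" for x y z :: real
    proof -
      consider "x + y + 2 * z \<le> 4 * x" | "x + y + 2 * z \<le> 4 * y" | "x + y + 2 * z \<le> 4 * z" by linarith
      then show ?thesis
        by cases (smt (verit) exp_gt_zero exp_le_cancel_iff)+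
    qed
    have "(\<Lambda> g)\<^sup>2 \<le> avg (\<lambda>s. (exp (a * \<bar>X s g\<bar>))\<^sup>2)" unfolding \<Lambda>_def by (rule avg_square)
    then have "exp (a * \<bar>X s g\<bar>) * exp (a * \<bar>X s' g\<bar>) * (\<Lambda> g)\<^sup>2
      \<le> exp (a * \<bar>X s g\<bar>) * exp (a * \<bar>X s' g\<bar>) * avg (\<lambda>s. (exp (a * \<bar>X s g\<bar>))\<^sup>2)"
      by (rule mult_left_mono) simp
    also have "\<dots> = avg (\<lambda>s''. exp (a * \<bar>X s g\<bar> + a * \<bar>X s' g\<bar> + 2 * (a * \<bar>X s'' g\<bar>)))"
      unfolding avg_cmult[symmetric] by (intro avg_cong) (simp add: exp_add exp_double)
    also have "\<dots> \<le> avg (\<lambda>s''. exp (4 * (a * \<bar>X s g\<bar>)) + exp (4 * (a * \<bar>X s' g\<bar>)) + exp (4 * (a * \<bar>X s'' g\<bar>)))"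
      by (intro avg_mono conv)
    also have "\<dots> = u s s' g" by (simp add: avg_add u_def mult.assoc)
    finally have U: "exp (a * \<bar>X s g\<bar>) * exp (a * \<bar>X s' g\<bar>) * (\<Lambda> g)\<^sup>2 \<le> u s s' g" .
    have "0 \<le> (u s s' g - \<kappa>)\<^sup>2" by simp
    then have "(2 * \<kappa> - u s s' g) * u s s' g \<le> \<kappa>\<^sup>2" by (simp add: power2_eq_square algebra_simps)
    then have "(2 * \<kappa> - u s s' g) / \<kappa>\<^sup>2 \<le> 1 / u s s' g"
      using u_pos[of s s' g] \<kappa> by (simp add: field_simps)
    also have "\<dots> \<le> 1 / (exp (a * \<bar>X s g\<bar>) * exp (a * \<bar>X s' g\<bar>) * (\<Lambda> g)\<^sup>2)"
      using U \<Lambda>1[of g] by (intro divide_left_mono mult_pos_pos u_pos) auto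
    also have "\<dots> = (exp (- (a * \<bar>X s g\<bar>)) / \<Lambda> g) * (exp (- (a * \<bar>X s' g\<bar>)) / \<Lambda> g)"
      using \<Lambda>1[of g] by (simp add: exp_minus field_simps power2_eq_square)
    also have "\<dots> \<le> Tl s g * Tl s' g"
      using \<Lambda>1[of g] by (intro mult_mono Tl_lower order_trans[OF _ Tl_lower[of s]]) auto
    finally show ?thesis .
  qed
  have gx: "exp (4 * a * \<bar>X s g\<bar>) \<le> exp (lin J g (\<lambda>e. 4 * a * v s e)) + exp (lin J g (\<lambda>e. - 4 * a * v s e))" for s g
  proof -
    have "4 * a * \<bar>X s g\<bar> = \<bar>4 * a * X s g\<bar>" using a0 by (simp add: abs_mult)
    then show ?thesis using exp_abs_le[of "4 * a * X s g"]
        lin_scale_right[of J g "4 * a" "v s"] lin_scale_right[of J g "- 4 * a" "v s"] by (simp add: X_def)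
  qed
  have igx: "integrable P (\<lambda>g. exp (lin J g (\<lambda>e. 4 * a * v s e)) + exp (lin J g (\<lambda>e. - 4 * a * v s e)))" for s
    by (intro Bochner_Integration.integrable_add gauss_exp fin_J)
  have ie: "integrable P (\<lambda>g. exp (4 * a * \<bar>X s g\<bar>))" for s
    by (rule Bochner_Integration.integrable_bound[OF igx[of s]]) (use gx[of s] in \<open>auto intro!: order_trans[OF gx] abs_ge_self\<close>)
  have ee: "(\<integral>g. exp (4 * a * \<bar>X s g\<bar>) \<partial>P) \<le> 2 * exp 8" if s: "s \<in> \<Omega>" for s
  proof -
    have "(\<integral>g. exp (4 * a * \<bar>X s g\<bar>) \<partial>P) \<le> (\<integral>g. exp (lin J g (\<lambda>e. 4 * a * v s e)) + exp (lin J g (\<lambda>e. - 4 * a * v s e)) \<partial>P)"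
      by (rule integral_mono[OF ie igx gx])
    also have "\<dots> = exp (8 * a\<^sup>2 * lin J (v s) (v s)) + exp (8 * a\<^sup>2 * lin J (v s) (v s))"
    proof -
      have "lin J (\<lambda>e. c * v s e) (\<lambda>e. c * v s e) = c\<^sup>2 * lin J (v s) (v s)" for c
        by (simp only: lin_scale_left lin_scale_right power2_eq_square mult.assoc)
      from this[of "4 * a"] this[of "- 4 * a"] show ?thesis
        by (simp only: Bochner_Integration.integral_add gauss_exp fin_J) (simp add: power_mult_distrib)
    qed
    also have "\<dots> \<le> exp 8 + exp 8"
    proof -
      have "a\<^sup>2 * lin J (v s) (v s) \<le> a\<^sup>2 * L\<^sup>2" using lin_v[OF s s] by (intro mult_left_mono) auto
      then show ?thesis using aL by (intro add_mono) auto
    qed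
    finally show ?thesis by simp
  qed
  have iu: "integrable P (u s s')" for s s'
    unfolding u_def by (intro Bochner_Integration.integrable_add ie avg_integrable)
  have eu: "(\<integral>g. u s s' g \<partial>P) \<le> \<kappa>" if s: "s \<in> \<Omega>" "s' \<in> \<Omega>" for s s'
  proof -
    have "(\<integral>g. u s s' g \<partial>P) = (\<integral>g. exp (4 * a * \<bar>X s g\<bar>) \<partial>P) + (\<integral>g. exp (4 * a * \<bar>X s' g\<bar>) \<partial>P)
       + avg (\<lambda>s. \<integral>g. exp (4 * a * \<bar>X s g\<bar>) \<partial>P)"
      unfolding u_def by (simp add: ie avg_integrable avg_integral)
    also have "\<dots> \<le> 2 * exp 8 + 2 * exp 8 + 2 * exp 8"
      using avg_mono[of "\<lambda>s. \<integral>g. exp (4 * a * \<bar>X s g\<bar>) \<partial>P" "\<lambda>_. 2 * exp 8"] ee s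
      by (intro add_mono) auto
    finally show ?thesis by (simp add: \<kappa>_def)
  qed
  have "avg2 f / \<kappa> = avg2 (\<lambda>s s'. f s s' / \<kappa>)"
    by (simp add: divide_inverse avg_multc)
  also have "\<dots> \<le> avg2 (\<lambda>s s'. f s s' * ((2 * \<kappa> - (\<integral>g. u s s' g \<partial>P)) / \<kappa>\<^sup>2))"
  proof (intro avg_mono)
    fix s s' assume s: "s \<in> \<Omega>" "s' \<in> \<Omega>"
    have "f s s' / \<kappa> = f s s' * (\<kappa> / \<kappa>\<^sup>2)" using \<kappa> by (simp add: power2_eq_square)
    also have "\<dots> \<le> f s s' * ((2 * \<kappa> - (\<integral>g. u s s' g \<partial>P)) / \<kappa>\<^sup>2)"
      using eu[OF s] f[OF s] by (intro mult_left_mono divide_right_mono) auto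
    finally show "f s s' / \<kappa> \<le> \<dots>" .
  qed
  also have "\<dots> = (\<integral>g. avg2 (\<lambda>s s'. f s s' * ((2 * \<kappa> - u s s' g) / \<kappa>\<^sup>2)) \<partial>P)"
  proof -
    have i: "integrable P (\<lambda>g. f s s' * ((2 * \<kappa> - u s s' g) / \<kappa>\<^sup>2))" for s s'
      using iu[of s s'] by (intro integrable_mult_right integrable_divide Bochner_Integration.integrable_diff P.integrable_const)
    have "(\<integral>g. avg2 (\<lambda>s s'. f s s' * ((2 * \<kappa> - u s s' g) / \<kappa>\<^sup>2)) \<partial>P)
      = avg2 (\<lambda>s s'. \<integral>g. f s s' * ((2 * \<kappa> - u s s' g) / \<kappa>\<^sup>2) \<partial>P)"
      by (subst avg_integral; intro avg_integrable avg_cong avg_integral i)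
    then show ?thesis using iu by (simp add: P.prob_space)
  qed
  also have "\<dots> \<le> (\<integral>g. full2 (\<lambda>s s' e. f s s') g \<partial>P)"
  proof (rule integral_mono[OF _ full2_integrable])
    show "integrable P (\<lambda>g. avg2 (\<lambda>s s'. f s s' * ((2 * \<kappa> - u s s' g) / \<kappa>\<^sup>2)))"
      using iu by (intro avg_integrable integrable_mult_right integrable_divide Bochner_Integration.integrable_diff P.integrable_const)
    show "avg2 (\<lambda>s s'. f s s' * ((2 * \<kappa> - u s s' g) / \<kappa>\<^sup>2)) \<le> full2 (\<lambda>s s' e. f s s') g" for g
      unfolding full by (intro avg_mono mult_left_mono prod_lower f)
  qed
  finally show ?thesis using \<kappa> by (simp add: \<kappa>_def field_simps)
qed

text \<open>The weights of the removed spin in the Gaussian picture: the exponential moment of a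
  centred field of variance \<open>r\<close> is absorbed into \<open>w\<close>, so that only the
  mean field remains random.\<close>

definition "wt \<gamma> = w \<gamma> * exp ((t \<gamma>)\<^sup>2 * r / 2)"
definition "w2 e = wt (fst e) * wt (snd e)"
definition "cc e = t (fst e) + t (snd e)"
text \<open>The probability of the pair of values \<open>e\<close> for two independent spins in the
  mean field. Written as an \<open>eavg\<close> of an indicator, it inherits the Lipschitz
  bound.\<close>

definition "\<pi> e = eavg (\<Gamma>\<times>\<Gamma>) w2 cc (\<lambda>e'. if e' = e then 1 else 0)"
definition "Zt g = (\<Sum>\<gamma>\<in>\<Gamma>. wt \<gamma> * exp (t \<gamma> * lin J g vb))"
definition "nG = real (card \<Gamma>)"

lemma wt_pos: "\<gamma> \<in> \<Gamma> \<Longrightarrow> 0 < wt \<gamma>"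
  by (simp add: wt_def w_pos)

sublocale ef: expfam "\<Gamma>\<times>\<Gamma>" w2 cc "2 * (b * L)"
proof
  fix e assume e: "e \<in> \<Gamma>\<times>\<Gamma>"
  then show "0 < w2 e" by (auto simp: w2_def wt_pos)
  show "\<bar>cc e\<bar> \<le> 2 * (b * L)"
    using e t_bounds(1)[of "fst e"] t_bounds(1)[of "snd e"] unfolding cc_def by (auto simp del: abs_mult simp: mem_Times_iff)
qed (use fin_Gamma Gamma_ne in auto)

sublocale ef1: expfam \<Gamma> wt t "b * L"
  by unfold_locales (use fin_Gamma Gamma_ne wt_pos t_bounds(1) in auto)

lemma nG: "1 \<le> nG"
  using fin_Gamma Gamma_ne by (simp add: nG_def Suc_le_eq card_gt_0_iff)

lemma card_GG: "real (card (\<Gamma>\<times>\<Gamma>)) = nG\<^sup>2"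
  by (simp add: nG_def card_cartesian_product power2_eq_square)

lemma Zt_pos: "0 < Zt g"
  unfolding Zt_def using fin_Gamma Gamma_ne wt_pos by (intro sum_pos) auto

lemma Zt_square: "(Zt g)\<^sup>2 = ef.Z (lin J g vb)"
  unfolding Zt_def power2_eq_square sum_product sum.cartesian_product
  by (intro sum.cong) (auto simp: w2_def cc_def exp_add[symmetric] algebra_simps)

lemma pi_eq: "e \<in> \<Gamma>\<times>\<Gamma> \<Longrightarrow> \<pi> e x = w2 e * exp (cc e * x) / ef.Z x"
  unfolding \<pi>_def eavg_def using fin_Gamma by (simp add: if_distrib[of "\<lambda>x. x * _"] cong: if_cong)

lemma pi_bounds: "e \<in> \<Gamma>\<times>\<Gamma> \<Longrightarrow> 0 \<le> \<pi> e x" "\<bar>\<pi> e x\<bar> \<le> 1"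
proof -
  show "\<bar>\<pi> e x\<bar> \<le> 1" unfolding \<pi>_def by (intro ef.eavg_bound) auto
  show "0 \<le> \<pi> e x" if "e \<in> \<Gamma>\<times>\<Gamma>"
    using that ef.Z_pos[of x] ef.w[OF that] by (simp add: pi_eq)
qed

lemma pi_measurable [measurable]: "\<pi> e \<in> borel_measurable borel"
  unfolding \<pi>_def by measurable

lemma pi_lipschitz: "\<bar>\<pi> e x - \<pi> e x'\<bar> \<le> 4 * (b * L) * \<bar>x - x'\<bar>"
  using ef.eavg_lipschitz[of 1 "\<lambda>e'. if e' = e then 1 else 0" x x'] unfolding \<pi>_def by simp

lemma eavg_pi: "eavg (\<Gamma>\<times>\<Gamma>) w2 cc F x = (\<Sum>e\<in>\<Gamma>\<times>\<Gamma>. F e * \<pi> e x)"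
  unfolding eavg_def sum_divide_distrib by (intro sum.cong refl) (simp add: pi_eq)

text \<open>The difference of the partition functions is a combination of the
  \<open>y \<gamma> g\<close> whose positive coefficients sum to at most \<open>Zg\<close> by
  \<open>Zg_ge\<close>. The factor 2 bounds \<open>exp (1/2)\<close>, as
  \<open>(t \<gamma>)\<^sup>2 * r \<le> 1\<close>.\<close>

lemma ratio_bounds:
  "Zt g \<le> 2 * Zg g" "\<bar>Zt g - Zg g\<bar> \<le> (\<Sum>\<gamma>\<in>\<Gamma>. \<bar>y \<gamma> g\<bar>) * Zg g"
proof -
  let ?e = "\<lambda>\<gamma>. w \<gamma> * exp (t \<gamma> * lin J g vb)"
  have e0: "0 \<le> ?e \<gamma>" if "\<gamma> \<in> \<Gamma>" for \<gamma> using w_pos[OF that] by simp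
  have "exp (1/2) \<le> (2::real)"
    by (rule exp_half_le2)
  then have h: "exp ((t \<gamma>)\<^sup>2 * r / 2) \<le> 2" if "\<gamma> \<in> \<Gamma>" for \<gamma>
  proof -
    have "(t \<gamma>)\<^sup>2 * r \<le> (t \<gamma>)\<^sup>2 * L\<^sup>2" using r_bound by (intro mult_left_mono) auto
    then have "exp ((t \<gamma>)\<^sup>2 * r / 2) \<le> exp (1/2)" using t_bounds(2)[OF that] by simp
    then show ?thesis using \<open>exp (1/2) \<le> 2\<close> by linarith
  qed
  have "Zt g = (\<Sum>\<gamma>\<in>\<Gamma>. ?e \<gamma> * exp ((t \<gamma>)\<^sup>2 * r / 2))"
    unfolding Zt_def wt_def by (intro sum.cong) auto
  also have "\<dots> \<le> (\<Sum>\<gamma>\<in>\<Gamma>. ?e \<gamma> * 2)"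
    by (intro sum_mono mult_left_mono h e0)
  also have "\<dots> \<le> 2 * Zg g" using Zg_ge[of g] by (simp add: sum_distrib_right[symmetric])
  finally show "Zt g \<le> 2 * Zg g" .
  have "Zg g - Zt g = (\<Sum>\<gamma>\<in>\<Gamma>. ?e \<gamma> * y \<gamma> g)"
    unfolding Zt_def Zg_eq wt_def y_def sum_subtractf[symmetric] by (intro sum.cong) (auto simp: algebra_simps)
  then have "\<bar>Zt g - Zg g\<bar> = \<bar>\<Sum>\<gamma>\<in>\<Gamma>. ?e \<gamma> * y \<gamma> g\<bar>"
    by linarith
  also have "\<dots> \<le> (\<Sum>\<gamma>\<in>\<Gamma>. \<bar>?e \<gamma> * y \<gamma> g\<bar>)" by (rule sum_abs)
  also have "\<dots> \<le> (\<Sum>\<gamma>\<in>\<Gamma>. ?e \<gamma> * (\<Sum>\<gamma>\<in>\<Gamma>. \<bar>y \<gamma> g\<bar>))"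
  proof (intro sum_mono)
    fix \<gamma> assume \<gamma>: "\<gamma> \<in> \<Gamma>"
    have "\<bar>y \<gamma> g\<bar> \<le> (\<Sum>\<gamma>\<in>\<Gamma>. \<bar>y \<gamma> g\<bar>)"
      using fin_Gamma \<gamma> by (intro member_le_sum) auto
    then show "\<bar>?e \<gamma> * y \<gamma> g\<bar> \<le> ?e \<gamma> * (\<Sum>\<gamma>\<in>\<Gamma>. \<bar>y \<gamma> g\<bar>)"
      unfolding abs_mult[of "?e \<gamma>"] abs_of_nonneg[OF e0[OF \<gamma>]] by (rule mult_left_mono[OF _ e0[OF \<gamma>]])
  qed
  also have "\<dots> = (\<Sum>\<gamma>\<in>\<Gamma>. ?e \<gamma>) * (\<Sum>\<gamma>\<in>\<Gamma>. \<bar>y \<gamma> g\<bar>)" by (simp add: sum_distrib_right)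
  also have "\<dots> \<le> Zg g * (\<Sum>\<gamma>\<in>\<Gamma>. \<bar>y \<gamma> g\<bar>)"
    by (intro mult_right_mono Zg_ge sum_nonneg) auto
  finally show "\<bar>Zt g - Zg g\<bar> \<le> (\<Sum>\<gamma>\<in>\<Gamma>. \<bar>y \<gamma> g\<bar>) * Zg g" by (simp add: mult.commute)
qed

lemma
  shows y_sum_integrable: "integrable P (\<lambda>g. (\<Sum>\<gamma>\<in>\<Gamma>. \<bar>y \<gamma> g\<bar>)\<^sup>2)"
    and y_sum_le: "(\<integral>g. (\<Sum>\<gamma>\<in>\<Gamma>. \<bar>y \<gamma> g\<bar>)\<^sup>2 \<partial>P) \<le> 96 * exp 13 * nG\<^sup>2 * b\<^sup>2 * W"
proof -
  have [measurable]: "y \<gamma> \<in> borel_measurable P" for \<gamma> unfolding y_def by measurable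
  have i: "integrable P (\<lambda>g. nG * (\<Sum>\<gamma>\<in>\<Gamma>. (y \<gamma> g)\<^sup>2))"
    by (intro integrable_mult_right Bochner_Integration.integrable_sum y_square_integrable)
  have le: "(\<Sum>\<gamma>\<in>\<Gamma>. \<bar>y \<gamma> g\<bar>)\<^sup>2 \<le> nG * (\<Sum>\<gamma>\<in>\<Gamma>. (y \<gamma> g)\<^sup>2)" for g
    unfolding nG_def by (rule sum_abs_square_le[OF fin_Gamma])
  show 1: "integrable P (\<lambda>g. (\<Sum>\<gamma>\<in>\<Gamma>. \<bar>y \<gamma> g\<bar>)\<^sup>2)"
    by (rule Bochner_Integration.integrable_bound[OF i]) (use le in \<open>auto intro!: order_trans[OF le] abs_ge_self\<close>)
  have "(\<integral>g. (\<Sum>\<gamma>\<in>\<Gamma>. \<bar>y \<gamma> g\<bar>)\<^sup>2 \<partial>P) \<le> (\<integral>g. nG * (\<Sum>\<gamma>\<in>\<Gamma>. (y \<gamma> g)\<^sup>2) \<partial>P)"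
    by (rule integral_mono[OF 1 i le])
  also have "\<dots> = nG * (\<Sum>\<gamma>\<in>\<Gamma>. \<integral>g. (y \<gamma> g)\<^sup>2 \<partial>P)"
    by (simp add: y_square_integrable Bochner_Integration.integral_sum)
  also have "\<dots> \<le> nG * (\<Sum>\<gamma>\<in>\<Gamma>. 96 * exp 13 * b\<^sup>2 * W)"
    using nG by (intro mult_left_mono sum_mono y_square_le) auto
  also have "\<dots> = 96 * exp 13 * nG\<^sup>2 * b\<^sup>2 * W" by (simp add: nG_def power2_eq_square)
  finally show "(\<integral>g. (\<Sum>\<gamma>\<in>\<Gamma>. \<bar>y \<gamma> g\<bar>)\<^sup>2 \<partial>P) \<le> 96 * exp 13 * nG\<^sup>2 * b\<^sup>2 * W" .
qed

end

text \<open>\<open>c\<close> is the value that the fixed point equations predict for the average of \<open>\<Phi>\<close> over two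
  replicas of the removed spin.\<close>

locale cavity_test = cavity +
  fixes \<Phi> :: "int \<times> int \<Rightarrow> real" and f :: "'a \<Rightarrow> 'a \<Rightarrow> real" and c :: real and B :: real
  assumes Phi_bound: "\<And>e. e \<in> \<Gamma>\<times>\<Gamma> \<Longrightarrow> \<bar>\<Phi> e\<bar> \<le> L\<^sup>2"
    and c_eq: "c = (\<integral>x. eavg (\<Gamma>\<times>\<Gamma>) w2 cc \<Phi> (sqrt q * x) \<partial>stdN)"
    and f_bound: "\<And>s s'. s \<in> \<Omega> \<Longrightarrow> s' \<in> \<Omega> \<Longrightarrow> \<bar>f s s'\<bar> \<le> \<eta> s s'"
    and bB: "b \<le> B" "0 < B"
begin

section \<open>Expectation of a test functional of the removed spin\<close>

definition "uu e s s' = (\<lambda>i. t (fst e) * vd s i + t (snd e) * vd s' i)"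
definition "\<rho> e = ((t (fst e))\<^sup>2 + (t (snd e))\<^sup>2) * r / 2"
text \<open>The actual exponential of the centred fields of two replicas, divided by its Gaussian
  prediction, in which the replicas are independent with variance \<open>r\<close>.\<close>

definition "Ee e s s' g = exp (lin J g (uu e s s') - \<rho> e)"
text \<open>The test functional \<open>H\<close> with the partition function replaced by its
  Gaussian counterpart. Its randomness is a bounded function of the mean field times exponentials of
  linear fields, to which \<open>cameron_martin\<close> applies.\<close>

definition "Main g = avg2 (\<lambda>s s'. f s s' * (\<Sum>e\<in>\<Gamma>\<times>\<Gamma>. (\<Phi> e - c) * (\<pi> e (lin J g vb) * Ee e s s' g)))"
definition "H = full2 (\<lambda>s s' e. f s s' * (\<Phi> e - c))"

lemma c_bound: "\<bar>c\<bar> \<le> L\<^sup>2"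
proof -
  have b: "\<bar>eavg (\<Gamma>\<times>\<Gamma>) w2 cc \<Phi> x\<bar> \<le> L\<^sup>2" for x
    by (intro ef.eavg_bound Phi_bound) auto
  have i: "integrable stdN (\<lambda>x. eavg (\<Gamma>\<times>\<Gamma>) w2 cc \<Phi> (sqrt q * x))"
    by (rule stdN.integrable_const_bound[of _ "L\<^sup>2"]) (use b in auto)
  have "\<bar>c\<bar> \<le> (\<integral>x. \<bar>eavg (\<Gamma>\<times>\<Gamma>) w2 cc \<Phi> (sqrt q * x)\<bar> \<partial>stdN)"
    unfolding c_eq by (rule integral_abs_bound)
  also have "\<dots> \<le> (\<integral>x. L\<^sup>2 \<partial>stdN)"
    by (intro integral_mono b integrable_abs i) auto
  finally show ?thesis using stdN.prob_space by simp
qed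

lemma Phi_c: "e \<in> \<Gamma>\<times>\<Gamma> \<Longrightarrow> \<bar>\<Phi> e - c\<bar> \<le> 2 * L\<^sup>2"
  using Phi_bound[of e] c_bound by linarith

lemma Wt_factor:
  assumes e: "e \<in> \<Gamma>\<times>\<Gamma>"
  shows "Wt s (fst e) g * Wt s' (snd e) g / (Zg g)\<^sup>2 = \<pi> e (lin J g vb) * Ee e s s' g * (Zt g / Zg g)\<^sup>2"
proof -
  have 1: "Wt s (fst e) g * Wt s' (snd e) g = w2 e * exp (cc e * lin J g vb) * Ee e s s' g"
    by (simp add: Wt_def w2_def wt_def cc_def Ee_def uu_def \<rho>_def vd_eq lin_simps)
       (simp add: exp_add[symmetric] exp_diff[symmetric] exp_minus[symmetric] algebra_simps add_divide_distrib)
  show ?thesis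
    unfolding 1 pi_eq[OF e] Zt_square[symmetric] using Zt_pos[of g] by (simp add: power_divide)
qed

lemma H_eq: "H g = Main g * (Zt g / Zg g)\<^sup>2"
proof -
  have "H g = avg2 (\<lambda>s s'. \<Sum>e\<in>\<Gamma>\<times>\<Gamma>. f s s' * (\<Phi> e - c) * (Wt s (fst e) g * Wt s' (snd e) g / (Zg g)\<^sup>2))"
    unfolding H_def full2_def divide_inverse avg_multc[symmetric]
    by (simp add: sum_distrib_right mult.assoc)
  also have "\<dots> = avg2 (\<lambda>s s'. f s s' * (\<Sum>e\<in>\<Gamma>\<times>\<Gamma>. (\<Phi> e - c) * (\<pi> e (lin J g vb) * Ee e s s' g)) * (Zt g / Zg g)\<^sup>2)"
    by (intro avg_cong) (simp add: Wt_factor sum_distrib_left sum_distrib_right mult_ac)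
  finally show ?thesis unfolding Main_def avg_multc .
qed

text \<open>\<open>H\<close> is \<open>Main\<close> times the square of \<open>R = Zt / Zg\<close>,
  and \<open>R\<^sup>2 - 1 = (R - 1) * (R + 1)\<close> with \<open>R + 1 \<le> 3\<close>.\<close>

lemma H_diff: "\<bar>H g - Main g\<bar> \<le> 3 * \<bar>Main g\<bar> * (\<Sum>\<gamma>\<in>\<Gamma>. \<bar>y \<gamma> g\<bar>)"
proof -
  define R where "R = Zt g / Zg g"
  have 1: "0 \<le> R" "R \<le> 2" "\<bar>R - 1\<bar> \<le> (\<Sum>\<gamma>\<in>\<Gamma>. \<bar>y \<gamma> g\<bar>)"
    using ratio_bounds[of g] Zg_pos[of g] Zt_pos[of g] by (auto simp: R_def field_simps abs_if split: if_splits)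
  have "H g - Main g = Main g * ((R - 1) * (R + 1))"
    unfolding H_eq R_def[symmetric] by (simp add: power2_eq_square algebra_simps)
  then have "\<bar>H g - Main g\<bar> = \<bar>Main g\<bar> * (\<bar>R - 1\<bar> * (R + 1))"
    using 1 by (simp only: abs_mult)
  also have "\<dots> \<le> \<bar>Main g\<bar> * ((\<Sum>\<gamma>\<in>\<Gamma>. \<bar>y \<gamma> g\<bar>) * 3)"
    using 1 by (intro mult_left_mono mult_mono) auto
  finally show ?thesis by (simp add: mult_ac)
qed

text \<open>The first bound has the small factor \<open>b\<close>, since
  \<open>(t \<gamma>)\<^sup>2 \<le> b\<close> also bounds the cross term through the
  arithmetic-geometric inequality. The other two only keep exponentials bounded.\<close>

lemma uu_norm:
  assumes e: "e \<in> \<Gamma>\<times>\<Gamma>" and s: "s \<in> \<Omega>" "s' \<in> \<Omega>"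
  defines "\<psi> \<equiv> lin J (uu e s s') (uu e s s') / 2 - \<rho> e"
  shows "\<bar>\<psi>\<bar> \<le> 3 * b * \<eta> s s'" "\<bar>\<psi>\<bar> \<le> 9" "\<bar>\<rho> e\<bar> \<le> 1"
proof -
  obtain \<gamma> \<gamma>' where ee: "e = (\<gamma>, \<gamma>')" "\<gamma> \<in> \<Gamma>" "\<gamma>' \<in> \<Gamma>" using e by auto
  define T T' where "T = t \<gamma>" and "T' = t \<gamma>'"
  note tb = t_bounds[OF ee(2), folded T_def] t_bounds[OF ee(3), folded T'_def]
  define A where "A s = lin J (vd s) (vd s) - r" for s
  define k where "k = lin J (vd s) (vd s')"
  have chi: "\<psi> = T\<^sup>2 * A s / 2 + T'\<^sup>2 * A s' / 2 + T * T' * k"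
    unfolding \<psi>_def A_def k_def uu_def \<rho>_def ee T_def T'_def
    by (simp add: lin_simps lin_commute[of J "vd s'" "vd s"] power2_eq_square field_simps)
  have TT: "\<bar>T * T'\<bar> \<le> (T\<^sup>2 + T'\<^sup>2) / 2"
  proof -
    have "0 \<le> (\<bar>T\<bar> - \<bar>T'\<bar>)\<^sup>2" by simp
    then show ?thesis by (simp add: power2_eq_square abs_mult algebra_simps)
  qed
  have \<eta>0: "0 \<le> \<eta> s s'" by (rule \<eta>_nonneg)
  have e: "\<bar>k\<bar> \<le> \<eta> s s'" "\<bar>A s\<bar> \<le> 2 * \<eta> s s'" "\<bar>A s'\<bar> \<le> 2 * \<eta> s s'"
    using vd_self_le[of s s'] vd_self_le[of s' s] vd_vd_le[of s s']
    by (auto simp: k_def A_def \<eta>_sym[of s' s])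
  have h: "\<bar>T\<^sup>2 * A s\<bar> \<le> b * (2 * \<eta> s s')" "\<bar>T'\<^sup>2 * A s'\<bar> \<le> b * (2 * \<eta> s s')" "\<bar>T * T' * k\<bar> \<le> b * \<eta> s s'"
    using TT tb e b0 \<eta>0 unfolding abs_mult[of "T\<^sup>2"] abs_mult[of "T'\<^sup>2"] abs_mult[of "T * T'" k]
    by (auto intro!: mult_mono)
  have "\<bar>\<psi>\<bar> \<le> \<bar>T\<^sup>2 * A s\<bar> / 2 + \<bar>T'\<^sup>2 * A s'\<bar> / 2 + \<bar>T * T' * k\<bar>"
    unfolding chi by linarith
  also have "\<dots> \<le> 3 * b * \<eta> s s'" using h by simp
  finally show "\<bar>\<psi>\<bar> \<le> 3 * b * \<eta> s s'" .
  have A5: "\<bar>A s\<bar> \<le> 5 * L\<^sup>2" "\<bar>A s'\<bar> \<le> 5 * L\<^sup>2" "\<bar>k\<bar> \<le> 4 * L\<^sup>2"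
    using vd_vd_size[OF s(1) s(1)] vd_vd_size[OF s(2) s(2)] vd_vd_size[OF s] r_bound
    unfolding A_def k_def by linarith+
  have h1: "\<bar>T\<^sup>2 * A s\<bar> \<le> T\<^sup>2 * (5 * L\<^sup>2)" "\<bar>T'\<^sup>2 * A s'\<bar> \<le> T'\<^sup>2 * (5 * L\<^sup>2)"
    "\<bar>T * T' * k\<bar> \<le> ((T\<^sup>2 + T'\<^sup>2) / 2) * (4 * L\<^sup>2)"
    unfolding abs_mult[of "T\<^sup>2"] abs_mult[of "T'\<^sup>2"] abs_mult[of "T * T'" k]
    by (intro mult_mono TT A5 mult_nonneg_nonneg; simp)+
  have "((T\<^sup>2 + T'\<^sup>2) / 2) * (4 * L\<^sup>2) = 2 * (T\<^sup>2 * L\<^sup>2) + 2 * (T'\<^sup>2 * L\<^sup>2)" by (simp add: algebra_simps)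
  then have h2: "\<bar>T\<^sup>2 * A s\<bar> \<le> 5" "\<bar>T'\<^sup>2 * A s'\<bar> \<le> 5" "\<bar>T * T' * k\<bar> \<le> 4"
    using h1 tb by auto
  show "\<bar>\<psi>\<bar> \<le> 9" unfolding chi using h2 by linarith
  have "\<bar>T\<^sup>2 * r\<bar> \<le> T\<^sup>2 * L\<^sup>2" "\<bar>T'\<^sup>2 * r\<bar> \<le> T'\<^sup>2 * L\<^sup>2"
    using r_bound unfolding abs_mult[of "T\<^sup>2"] abs_mult[of "T'\<^sup>2"] by (auto intro!: mult_mono)
  then have "\<bar>T\<^sup>2 * r\<bar> \<le> 1" "\<bar>T'\<^sup>2 * r\<bar> \<le> 1" using tb by auto
  then show "\<bar>\<rho> e\<bar> \<le> 1" unfolding \<rho>_def ee T_def T'_def by (simp add: distrib_right)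
qed

lemma Ee_square:
  "integrable P (\<lambda>g. (Ee e s s' g)\<^sup>2)" "e \<in> \<Gamma>\<times>\<Gamma> \<Longrightarrow> s \<in> \<Omega> \<Longrightarrow> s' \<in> \<Omega> \<Longrightarrow> (\<integral>g. (Ee e s s' g)\<^sup>2 \<partial>P) \<le> exp 38"
proof -
  have eq: "(Ee e s s' g)\<^sup>2 = exp (lin J g (\<lambda>i. 2 * uu e s s' i)) * exp (- 2 * \<rho> e)" for g
    by (simp add: Ee_def power2_eq_square exp_add[symmetric] lin_scale_right algebra_simps)
  show "integrable P (\<lambda>g. (Ee e s s' g)\<^sup>2)"
    unfolding eq by (intro integrable_mult_left gauss_exp fin_J)
  assume a: "e \<in> \<Gamma>\<times>\<Gamma>" "s \<in> \<Omega>" "s' \<in> \<Omega>"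
  have "(\<integral>g. (Ee e s s' g)\<^sup>2 \<partial>P) = exp (lin J (\<lambda>i. 2 * uu e s s' i) (\<lambda>i. 2 * uu e s s' i) / 2) * exp (- 2 * \<rho> e)"
    unfolding eq by (simp add: gauss_exp fin_J)
  also have "\<dots> = exp (4 * (lin J (uu e s s') (uu e s s') / 2 - \<rho> e) + 2 * \<rho> e)"
    by (simp add: exp_add[symmetric] lin_scale_left lin_scale_right algebra_simps)
  \<comment> \<open>38 is 4 times the bound 9 plus twice the bound 1 of
    \<open>uu_norm\<close>.\<close>
  also have "\<dots> \<le> exp 38"
    using uu_norm[OF a] by (auto simp: abs_le_iff)
  finally show "(\<integral>g. (Ee e s s' g)\<^sup>2 \<partial>P) \<le> exp 38" .
qed

lemma Ee_measurable [measurable]: "Ee e s s' \<in> borel_measurable P"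
  unfolding Ee_def by measurable

lemma Main_measurable [measurable]: "Main \<in> borel_measurable P"
  unfolding Main_def by measurable

text \<open>Cauchy--Schwarz over the pairs of spin values. The factor \<open>f\<close> supplies
  \<open>\<eta>\<close> squared, and the square integrability of \<open>Ee\<close> does the rest;
  there is no gain in \<open>b\<close>.\<close>

lemma Main_square:
  "integrable P (\<lambda>g. (Main g)\<^sup>2)" "(\<integral>g. (Main g)\<^sup>2 \<partial>P) \<le> 96 * exp 38 * L^4 * nG^4 * W"
proof -
  let ?U = "\<lambda>g. avg2 (\<lambda>s s'. 4 * L^4 * nG\<^sup>2 * (f s s')\<^sup>2 * (\<Sum>e\<in>\<Gamma>\<times>\<Gamma>. (Ee e s s' g)\<^sup>2))"
  have le: "(Main g)\<^sup>2 \<le> ?U g" for g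
  proof -
    have "(Main g)\<^sup>2 \<le> avg2 (\<lambda>s s'. (f s s' * (\<Sum>e\<in>\<Gamma>\<times>\<Gamma>. (\<Phi> e - c) * (\<pi> e (lin J g vb) * Ee e s s' g)))\<^sup>2)"
      unfolding Main_def by (intro order_trans[OF avg_square] avg_mono avg_square)
    also have "\<dots> \<le> ?U g"
    proof (intro avg_mono)
      fix s s'
      let ?S = "\<Sum>e\<in>\<Gamma>\<times>\<Gamma>. (\<Phi> e - c) * (\<pi> e (lin J g vb) * Ee e s s' g)"
      have "\<bar>?S\<bar> \<le> (\<Sum>e\<in>\<Gamma>\<times>\<Gamma>. \<bar>(\<Phi> e - c) * (\<pi> e (lin J g vb) * Ee e s s' g)\<bar>)" by (rule sum_abs)
      also have "\<dots> \<le> (\<Sum>e\<in>\<Gamma>\<times>\<Gamma>. 2 * L\<^sup>2 * (1 * \<bar>Ee e s s' g\<bar>))"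
        unfolding abs_mult by (intro sum_mono mult_mono Phi_c pi_bounds) auto
      finally have "\<bar>?S\<bar> \<le> \<bar>2 * L\<^sup>2 * (\<Sum>e\<in>\<Gamma>\<times>\<Gamma>. \<bar>Ee e s s' g\<bar>)\<bar>" by (simp add: sum_distrib_left)
      then have "?S\<^sup>2 \<le> (2 * L\<^sup>2 * (\<Sum>e\<in>\<Gamma>\<times>\<Gamma>. \<bar>Ee e s s' g\<bar>))\<^sup>2" by (simp only: abs_le_square_iff)
      also have "\<dots> = 4 * L^4 * (\<Sum>e\<in>\<Gamma>\<times>\<Gamma>. \<bar>Ee e s s' g\<bar>)\<^sup>2"
        by (simp add: power_mult_distrib)
      also have "\<dots> \<le> 4 * L^4 * (nG\<^sup>2 * (\<Sum>e\<in>\<Gamma>\<times>\<Gamma>. (Ee e s s' g)\<^sup>2))"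
        using sum_abs_square_le[of "\<Gamma>\<times>\<Gamma>" "\<lambda>e. Ee e s s' g"] fin_Gamma unfolding card_GG
        by (intro mult_left_mono) auto
      finally have "(f s s')\<^sup>2 * ?S\<^sup>2 \<le> (f s s')\<^sup>2 * (4 * L^4 * (nG\<^sup>2 * (\<Sum>e\<in>\<Gamma>\<times>\<Gamma>. (Ee e s s' g)\<^sup>2)))"
        by (rule mult_left_mono) simp
      then show "(f s s' * ?S)\<^sup>2 \<le> 4 * L^4 * nG\<^sup>2 * (f s s')\<^sup>2 * (\<Sum>e\<in>\<Gamma>\<times>\<Gamma>. (Ee e s s' g)\<^sup>2)"
        by (simp add: power_mult_distrib mult_ac)
    qed
    finally show ?thesis .
  qed
  have i1: "integrable P (\<lambda>g. 4 * L^4 * nG\<^sup>2 * (f s s')\<^sup>2 * (\<Sum>e\<in>\<Gamma>\<times>\<Gamma>. (Ee e s s' g)\<^sup>2))" for s s'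
    by (intro integrable_mult_right Bochner_Integration.integrable_sum Ee_square)
  have iU: "integrable P ?U" by (intro avg_integrable i1)
  show 1: "integrable P (\<lambda>g. (Main g)\<^sup>2)"
    by (rule Bochner_Integration.integrable_bound[OF iU]) (auto intro!: order_trans[OF le] abs_ge_self)
  have "(\<integral>g. (Main g)\<^sup>2 \<partial>P) \<le> (\<integral>g. ?U g \<partial>P)" by (rule integral_mono[OF 1 iU le])
  also have "\<dots> = avg2 (\<lambda>s s'. \<integral>g. 4 * L^4 * nG\<^sup>2 * (f s s')\<^sup>2 * (\<Sum>e\<in>\<Gamma>\<times>\<Gamma>. (Ee e s s' g)\<^sup>2) \<partial>P)"
    by (subst avg_integral; intro avg_integrable avg_cong avg_integral i1)
  also have "\<dots> \<le> avg2 (\<lambda>s s'. 4 * L^4 * nG\<^sup>2 * (\<eta> s s')\<^sup>2 * (\<Sum>e\<in>\<Gamma>\<times>\<Gamma>. exp 38))"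
  proof (intro avg_mono)
    fix s s' assume s: "s \<in> \<Omega>" "s' \<in> \<Omega>"
    have "(\<integral>g. 4 * L^4 * nG\<^sup>2 * (f s s')\<^sup>2 * (\<Sum>e\<in>\<Gamma>\<times>\<Gamma>. (Ee e s s' g)\<^sup>2) \<partial>P)
      = 4 * L^4 * nG\<^sup>2 * (f s s')\<^sup>2 * (\<Sum>e\<in>\<Gamma>\<times>\<Gamma>. \<integral>g. (Ee e s s' g)\<^sup>2 \<partial>P)"
      by (simp add: Ee_square Bochner_Integration.integral_sum)
    also have "\<dots> \<le> 4 * L^4 * nG\<^sup>2 * (\<eta> s s')\<^sup>2 * (\<Sum>e\<in>\<Gamma>\<times>\<Gamma>. exp 38)"
    proof (intro mult_mono sum_mono Ee_square s)
      show "(f s s')\<^sup>2 \<le> (\<eta> s s')\<^sup>2"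
        using f_bound[OF s] \<eta>_nonneg[of s s'] by (intro abs_le_square_iff[THEN iffD1]) simp
    qed (auto intro!: sum_nonneg)
    finally show "(\<integral>g. 4 * L^4 * nG\<^sup>2 * (f s s')\<^sup>2 * (\<Sum>e\<in>\<Gamma>\<times>\<Gamma>. (Ee e s s' g)\<^sup>2) \<partial>P) \<le> \<dots>" .
  qed
  also have "\<dots> = 4 * L^4 * nG^4 * exp 38 * avg2 (\<lambda>s s'. (\<eta> s s')\<^sup>2)"
  proof -
    have *: "4 * L^4 * nG\<^sup>2 * (\<eta> s s')\<^sup>2 * (\<Sum>e\<in>\<Gamma>\<times>\<Gamma>. exp 38) = 4 * L^4 * nG^4 * exp 38 * (\<eta> s s')\<^sup>2" for s s'
      unfolding sum_constant card_GG by (simp add: power4_eq_xxxx power2_eq_square mult_ac)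
    show ?thesis unfolding * avg_cmult ..
  qed
  also have "\<dots> \<le> 4 * L^4 * nG^4 * exp 38 * (24 * W)"
    using L1 nG by (intro mult_left_mono avg2_eta_square) auto
  finally show "(\<integral>g. (Main g)\<^sup>2 \<partial>P) \<le> 96 * exp 38 * L^4 * nG^4 * W" by (simp add: mult_ac)
qed

definition "pe e = (\<integral>g. \<pi> e (lin J g vb) \<partial>P)"

lemma pi_int: "integrable P (\<lambda>g. \<pi> e (lin J g vb + x))"
  by (rule P.integrable_const_bound[of _ 1]) (auto simp: \<pi>_def intro!: ef.eavg_bound)

text \<open>Cameron--Martin turns \<open>Ee\<close> into a scalar \<open>exp \<psi>\<close> and a
  shift \<open>\<theta>\<close> of the mean field. Both corrections are of order
  \<open>b * \<eta> s s'\<close>: the first by \<open>uu_norm\<close>, the second because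
  \<open>\<theta>\<close> and the Lipschitz constant of \<open>\<pi>\<close> each carry a factor
  \<open>b * L\<close>.\<close>

lemma
  shows pi_Ee_integrable: "integrable P (\<lambda>g. \<pi> e (lin J g vb) * Ee e s s' g)"
    and pi_Ee_le: "e \<in> \<Gamma>\<times>\<Gamma> \<Longrightarrow> s \<in> \<Omega> \<Longrightarrow> s' \<in> \<Omega> \<Longrightarrow>
      \<bar>(\<integral>g. \<pi> e (lin J g vb) * Ee e s s' g \<partial>P) - pe e\<bar> \<le> 4 * exp 9 * b * \<eta> s s'"
proof -
  let ?u = "uu e s s'"
  define \<theta> where "\<theta> = lin J ?u vb"
  define \<psi> where "\<psi> = lin J ?u ?u / 2 - \<rho> e"
  have eq: "\<pi> e (lin J g vb) * Ee e s s' g = (\<pi> e (lin J g vb) * exp (lin J g ?u)) * exp (- \<rho> e)" for g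
    by (simp add: Ee_def exp_diff exp_minus divide_inverse)
  have sh: "lin J (\<lambda>i\<in>J. g i + ?u i) vb = lin J g vb + \<theta>" for g
    unfolding \<theta>_def lin_add_left[symmetric] by (rule lin_cong) auto
  have m: "(\<lambda>g. \<pi> e (lin J g vb)) \<in> borel_measurable P" by measurable
  show "integrable P (\<lambda>g. \<pi> e (lin J g vb) * Ee e s s' g)"
    unfolding eq by (rule integrable_mult_left) (simp add: cameron_martin(2)[OF fin_J m] sh pi_int)
  assume a: "e \<in> \<Gamma>\<times>\<Gamma>" "s \<in> \<Omega>" "s' \<in> \<Omega>"
  define A where "A = (\<integral>g. \<pi> e (lin J g vb + \<theta>) \<partial>P)"
  have E: "(\<integral>g. \<pi> e (lin J g vb) * Ee e s s' g \<partial>P) = exp \<psi> * A"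
  proof -
    have 1: "(\<integral>g. \<pi> e (lin J g vb) * exp (lin J g ?u) \<partial>P) = exp (lin J ?u ?u / 2) * A"
      using cameron_martin(1)[OF fin_J m, of ?u] unfolding sh A_def .
    have 2: "(\<integral>g. \<pi> e (lin J g vb) * exp (lin J g ?u) * exp (- \<rho> e) \<partial>P)
      = (\<integral>g. \<pi> e (lin J g vb) * exp (lin J g ?u) \<partial>P) * exp (- \<rho> e)"
      by (rule integral_mult_left_zero)
    have 3: "exp \<psi> = exp (lin J ?u ?u / 2) * exp (- \<rho> e)"
      unfolding \<psi>_def exp_add[symmetric] by simp
    show ?thesis unfolding eq 2 1 3 by (simp only: mult_ac)
  qed
  have \<eta>0: "0 \<le> \<eta> s s'" by (rule \<eta>_nonneg)
  have A1: "\<bar>A\<bar> \<le> 1"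
  proof -
    have "\<bar>A\<bar> \<le> (\<integral>g. \<bar>\<pi> e (lin J g vb + \<theta>)\<bar> \<partial>P)" unfolding A_def by (rule integral_abs_bound)
    also have "\<dots> \<le> (\<integral>g. 1 \<partial>P)" by (intro integral_mono integrable_abs pi_int pi_bounds a) auto
    finally show ?thesis using P.prob_space by simp
  qed
  have "\<bar>A - pe e\<bar> \<le> 4 * (b * L) * \<bar>\<theta>\<bar>"
  proof -
    have i0: "integrable P (\<lambda>g. \<pi> e (lin J g vb))" using pi_int[of e 0] by simp
    have E: "A - pe e = (\<integral>g. \<pi> e (lin J g vb + \<theta>) - \<pi> e (lin J g vb) \<partial>P)"
      unfolding A_def pe_def by (simp add: pi_int i0)
    have "\<bar>A - pe e\<bar> \<le> (\<integral>g. \<bar>\<pi> e (lin J g vb + \<theta>) - \<pi> e (lin J g vb)\<bar> \<partial>P)"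
      unfolding E by (rule integral_abs_bound)
    also have "\<dots> \<le> (\<integral>g. 4 * (b * L) * \<bar>\<theta>\<bar> \<partial>P)"
    proof (intro integral_mono integrable_abs Bochner_Integration.integrable_diff pi_int i0)
      show "\<bar>\<pi> e (lin J g vb + \<theta>) - \<pi> e (lin J g vb)\<bar> \<le> 4 * (b * L) * \<bar>\<theta>\<bar>" for g
        using pi_lipschitz[of e "lin J g vb + \<theta>" "lin J g vb"] by simp
    qed auto
    finally show ?thesis using P.prob_space by simp
  qed
  also have "\<dots> \<le> 4 * (b * L) * (2 * (b * L) * \<eta> s s')"
  proof (intro mult_left_mono)
    have "\<theta> = t (fst e) * lin J (vd s) vb + t (snd e) * lin J (vd s') vb"
      by (simp add: \<theta>_def uu_def lin_add_left lin_scale_left)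
    then have "\<bar>\<theta>\<bar> \<le> \<bar>t (fst e)\<bar> * \<bar>lin J (vd s) vb\<bar> + \<bar>t (snd e)\<bar> * \<bar>lin J (vd s') vb\<bar>"
      by (metis abs_mult abs_triangle_ineq)
    also have "\<dots> \<le> (b * L) * \<eta> s s' + (b * L) * \<eta> s s'"
      using a t_bounds(1)[of "fst e"] t_bounds(1)[of "snd e"] vd_vb_le[of s s'] vd_vb_le[of s' s] \<eta>0 b0 L1
      by (intro add_mono mult_mono) (auto simp: \<eta>_sym[of s' s])
    finally show "\<bar>\<theta>\<bar> \<le> 2 * (b * L) * \<eta> s s'" by (simp add: mult_ac)
  qed (use b0 L1 in auto)
  also have "\<dots> = 8 * (b * (b * L\<^sup>2)) * \<eta> s s'" by (simp add: power2_eq_square)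
  also have "\<dots> \<le> 8 * (b * 1) * \<eta> s s'"
    using b0 bL \<eta>0 by (intro mult_right_mono mult_left_mono) auto
  finally have 1: "\<bar>A - pe e\<bar> \<le> 8 * (b * \<eta> s s')" by simp
  have "\<bar>exp \<psi> - 1\<bar> \<le> \<bar>\<psi>\<bar> * exp \<bar>\<psi>\<bar>" by (rule abs_exp_minus_one_le)
  also have "\<dots> \<le> (3 * b * \<eta> s s') * exp 9"
    using uu_norm[OF a, folded \<psi>_def] b0 \<eta>0 by (intro mult_mono) auto
  finally have "\<bar>exp \<psi> - 1\<bar> * \<bar>A\<bar> \<le> ((3 * b * \<eta> s s') * exp 9) * 1"
    using A1 b0 \<eta>0 by (intro mult_mono) auto
  then have 2: "\<bar>(exp \<psi> - 1) * A\<bar> \<le> 3 * exp 9 * (b * \<eta> s s')" by (simp add: abs_mult mult_ac)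
  have "exp \<psi> * A - pe e = (exp \<psi> - 1) * A + (A - pe e)" by (simp add: algebra_simps)
  then have "\<bar>exp \<psi> * A - pe e\<bar> \<le> 3 * exp 9 * (b * \<eta> s s') + 8 * (b * \<eta> s s')" using 1 2 by linarith
  moreover have "8 * (b * \<eta> s s') \<le> exp 9 * (b * \<eta> s s')"
    using b0 \<eta>0 exp_ge_add_one_self[of "9::real"] by (intro mult_right_mono mult_nonneg_nonneg) auto
  ultimately show "\<bar>(\<integral>g. \<pi> e (lin J g vb) * Ee e s s' g \<partial>P) - pe e\<bar> \<le> 4 * exp 9 * b * \<eta> s s'"
    unfolding E by (simp add: mult_ac)
qed

text \<open>The fixed point equation enters here: the sum would vanish if the mean field had
  variance exactly \<open>q\<close>. Its variance is \<open>lin J vb vb\<close>, and by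
  \<open>gauss_second_difference\<close> the error is linear in the difference of the variances.
  That difference is a full average of \<open>d\<close>, hence below \<open>\<eta> s s'\<close> for
  every pair.\<close>

lemma sum_pe: "\<bar>\<Sum>e\<in>\<Gamma>\<times>\<Gamma>. (\<Phi> e - c) * pe e\<bar> \<le> 24 * L\<^sup>2 * b * \<eta> s s'"
proof -
  let ?\<phi> = "eavg (\<Gamma>\<times>\<Gamma>) w2 cc \<Phi>"
  have bd: "\<bar>?\<phi> x\<bar> \<le> L\<^sup>2" for x by (intro ef.eavg_bound Phi_bound) auto
  have i0: "integrable P (\<lambda>g. \<pi> e (lin J g vb))" for e using pi_int[of e 0] by simp
  have iphi: "integrable P (\<lambda>g. ?\<phi> (lin J g vb))"
    by (rule P.integrable_const_bound[of _ "L\<^sup>2"]) (use bd in auto)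
  have one: "(\<Sum>e\<in>\<Gamma>\<times>\<Gamma>. \<pi> e x) = 1" for x
    using eavg_pi[of "\<lambda>_. 1" x] ef.Z_pos[of x] by (simp add: eavg_def)
  have "(\<Sum>e\<in>\<Gamma>\<times>\<Gamma>. (\<Phi> e - c) * pe e) = (\<integral>g. (\<Sum>e\<in>\<Gamma>\<times>\<Gamma>. (\<Phi> e - c) * \<pi> e (lin J g vb)) \<partial>P)"
    unfolding pe_def by (simp add: i0 Bochner_Integration.integral_sum)
  also have "\<dots> = (\<integral>g. ?\<phi> (lin J g vb) - c \<partial>P)"
    by (intro Bochner_Integration.integral_cong refl)
       (simp add: eavg_pi left_diff_distrib sum_subtractf sum_distrib_left[symmetric] one)
  also have "\<dots> = (\<integral>g. ?\<phi> (lin J g vb) \<partial>P) - c"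
    using iphi P.prob_space by simp
  also have "(\<integral>g. ?\<phi> (lin J g vb) \<partial>P) = (\<integral>x. ?\<phi> (sqrt (lin J vb vb) * x) \<partial>stdN)"
    by (rule integral_lin_stdN(1)[OF fin_J]) measurable
  finally have eq: "(\<Sum>e\<in>\<Gamma>\<times>\<Gamma>. (\<Phi> e - c) * pe e)
     = (\<integral>x. ?\<phi> (sqrt (lin J vb vb) * x) \<partial>stdN) - (\<integral>x. ?\<phi> (sqrt q * x) \<partial>stdN)"
    by (simp add: c_eq)
  have "\<bar>\<Sum>e\<in>\<Gamma>\<times>\<Gamma>. (\<Phi> e - c) * pe e\<bar> \<le> (12 * L\<^sup>2 * (2 * (b * L))\<^sup>2) / 2 * \<bar>lin J vb vb - q\<bar>"
    unfolding eq
    by (rule gauss_second_difference[OF _ bd])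
       (use q_bounds ef.eavg_second_difference[of "L\<^sup>2" \<Phi>] Phi_bound lin_self_nonneg in auto)
  also have "\<dots> = 24 * L\<^sup>2 * (b * (b * L\<^sup>2)) * \<bar>lin J vb vb - q\<bar>" by (simp add: power2_eq_square)
  also have "\<dots> \<le> 24 * L\<^sup>2 * (b * 1) * \<eta> s s'"
    using b0 bL vb_vb_le \<eta>_nonneg by (intro mult_mono) auto
  finally show ?thesis by simp
qed

lemma Main_integrable: "integrable P Main"
  unfolding Main_def
  by (intro avg_integrable integrable_mult_right Bochner_Integration.integrable_sum pi_Ee_integrable)

text \<open>Two small factors meet: \<open>f\<close> is at most \<open>\<eta>\<close>, and the
  integral multiplying it is at most a constant times \<open>b * \<eta>\<close>, with 32 = 8 + 24
  from the two previous estimates. This yields the factor \<open>b\<close> that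
  \<open>Main_square\<close> does not give.\<close>

lemma Main_expectation: "\<bar>\<integral>g. Main g \<partial>P\<bar> \<le> 768 * exp 9 * L\<^sup>2 * nG\<^sup>2 * b * W"
proof -
  let ?S = "\<lambda>s s' g. \<Sum>e\<in>\<Gamma>\<times>\<Gamma>. (\<Phi> e - c) * (\<pi> e (lin J g vb) * Ee e s s' g)"
  have i: "integrable P (\<lambda>g. f s s' * ?S s s' g)" for s s'
    by (intro integrable_mult_right Bochner_Integration.integrable_sum pi_Ee_integrable)
  have E: "(\<integral>g. Main g \<partial>P) = avg2 (\<lambda>s s'. \<integral>g. f s s' * ?S s s' g \<partial>P)"
    unfolding Main_def by (subst avg_integral; intro avg_integrable avg_cong avg_integral i)
  have "\<bar>\<integral>g. Main g \<partial>P\<bar> \<le> avg2 (\<lambda>s s'. \<bar>\<integral>g. f s s' * ?S s s' g \<partial>P\<bar>)"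
    unfolding E by (rule order_trans[OF avg_abs]) (intro avg_mono avg_abs)
  also have "\<dots> \<le> avg2 (\<lambda>s s'. 32 * exp 9 * L\<^sup>2 * nG\<^sup>2 * b * (\<eta> s s')\<^sup>2)"
  proof (intro avg_mono)
    fix s s' assume s: "s \<in> \<Omega>" "s' \<in> \<Omega>"
    let ?I = "\<lambda>e. \<integral>g. \<pi> e (lin J g vb) * Ee e s s' g \<partial>P"
    have \<eta>0: "0 \<le> \<eta> s s'" by (rule \<eta>_nonneg)
    have "(\<integral>g. f s s' * ?S s s' g \<partial>P)
      = f s s' * (\<Sum>e\<in>\<Gamma>\<times>\<Gamma>. (\<Phi> e - c) * ?I e)"
      by (simp add: pi_Ee_integrable Bochner_Integration.integral_sum)
    also have "(\<Sum>e\<in>\<Gamma>\<times>\<Gamma>. (\<Phi> e - c) * ?I e) = (\<Sum>e\<in>\<Gamma>\<times>\<Gamma>. (\<Phi> e - c) * (?I e - pe e)) + (\<Sum>e\<in>\<Gamma>\<times>\<Gamma>. (\<Phi> e - c) * pe e)"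
      by (simp add: sum.distrib[symmetric] algebra_simps)
    finally have "\<bar>\<integral>g. f s s' * ?S s s' g \<partial>P\<bar>
      = \<bar>f s s'\<bar> * \<bar>(\<Sum>e\<in>\<Gamma>\<times>\<Gamma>. (\<Phi> e - c) * (?I e - pe e)) + (\<Sum>e\<in>\<Gamma>\<times>\<Gamma>. (\<Phi> e - c) * pe e)\<bar>"
      by (simp only: abs_mult)
    also have "\<dots> \<le> \<eta> s s' * (32 * exp 9 * L\<^sup>2 * nG\<^sup>2 * b * \<eta> s s')"
    proof (intro mult_mono f_bound s)
      have "\<bar>\<Sum>e\<in>\<Gamma>\<times>\<Gamma>. (\<Phi> e - c) * (?I e - pe e)\<bar> \<le> (\<Sum>e\<in>\<Gamma>\<times>\<Gamma>. \<bar>(\<Phi> e - c) * (?I e - pe e)\<bar>)" by (rule sum_abs)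
      also have "\<dots> \<le> (\<Sum>e\<in>\<Gamma>\<times>\<Gamma>. 2 * L\<^sup>2 * (4 * exp 9 * b * \<eta> s s'))"
        unfolding abs_mult by (intro sum_mono mult_mono Phi_c pi_Ee_le s) auto
      also have "\<dots> = 8 * (exp 9 * L\<^sup>2 * nG\<^sup>2 * b * \<eta> s s')" unfolding sum_constant card_GG by simp
      finally have 1: "\<bar>\<Sum>e\<in>\<Gamma>\<times>\<Gamma>. (\<Phi> e - c) * (?I e - pe e)\<bar> \<le> 8 * (exp 9 * L\<^sup>2 * nG\<^sup>2 * b * \<eta> s s')" .
      have "1 * 1 * (L\<^sup>2 * b * \<eta> s s') \<le> exp 9 * nG\<^sup>2 * (L\<^sup>2 * b * \<eta> s s')"
        using nG b0 \<eta>0 by (intro mult_right_mono mult_mono) (auto intro!: mult_nonneg_nonneg)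
      then have "24 * L\<^sup>2 * b * \<eta> s s' \<le> 24 * (exp 9 * L\<^sup>2 * nG\<^sup>2 * b * \<eta> s s')" by (simp add: mult_ac)
      with sum_pe[of s s'] 1
      show "\<bar>(\<Sum>e\<in>\<Gamma>\<times>\<Gamma>. (\<Phi> e - c) * (?I e - pe e)) + (\<Sum>e\<in>\<Gamma>\<times>\<Gamma>. (\<Phi> e - c) * pe e)\<bar> \<le> 32 * exp 9 * L\<^sup>2 * nG\<^sup>2 * b * \<eta> s s'"
        by linarith
    qed (use \<eta>0 in auto)
    finally show "\<bar>\<integral>g. f s s' * ?S s s' g \<partial>P\<bar>
      \<le> 32 * exp 9 * L\<^sup>2 * nG\<^sup>2 * b * (\<eta> s s')\<^sup>2" by (simp add: power2_eq_square mult_ac)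
  qed
  also have "\<dots> \<le> 32 * exp 9 * L\<^sup>2 * nG\<^sup>2 * b * (24 * W)"
    unfolding avg_cmult using b0 by (intro mult_left_mono avg2_eta_square) auto
  finally show ?thesis by simp
qed

text \<open>The mean of \<open>Main\<close> is already small; the replaced partition function costs
  at most \<open>\<bar>Main\<bar>\<close> times the sum of \<open>\<bar>y\<bar>\<close>, of order
  \<open>sqrt W\<close> and \<open>b * sqrt W\<close> in mean square. The positive number
  \<open>B\<close> stands in for \<open>b\<close>, which may be 0 and could not be a
  divisor.\<close>

theorem H_expectation: "\<bar>\<integral>g. H g \<partial>P\<bar> \<le> 1056 * exp 38 * L^4 * nG^4 * B * W"
proof -
  let ?S = "\<lambda>g. \<Sum>\<gamma>\<in>\<Gamma>. \<bar>y \<gamma> g\<bar>"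
  define K where "K = exp 38 * L^4 * nG^4"
  have K: "exp 13 * nG\<^sup>2 \<le> K" "exp 9 * L\<^sup>2 * nG\<^sup>2 \<le> K"
  proof -
    have a: "L\<^sup>2 \<le> L^4" "nG\<^sup>2 \<le> nG^4" "1 \<le> L^4" "1 \<le> nG^4"
      using L1 nG by (auto intro: power_increasing)
    have "exp 13 * 1 * nG\<^sup>2 \<le> exp 38 * L^4 * nG^4" using a by (intro mult_mono) auto
    then show "exp 13 * nG\<^sup>2 \<le> K" by (simp add: K_def)
    show "exp 9 * L\<^sup>2 * nG\<^sup>2 \<le> K" unfolding K_def using a by (intro mult_mono) auto
  qed
  have iH: "integrable P H" unfolding H_def by (rule full2_integrable)
  have iHM: "integrable P (\<lambda>g. H g - Main g)" by (intro Bochner_Integration.integrable_diff iH Main_integrable)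
  \<comment> \<open>Young's inequality weighted by \<open>B\<close>: it balances the orders
    \<open>W\<close> and \<open>B\<^sup>2 * W\<close> of the two second moments, so both terms
    become of order \<open>B * W\<close>.\<close>
  let ?U = "\<lambda>g. 3 / 2 * (B * (Main g)\<^sup>2 + (?S g)\<^sup>2 / B)"
  have iU: "integrable P ?U"
    by (intro integrable_mult_right Bochner_Integration.integrable_add integrable_divide Main_square y_sum_integrable)
  have le: "\<bar>H g - Main g\<bar> \<le> ?U g" for g
  proof -
    have "0 \<le> (B * \<bar>Main g\<bar> - ?S g)\<^sup>2 / B" using bB by simp
    also have "(B * \<bar>Main g\<bar> - ?S g)\<^sup>2 / B = B * (Main g)\<^sup>2 + (?S g)\<^sup>2 / B - 2 * \<bar>Main g\<bar> * ?S g"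
    proof -
      have "(B * \<bar>m\<bar> - s)\<^sup>2 / B = B * m\<^sup>2 + s\<^sup>2 / B - 2 * \<bar>m\<bar> * s" for m s
        using bB by (simp add: power2_diff power_mult_distrib diff_divide_distrib add_divide_distrib) (simp add: power2_eq_square)
      then show ?thesis .
    qed
    finally have "0 \<le> B * (Main g)\<^sup>2 + (?S g)\<^sup>2 / B - 2 * (\<bar>Main g\<bar> * ?S g)" by (simp add: mult.assoc)
    moreover have "\<bar>H g - Main g\<bar> \<le> 3 * (\<bar>Main g\<bar> * ?S g)" using H_diff[of g] by (simp add: mult.assoc)
    moreover have "a \<le> 3 / 2 * (u + v)" if "0 \<le> u + v - 2 * x" "a \<le> 3 * x" for a u v x :: real
      using that by (simp add: field_simps)
    ultimately show ?thesis by blast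
  qed
  have "\<bar>\<integral>g. H g - Main g \<partial>P\<bar> \<le> (\<integral>g. \<bar>H g - Main g\<bar> \<partial>P)" by (rule integral_abs_bound)
  also have "\<dots> \<le> (\<integral>g. ?U g \<partial>P)" by (intro integral_mono integrable_abs iHM iU le)
  also have "\<dots> = 3 / 2 * (B * (\<integral>g. (Main g)\<^sup>2 \<partial>P) + (\<integral>g. (?S g)\<^sup>2 \<partial>P) / B)"
    by (simp add: Main_square y_sum_integrable)
  also have "\<dots> \<le> 3 / 2 * (B * (96 * K * W) + 96 * K * B * W)"
  proof (intro mult_left_mono add_mono)
    show "(\<integral>g. (Main g)\<^sup>2 \<partial>P) \<le> 96 * K * W" using Main_square(2) by (simp add: K_def mult_ac)
    have "b\<^sup>2 \<le> B\<^sup>2" using bB b0 by (intro power_mono) auto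
    have "(\<integral>g. (?S g)\<^sup>2 \<partial>P) \<le> 96 * (exp 13 * nG\<^sup>2) * b\<^sup>2 * W" using y_sum_le by (simp add: mult_ac)
    also have "\<dots> \<le> 96 * K * B\<^sup>2 * W"
      using K \<open>b\<^sup>2 \<le> B\<^sup>2\<close> W_nonneg by (intro mult_mono mult_right_mono) (auto simp: K_def)
    finally show "(\<integral>g. (?S g)\<^sup>2 \<partial>P) / B \<le> 96 * K * B * W"
      using bB by (simp add: field_simps power2_eq_square)
  qed (use bB in auto)
  finally have 1: "\<bar>\<integral>g. H g - Main g \<partial>P\<bar> \<le> 288 * (K * B * W)" by (simp add: mult_ac)
  have "\<bar>\<integral>g. Main g \<partial>P\<bar> \<le> 768 * (exp 9 * L\<^sup>2 * nG\<^sup>2) * b * W" using Main_expectation by simp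
  also have "\<dots> \<le> 768 * K * B * W"
    using K bB b0 W_nonneg by (intro mult_right_mono mult_mono) (auto simp: K_def)
  finally have 2: "\<bar>\<integral>g. Main g \<partial>P\<bar> \<le> 768 * (K * B * W)" by simp
  have "(\<integral>g. H g \<partial>P) = (\<integral>g. H g - Main g \<partial>P) + (\<integral>g. Main g \<partial>P)"
    by (simp add: iH Main_integrable)
  then have "\<bar>\<integral>g. H g \<partial>P\<bar> \<le> 1056 * (K * B * W)" using 1 2 by linarith
  then show ?thesis by (simp add: K_def mult_ac)
qed

end

section \<open>The removed spin as a function of its corrected field\<close>

context cavity
begin

definition "mean1 h g = (\<Sum>\<gamma>\<in>\<Gamma>. h \<gamma> * avg (\<lambda>s. Wt s \<gamma> g)) / Zg g"
definition "field g = (\<Sum>\<gamma>\<in>\<Gamma>. avg (\<lambda>s. lin J g (v s) * Wt s \<gamma> g)) / Zg g"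
text \<open>In \<open>field\<close> the other spins are averaged under the full measure, so they
  have reacted to the removed spin; the subtracted term is the Onsager correction for this
  reaction.\<close>

definition "\<xi> g = field g - b * r * mean1 real_of_int g"

lemma Wt_eq: "Wt s \<gamma> g = w \<gamma> * exp (t \<gamma> * lin J g vb) * exp (t \<gamma> * lin J g (vd s))"
  by (simp add: Wt_def vd_eq lin_diff_right mult.assoc exp_add[symmetric] algebra_simps)

text \<open>The mean field \<open>lin J g vb\<close> is the link: replacing the removed spin's mean
  by its Gaussian version there costs the \<open>y\<close> terms, and moving from there to
  \<open>\<xi> g\<close> costs the \<open>z\<close> terms times the Lipschitz constant.\<close>

lemma tap_pointwise:
  assumes M: "0 \<le> M" "\<And>\<gamma>. \<gamma> \<in> \<Gamma> \<Longrightarrow> \<bar>h \<gamma>\<bar> \<le> M"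
  shows "\<bar>mean1 h g - eavg \<Gamma> wt t h (\<xi> g)\<bar> \<le> 2 * M * (\<Sum>\<gamma>\<in>\<Gamma>. \<bar>y \<gamma> g\<bar>) + 2 * M * (b * L) * (\<Sum>\<gamma>\<in>\<Gamma>. \<bar>z \<gamma> g\<bar>)"
proof -
  define e where "e \<gamma> = w \<gamma> * exp (t \<gamma> * lin J g vb)" for \<gamma>
  define k where "k \<gamma> = exp ((t \<gamma>)\<^sup>2 * r / 2)" for \<gamma>
  have e0: "0 < e \<gamma>" if "\<gamma> \<in> \<Gamma>" for \<gamma> using w_pos[OF that] by (simp add: e_def)
  have bound: "\<bar>(\<Sum>\<gamma>\<in>\<Gamma>. e \<gamma> * a \<gamma>) / Zg g\<bar> \<le> (\<Sum>\<gamma>\<in>\<Gamma>. \<bar>a \<gamma>\<bar>)" for a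
  proof -
    have "\<bar>\<Sum>\<gamma>\<in>\<Gamma>. e \<gamma> * a \<gamma>\<bar> \<le> (\<Sum>\<gamma>\<in>\<Gamma>. \<bar>e \<gamma> * a \<gamma>\<bar>)" by (rule sum_abs)
    also have "\<dots> \<le> (\<Sum>\<gamma>\<in>\<Gamma>. e \<gamma> * (\<Sum>\<gamma>\<in>\<Gamma>. \<bar>a \<gamma>\<bar>))"
    proof (intro sum_mono)
      fix \<gamma> assume \<gamma>: "\<gamma> \<in> \<Gamma>"
      have "\<bar>a \<gamma>\<bar> \<le> (\<Sum>\<gamma>\<in>\<Gamma>. \<bar>a \<gamma>\<bar>)" using fin_Gamma \<gamma> by (intro member_le_sum) auto
      then show "\<bar>e \<gamma> * a \<gamma>\<bar> \<le> e \<gamma> * (\<Sum>\<gamma>\<in>\<Gamma>. \<bar>a \<gamma>\<bar>)"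
        using e0[OF \<gamma>] by (simp add: abs_mult)
    qed
    also have "\<dots> = (\<Sum>\<gamma>\<in>\<Gamma>. e \<gamma>) * (\<Sum>\<gamma>\<in>\<Gamma>. \<bar>a \<gamma>\<bar>)" by (simp add: sum_distrib_right)
    also have "\<dots> \<le> Zg g * (\<Sum>\<gamma>\<in>\<Gamma>. \<bar>a \<gamma>\<bar>)"
      using Zg_ge[of g] by (intro mult_right_mono sum_nonneg) (auto simp: e_def)
    finally show ?thesis using Zg_pos[of g] by (simp add: field_simps)
  qed
  have Wa: "avg (\<lambda>s. Wt s \<gamma> g) = e \<gamma> * (y \<gamma> g + k \<gamma>)" for \<gamma>
    unfolding Wt_eq e_def y_def k_def by (simp add: avg_cmult)
  have Z: "Zg g = (\<Sum>\<gamma>\<in>\<Gamma>. e \<gamma> * (y \<gamma> g + k \<gamma>))"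
    unfolding Zg_def avg_sum Wa ..
  define m where "m = eavg \<Gamma> wt t h (lin J g vb)"
  have wte: "wt \<gamma> * exp (t \<gamma> * lin J g vb) = e \<gamma> * k \<gamma>" for \<gamma>
    by (simp add: wt_def e_def k_def)
  have mM: "\<bar>m\<bar> \<le> M" unfolding m_def by (intro ef1.eavg_bound M)
  \<comment> \<open>Centring \<open>h\<close> at its Gaussian mean \<open>m\<close> eliminates the
    main part \<open>k\<close> of each weight, so that only \<open>y\<close> remains in the
    numerator.\<close>
  have mk: "(\<Sum>\<gamma>\<in>\<Gamma>. (h \<gamma> - m) * (e \<gamma> * k \<gamma>)) = 0"
  proof -
    have "0 < (\<Sum>\<gamma>\<in>\<Gamma>. e \<gamma> * k \<gamma>)" using Zt_pos[of g] by (simp add: Zt_def wte)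
    then have "m * (\<Sum>\<gamma>\<in>\<Gamma>. e \<gamma> * k \<gamma>) = (\<Sum>\<gamma>\<in>\<Gamma>. h \<gamma> * (e \<gamma> * k \<gamma>))"
      by (simp add: m_def eavg_def wte)
    then show ?thesis by (simp add: left_diff_distrib sum_subtractf sum_distrib_left)
  qed
  have "mean1 h g - m = (\<Sum>\<gamma>\<in>\<Gamma>. (h \<gamma> - m) * (e \<gamma> * (y \<gamma> g + k \<gamma>))) / Zg g"
  proof -
    have "mean1 h g - m = ((\<Sum>\<gamma>\<in>\<Gamma>. h \<gamma> * (e \<gamma> * (y \<gamma> g + k \<gamma>))) - m * Zg g) / Zg g"
      using Zg_pos[of g] by (simp add: mean1_def Wa diff_divide_distrib)
    then show ?thesis unfolding Z by (simp add: left_diff_distrib sum_subtractf sum_distrib_left)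
  qed
  also have "(\<Sum>\<gamma>\<in>\<Gamma>. (h \<gamma> - m) * (e \<gamma> * (y \<gamma> g + k \<gamma>))) = (\<Sum>\<gamma>\<in>\<Gamma>. e \<gamma> * ((h \<gamma> - m) * y \<gamma> g))"
  proof -
    have "(\<Sum>\<gamma>\<in>\<Gamma>. (h \<gamma> - m) * (e \<gamma> * (y \<gamma> g + k \<gamma>))) = (\<Sum>\<gamma>\<in>\<Gamma>. e \<gamma> * ((h \<gamma> - m) * y \<gamma> g)) + (\<Sum>\<gamma>\<in>\<Gamma>. (h \<gamma> - m) * (e \<gamma> * k \<gamma>))"
      by (simp add: sum.distrib[symmetric] algebra_simps)
    then show ?thesis using mk by simp
  qed
  finally have "\<bar>mean1 h g - m\<bar> \<le> (\<Sum>\<gamma>\<in>\<Gamma>. \<bar>(h \<gamma> - m) * y \<gamma> g\<bar>)"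
    using bound[of "\<lambda>\<gamma>. (h \<gamma> - m) * y \<gamma> g"] by simp
  also have "\<dots> \<le> (\<Sum>\<gamma>\<in>\<Gamma>. 2 * M * \<bar>y \<gamma> g\<bar>)"
  proof (intro sum_mono)
    fix \<gamma> assume "\<gamma> \<in> \<Gamma>"
    then have "\<bar>h \<gamma> - m\<bar> \<le> 2 * M" using M(2)[of \<gamma>] mM by linarith
    then show "\<bar>(h \<gamma> - m) * y \<gamma> g\<bar> \<le> 2 * M * \<bar>y \<gamma> g\<bar>" unfolding abs_mult by (rule mult_right_mono) simp
  qed
  finally have 1: "\<bar>mean1 h g - m\<bar> \<le> 2 * M * (\<Sum>\<gamma>\<in>\<Gamma>. \<bar>y \<gamma> g\<bar>)" by (simp add: sum_distrib_left)
  \<comment> \<open>The subtraction of \<open>t \<gamma> * r\<close> in \<open>z\<close> becomes the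
    Onsager term after averaging over \<gamma>, which makes this an exact identity.\<close>
  have "\<xi> g - lin J g vb = (\<Sum>\<gamma>\<in>\<Gamma>. e \<gamma> * z \<gamma> g) / Zg g"
  proof -
    have ez: "e \<gamma> * z \<gamma> g = avg (\<lambda>s. lin J g (v s) * Wt s \<gamma> g) - b * r * (real_of_int \<gamma> * avg (\<lambda>s. Wt s \<gamma> g)) - lin J g vb * avg (\<lambda>s. Wt s \<gamma> g)" for \<gamma>
    proof -
      have "e \<gamma> * z \<gamma> g = avg (\<lambda>s. lin J g (v s) * Wt s \<gamma> g - b * r * real_of_int \<gamma> * Wt s \<gamma> g - lin J g vb * Wt s \<gamma> g)"
        unfolding z_def avg_cmult[symmetric] Wt_eq e_def vd_eq lin_diff_right
        by (intro avg_cong) (simp add: algebra_simps)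
      then show ?thesis by (simp add: avg_diff avg_cmult mult.assoc)
    qed
    have "(\<Sum>\<gamma>\<in>\<Gamma>. avg (\<lambda>s. Wt s \<gamma> g)) = Zg g" by (simp add: Zg_def avg_sum)
    then have "(\<Sum>\<gamma>\<in>\<Gamma>. e \<gamma> * z \<gamma> g) = (\<Sum>\<gamma>\<in>\<Gamma>. avg (\<lambda>s. lin J g (v s) * Wt s \<gamma> g))
       - b * r * (\<Sum>\<gamma>\<in>\<Gamma>. real_of_int \<gamma> * avg (\<lambda>s. Wt s \<gamma> g)) - lin J g vb * Zg g"
      unfolding ez by (simp only: sum_subtractf sum_distrib_left[symmetric])
    then show ?thesis using Zg_pos[of g]
      by (simp add: \<xi>_def field_def mean1_def diff_divide_distrib)
  qed
  then have "\<bar>\<xi> g - lin J g vb\<bar> \<le> (\<Sum>\<gamma>\<in>\<Gamma>. \<bar>z \<gamma> g\<bar>)" using bound[of "\<lambda>\<gamma>. z \<gamma> g"] by simp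
  then have *: "2 * M * (b * L) * \<bar>\<xi> g - lin J g vb\<bar> \<le> 2 * M * (b * L) * (\<Sum>\<gamma>\<in>\<Gamma>. \<bar>z \<gamma> g\<bar>)"
    using M b0 L1 by (intro mult_left_mono) auto
  have 2: "\<bar>eavg \<Gamma> wt t h (\<xi> g) - m\<bar> \<le> 2 * M * (b * L) * (\<Sum>\<gamma>\<in>\<Gamma>. \<bar>z \<gamma> g\<bar>)"
  proof -
    have "\<bar>eavg \<Gamma> wt t h (\<xi> g) - eavg \<Gamma> wt t h (lin J g vb)\<bar> \<le> 2 * M * (b * L) * \<bar>\<xi> g - lin J g vb\<bar>"
      by (rule ef1.eavg_lipschitz) (use M in auto)
    with * show ?thesis unfolding m_def by linarith
  qed
  show ?thesis using 1 2 by linarith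
qed

lemma mean1_measurable [measurable]: "mean1 h \<in> borel_measurable P"
  unfolding mean1_def by measurable

lemma \<xi>_measurable [measurable]: "\<xi> \<in> borel_measurable P"
  unfolding \<xi>_def field_def by measurable

text \<open>Second moments of the pointwise bound: 3072 is 8 times 96 + 288, the constants of
  \<open>y\<close> and \<open>z\<close>, and the factors \<open>b\<^sup>2\<close> and
  \<open>(b * L)\<^sup>2\<close> are bounded by 1.\<close>

theorem tap:
  assumes M: "0 \<le> M" "\<And>\<gamma>. \<gamma> \<in> \<Gamma> \<Longrightarrow> \<bar>h \<gamma>\<bar> \<le> M"
  shows "(\<integral>g. (mean1 h g - eavg \<Gamma> wt t h (\<xi> g))\<^sup>2 \<partial>P) \<le> 3072 * exp 13 * nG\<^sup>2 * M\<^sup>2 * W"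
proof -
  have bL1: "(b * L)\<^sup>2 \<le> 1" "b\<^sup>2 \<le> 1"
  proof -
    have b1: "b \<le> 1" using Gamma_ne t_bounds(5) by blast
    then show "b\<^sup>2 \<le> 1" using b0 by (simp add: power_le_one)
    have "b * (b * L\<^sup>2) \<le> 1 * 1" using b0 b1 bL by (intro mult_mono) auto
    then show "(b * L)\<^sup>2 \<le> 1" by (simp add: power2_eq_square mult_ac)
  qed
  let ?U = "\<lambda>g. 8 * M\<^sup>2 * ((\<Sum>\<gamma>\<in>\<Gamma>. \<bar>y \<gamma> g\<bar>)\<^sup>2 + nG * (\<Sum>\<gamma>\<in>\<Gamma>. (z \<gamma> g)\<^sup>2))"
  have iz: "integrable P (\<lambda>g. nG * (\<Sum>\<gamma>\<in>\<Gamma>. (z \<gamma> g)\<^sup>2))"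
    by (intro integrable_mult_right Bochner_Integration.integrable_sum z_square_integrable)
  have iU: "integrable P ?U"
    by (intro integrable_mult_right Bochner_Integration.integrable_add y_sum_integrable iz)
  have le: "(mean1 h g - eavg \<Gamma> wt t h (\<xi> g))\<^sup>2 \<le> ?U g" for g
  proof -
    define a where "a = (\<Sum>\<gamma>\<in>\<Gamma>. \<bar>y \<gamma> g\<bar>)"
    define c where "c = (b * L) * (\<Sum>\<gamma>\<in>\<Gamma>. \<bar>z \<gamma> g\<bar>)"
    have ac: "0 \<le> a" "0 \<le> c" unfolding a_def c_def using b0 L1 by (auto intro!: sum_nonneg mult_nonneg_nonneg)
    have "\<bar>mean1 h g - eavg \<Gamma> wt t h (\<xi> g)\<bar> \<le> \<bar>2 * M * (a + c)\<bar>"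
      using tap_pointwise[where h=h and M=M and g=g, OF M] ac M(1) by (simp add: a_def c_def algebra_simps)
    then have "(mean1 h g - eavg \<Gamma> wt t h (\<xi> g))\<^sup>2 \<le> (2 * M * (a + c))\<^sup>2" by (simp only: abs_le_square_iff)
    also have "\<dots> = 4 * M\<^sup>2 * (a + c)\<^sup>2" by (simp add: power_mult_distrib)
    also have "\<dots> \<le> 4 * M\<^sup>2 * (2 * (a\<^sup>2 + c\<^sup>2))"
      using sum_squares_bound[of a c] by (intro mult_left_mono) (auto simp: power2_eq_square algebra_simps)
    also have "c\<^sup>2 = (b * L)\<^sup>2 * (\<Sum>\<gamma>\<in>\<Gamma>. \<bar>z \<gamma> g\<bar>)\<^sup>2" by (simp add: c_def power_mult_distrib)
    also have "4 * M\<^sup>2 * (2 * (a\<^sup>2 + (b * L)\<^sup>2 * (\<Sum>\<gamma>\<in>\<Gamma>. \<bar>z \<gamma> g\<bar>)\<^sup>2)) \<le> 4 * M\<^sup>2 * (2 * (a\<^sup>2 + 1 * (nG * (\<Sum>\<gamma>\<in>\<Gamma>. (z \<gamma> g)\<^sup>2))))"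
      unfolding nG_def using bL1 sum_abs_square_le[OF fin_Gamma, of "\<lambda>\<gamma>. z \<gamma> g"] fin_Gamma
      by (intro mult_left_mono add_left_mono mult_mono) auto
    finally show ?thesis by (simp add: a_def algebra_simps)
  qed
  have [measurable]: "eavg \<Gamma> wt t h \<in> borel_measurable borel" by (rule ef1.eavg_measurable)
  have i: "integrable P (\<lambda>g. (mean1 h g - eavg \<Gamma> wt t h (\<xi> g))\<^sup>2)"
    by (rule Bochner_Integration.integrable_bound[OF iU]) (auto intro!: order_trans[OF le] abs_ge_self)
  have "(\<integral>g. (mean1 h g - eavg \<Gamma> wt t h (\<xi> g))\<^sup>2 \<partial>P) \<le> (\<integral>g. ?U g \<partial>P)"
    by (rule integral_mono[OF i iU le])
  also have "\<dots> = 8 * M\<^sup>2 * ((\<integral>g. (\<Sum>\<gamma>\<in>\<Gamma>. \<bar>y \<gamma> g\<bar>)\<^sup>2 \<partial>P) + nG * (\<Sum>\<gamma>\<in>\<Gamma>. \<integral>g. (z \<gamma> g)\<^sup>2 \<partial>P))"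
    using iz by (simp add: y_sum_integrable z_square_integrable Bochner_Integration.integral_sum)
  also have "\<dots> \<le> 8 * M\<^sup>2 * (96 * exp 13 * nG\<^sup>2 * 1 * W + nG * (\<Sum>\<gamma>\<in>\<Gamma>. 288 * exp 13 * W))"
  proof (intro mult_left_mono add_mono sum_mono z_square_le)
    have "96 * exp 13 * nG\<^sup>2 * b\<^sup>2 * W \<le> 96 * exp 13 * nG\<^sup>2 * 1 * W"
      using bL1 W_nonneg by (intro mult_left_mono mult_right_mono) auto
    then show "(\<integral>g. (\<Sum>\<gamma>\<in>\<Gamma>. \<bar>y \<gamma> g\<bar>)\<^sup>2 \<partial>P) \<le> 96 * exp 13 * nG\<^sup>2 * 1 * W" using y_sum_le by linarith
  qed (use nG in auto)
  also have "\<dots> = 3072 * exp 13 * nG\<^sup>2 * M\<^sup>2 * W"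
    by (simp add: nG_def power2_eq_square)
  finally show ?thesis .
qed

end

section \<open>The Ghatak--Sherrington model seen from one site\<close>

lemma sum_symmetric_interval:
  fixes f :: "int \<Rightarrow> real"
  shows "(\<Sum>\<gamma>\<in>{- int S..int S}. f \<gamma>) = f 0 + (\<Sum>\<gamma>=1..S. f (int \<gamma>) + f (- int \<gamma>))"
proof (induction S)
  case (Suc S)
  have "{- int (Suc S)..int (Suc S)} = insert (int (Suc S)) (insert (- int (Suc S)) {- int S..int S})" by auto
  then show ?case using Suc by (simp add: algebra_simps)
qed simp

lemma exp_pair:
  fixes u x :: real
  shows "2 * cosh u * exp x = exp (u + x) + exp (- u + x)" "2 * sinh u * exp x = exp (u + x) - exp (- u + x)"
  unfolding exp_add by (simp_all add: cosh_field_def sinh_field_def field_simps)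

text \<open>Pairing the spin values \<gamma> and -\<gamma> produces the hyperbolic cosines, and the
  value 0 the summand 1; \<open>den1\<close> is the partition function of a single spin.\<close>

lemma den1_eq: "den1 S a \<delta> = (\<Sum>\<gamma>\<in>{- int S..int S}. exp (real_of_int \<gamma> * a + (real_of_int \<gamma>)\<^sup>2 * \<delta>))"
  unfolding sum_symmetric_interval den1_def exp_pair by simp

lemma num_mag_eq: "num_mag S a \<delta> = (\<Sum>\<gamma>\<in>{- int S..int S}. real_of_int \<gamma> * exp (real_of_int \<gamma> * a + (real_of_int \<gamma>)\<^sup>2 * \<delta>))"
  unfolding sum_symmetric_interval num_mag_def mult.assoc[of "real _"] exp_pair
  by (simp add: right_diff_distrib)

lemma num_sq_eq: "num_sq S a \<delta> = (\<Sum>\<gamma>\<in>{- int S..int S}. (real_of_int \<gamma>)\<^sup>2 * exp (real_of_int \<gamma> * a + (real_of_int \<gamma>)\<^sup>2 * \<delta>))"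
  unfolding sum_symmetric_interval num_sq_def mult.assoc[of "(real _)\<^sup>2"] exp_pair
  by (simp add: distrib_left)

lemma mag_bound: "\<bar>num_mag S a \<delta> / den1 S a \<delta>\<bar> \<le> real S"
  unfolding num_mag_eq den1_eq by (rule weighted_mean_bound) auto

lemma sq_bounds: "\<bar>num_sq S a \<delta> / den1 S a \<delta>\<bar> \<le> (real S)\<^sup>2" "0 \<le> num_sq S a \<delta> / den1 S a \<delta>"
proof -
  show "\<bar>num_sq S a \<delta> / den1 S a \<delta>\<bar> \<le> (real S)\<^sup>2"
    unfolding num_sq_eq den1_eq by (rule weighted_mean_bound) (auto simp: abs_le_square_iff[symmetric])
  show "0 \<le> num_sq S a \<delta> / den1 S a \<delta>"
    unfolding num_sq_eq den1_eq by (intro divide_nonneg_nonneg sum_nonneg) auto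
qed

lemma stdN_integral_le:
  assumes [measurable]: "f \<in> borel_measurable borel" and "\<And>x. 0 \<le> f x" "\<And>x. f x \<le> (B::real)"
  shows "0 \<le> (\<integral>x. f x \<partial>stdN)" "(\<integral>x. f x \<partial>stdN) \<le> B"
proof -
  show "0 \<le> (\<integral>x. f x \<partial>stdN)" using assms by simp
  have "integrable stdN f"
    by (rule stdN.integrable_const_bound[of _ B]) (use assms in auto)
  then have "(\<integral>x. f x \<partial>stdN) \<le> (\<integral>x. B \<partial>stdN)" using assms by (intro integral_mono) auto
  then show "(\<integral>x. f x \<partial>stdN) \<le> B" using stdN.prob_space by simp
qed

text \<open>The fixed point equations express \<open>p\<close> and \<open>q\<close> as Gaussian
  means of quantities between 0 and the square of \<open>S\<close>.\<close>

lemma is_pq_bounds: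
  assumes "is_pq S \<beta> D h p q"
  shows "0 \<le> p" "p \<le> (real S)\<^sup>2" "0 \<le> q" "q \<le> (real S)\<^sup>2"
proof -
  let ?a = "\<lambda>x. sqrt q * \<beta> * x + h" and ?d = "D + \<beta>\<^sup>2 / 2 * (p - q)"
  have p: "p = (\<integral>x. num_sq S (?a x) ?d / den1 S (?a x) ?d \<partial>stdN)"
    and q: "q = (\<integral>x. (num_mag S (?a x) ?d / den1 S (?a x) ?d)\<^sup>2 \<partial>stdN)"
    using assms unfolding is_pq_def by blast+
  have mp: "(\<lambda>x. num_sq S (?a x) ?d / den1 S (?a x) ?d) \<in> borel_measurable borel"
    unfolding num_sq_eq den1_eq by measurable
  have mq: "(\<lambda>x. (num_mag S (?a x) ?d / den1 S (?a x) ?d)\<^sup>2) \<in> borel_measurable borel"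
    unfolding num_mag_eq den1_eq by measurable
  have "(num_mag S (?a x) ?d / den1 S (?a x) ?d)\<^sup>2 \<le> (real S)\<^sup>2" for x
    using mag_bound[of S "?a x" ?d] by (intro abs_le_square_iff[THEN iffD1]) simp
  then have "(num_mag S (?a x) ?d / den1 S (?a x) ?d)\<^sup>2 \<le> (real S)\<^sup>2" for x .
  note Q = stdN_integral_le[OF mq _ this]
  note U = stdN_integral_le[OF mp sq_bounds(2) order_trans[OF abs_ge_self sq_bounds(1)]]
  show "0 \<le> q" by (subst q, rule Q) simp
  show "q \<le> (real S)\<^sup>2" by (subst q, rule Q) simp
  show "0 \<le> p" by (subst p, rule U)
  show "p \<le> (real S)\<^sup>2" by (subst p, rule U)
qed

locale ghatak_sherrington =
  fixes S N :: nat and \<beta> D h p q :: real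
  assumes S1: "1 \<le> S" and N1: "1 \<le> N" and beta0: "0 \<le> \<beta>" and betaS: "\<beta> * (real S)\<^sup>2 \<le> 1"
    and pq: "is_pq S \<beta> D h p q"
begin

definition "\<Gamma> = {- int S..int S}"
definition "V = {1..N}"
definition "Jk k = {e \<in> pairs N. fst e = k \<or> snd e = k}"
definition "Pk k = pairs N - Jk k"
definition oth :: "nat \<Rightarrow> nat \<times> nat \<Rightarrow> nat" where "oth k e = (if fst e = k then snd e else fst e)"
definition "Om k = PiE (V - {k}) (\<lambda>_. \<Gamma>)"
text \<open>Indexed by the couplings of site \<open>k\<close>, through their other endpoint, so that
  it pairs directly with the Gaussian vector of those couplings.\<close>

definition vv :: "nat \<Rightarrow> (nat \<Rightarrow> int) \<Rightarrow> nat \<times> nat \<Rightarrow> real" where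
  "vv k s e = real_of_int (s (oth k e)) / sqrt (real N)"
text \<open>The energy of the remaining spins keeps the factor
  \<open>\<beta> / sqrt (real N)\<close> of the full system. The splitting \<open>Ham_split\<close>
  is therefore exact, with no change of temperature.\<close>

definition Hm :: "nat \<Rightarrow> (nat \<times> nat \<Rightarrow> real) \<Rightarrow> (nat \<Rightarrow> int) \<Rightarrow> real" where
  "Hm k x s = \<beta> / sqrt (real N) * (\<Sum>(i, j)\<in>Pk k. x (i, j) * of_int (s i) * of_int (s j))
     + D * (\<Sum>i\<in>V - {k}. (of_int (s i))\<^sup>2) + h * (\<Sum>i\<in>V - {k}. of_int (s i))"
definition "mu k x s = exp (Hm k x s) / (\<Sum>s\<in>Om k. exp (Hm k x s))"
definition ww :: "int \<Rightarrow> real" where "ww \<gamma> = exp (D * (of_int \<gamma>)\<^sup>2 + h * of_int \<gamma>)"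
abbreviation "Ham \<equiv> hamiltonian N \<beta> D h"
abbreviation "C \<equiv> configs S N"
abbreviation "Zp \<equiv> partition_fn S N \<beta> D h"
definition gibbs2 :: "((nat \<Rightarrow> int) \<Rightarrow> (nat \<Rightarrow> int) \<Rightarrow> real) \<Rightarrow> (nat \<times> nat \<Rightarrow> real) \<Rightarrow> real" where
  "gibbs2 F g = (\<Sum>\<sigma>\<in>C. \<Sum>\<tau>\<in>C. F \<sigma> \<tau> * (exp (Ham g \<sigma>) * exp (Ham g \<tau>))) / (Zp g)\<^sup>2"
definition R :: "(nat \<Rightarrow> int) \<Rightarrow> (nat \<Rightarrow> int) \<Rightarrow> real" where
  "R \<sigma> \<tau> = (\<Sum>i\<in>V. of_int (\<sigma> i) * of_int (\<tau> i)) / real N"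
definition "mg k x y = merge (Pk k) (Jk k) (x, y)"

lemma finite_pairs: "finite (pairs N)"
  by (rule finite_subset[of _ "{..N} \<times> {..N}"]) (auto simp: pairs_def)

lemma finite_sets: "finite (Jk k)" "finite (Pk k)" "finite V" "finite \<Gamma>" "finite (Om k)" "finite C"
proof -
  show "finite (Om k)" unfolding Om_def by (rule finite_PiE) (auto simp: V_def \<Gamma>_def)
  show "finite C" unfolding configs_def by (rule finite_PiE) auto
qed (auto simp: Jk_def Pk_def V_def \<Gamma>_def finite_pairs)

lemma Gamma_ne: "\<Gamma> \<noteq> {}" by (auto simp: \<Gamma>_def)

lemma Om_ne: "Om k \<noteq> {}" using Gamma_ne by (auto simp: Om_def PiE_eq_empty_iff)

lemma Gamma_abs: "\<gamma> \<in> \<Gamma> \<Longrightarrow> \<bar>real_of_int \<gamma>\<bar> \<le> real S"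
  by (auto simp: \<Gamma>_def abs_le_iff)

lemma Om_mem: "s \<in> Om k \<Longrightarrow> i \<in> V - {k} \<Longrightarrow> s i \<in> \<Gamma>"
  by (auto simp: Om_def PiE_iff)

lemma sum_configs:
  assumes "k \<in> V"
  shows "(\<Sum>\<sigma>\<in>C. F \<sigma>) = (\<Sum>s\<in>Om k. \<Sum>\<gamma>\<in>\<Gamma>. F (s(k := \<gamma>)))"
proof -
  have "C = PiE (insert k (V - {k})) (\<lambda>_. \<Gamma>)"
    using assms by (simp add: configs_def V_def \<Gamma>_def insert_absorb)
  also have "\<dots> = (\<lambda>(y, g). g(k := y)) ` (\<Gamma> \<times> Om k)"
    unfolding PiE_insert_eq Om_def ..
  finally have C: "C = (\<lambda>(y, g). g(k := y)) ` (\<Gamma> \<times> Om k)" .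
  have inj: "inj_on (\<lambda>(y, g). g(k := y)) (\<Gamma> \<times> Om k)"
    unfolding Om_def by (rule inj_combinator) auto
  have "(\<Sum>\<sigma>\<in>C. F \<sigma>) = (\<Sum>(\<gamma>, s)\<in>\<Gamma> \<times> Om k. F (s(k := \<gamma>)))"
    unfolding C by (subst sum.reindex[OF inj]) (simp add: case_prod_beta)
  also have "\<dots> = (\<Sum>\<gamma>\<in>\<Gamma>. \<Sum>s\<in>Om k. F (s(k := \<gamma>)))" by (simp add: sum.cartesian_product)
  finally show ?thesis by (subst sum.swap)
qed

lemma oth_bij: "k \<in> V \<Longrightarrow> bij_betw (oth k) (Jk k) (V - {k})"
  unfolding bij_betw_def
proof
  assume k: "k \<in> V"
  show "inj_on (oth k) (Jk k)"
    by (auto simp: inj_on_def oth_def Jk_def pairs_def split: if_splits)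
  show "oth k ` Jk k = V - {k}"
  proof
    show "oth k ` Jk k \<subseteq> V - {k}" by (auto simp: oth_def Jk_def pairs_def V_def)
    show "V - {k} \<subseteq> oth k ` Jk k"
    proof
      fix i assume i: "i \<in> V - {k}"
      show "i \<in> oth k ` Jk k"
      proof (cases "i < k")
        case True
        then show ?thesis using i k by (intro image_eqI[of _ _ "(i, k)"]) (auto simp: oth_def Jk_def pairs_def V_def)
      next
        case False
        then show ?thesis using i k by (intro image_eqI[of _ _ "(k, i)"]) (auto simp: oth_def Jk_def pairs_def V_def)
      qed
    qed
  qed
qed

lemma lin_vv: "k \<in> V \<Longrightarrow> lin (Jk k) (vv k s) (vv k s') = (\<Sum>i\<in>V - {k}. of_int (s i) * of_int (s' i)) / real N"
proof -
  assume k: "k \<in> V"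
  have "lin (Jk k) (vv k s) (vv k s') = (\<Sum>e\<in>Jk k. of_int (s (oth k e)) * of_int (s' (oth k e)) / real N)"
    unfolding lin_def vv_def by (intro sum.cong) auto
  also have "\<dots> = (\<Sum>i\<in>V - {k}. of_int (s i) * of_int (s' i) / real N)"
    by (rule sum.reindex_bij_betw[OF oth_bij[OF k]])
  finally show ?thesis by (simp add: sum_divide_distrib)
qed

text \<open>The overlap of the full system exceeds that of the remaining spins by the contribution
  of site \<open>k\<close> alone; this is the origin of the errors of order 1/N.\<close>

lemma R_update: "k \<in> V \<Longrightarrow> R (s(k := \<gamma>)) (s'(k := \<gamma>')) = lin (Jk k) (vv k s) (vv k s') + of_int \<gamma> * of_int \<gamma>' / real N"
  unfolding R_def lin_vv
  by (subst sum.remove[of _ k]) (auto simp: finite_sets add_divide_distrib intro!: sum.cong)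

lemma Ham_split:
  assumes k: "k \<in> V"
  shows "Ham (mg k x y) (s(k := \<gamma>)) = Hm k x s + \<beta> * of_int \<gamma> * lin (Jk k) y (vv k s) + (D * (of_int \<gamma>)\<^sup>2 + h * of_int \<gamma>)"
proof -
  let ?\<sigma> = "s(k := \<gamma>)"
  let ?f = "\<lambda>e. mg k x y e * of_int (?\<sigma> (fst e)) * of_int (?\<sigma> (snd e))"
  have un: "pairs N = Pk k \<union> Jk k" "Pk k \<inter> Jk k = {}" by (auto simp: Pk_def Jk_def)
  have "(\<Sum>e\<in>pairs N. ?f e) = (\<Sum>e\<in>Pk k. ?f e) + (\<Sum>e\<in>Jk k. ?f e)"
    unfolding un(1) by (rule sum.union_disjoint) (use finite_sets un in auto)
  also have "(\<Sum>e\<in>Pk k. ?f e) = (\<Sum>e\<in>Pk k. x e * of_int (s (fst e)) * of_int (s (snd e)))"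
    by (intro sum.cong refl) (auto simp: mg_def merge_def Pk_def Jk_def)
  also have "(\<Sum>e\<in>Jk k. ?f e) = (\<Sum>e\<in>Jk k. of_int \<gamma> * sqrt (real N) * (y e * vv k s e))"
  proof (intro sum.cong refl)
    fix e assume e: "e \<in> Jk k"
    then have m: "mg k x y e = y e" by (simp add: mg_def merge_def Pk_def)
    have "fst e < snd e" "fst e = k \<or> snd e = k" using e by (auto simp: Jk_def pairs_def)
    then have "real_of_int (?\<sigma> (fst e)) * of_int (?\<sigma> (snd e)) = of_int \<gamma> * of_int (s (oth k e))"
      by (auto simp: oth_def)
    then show "?f e = of_int \<gamma> * sqrt (real N) * (y e * vv k s e)"
      using N1 by (simp add: m vv_def mult.assoc)
  qed
  also have "\<dots> = of_int \<gamma> * sqrt (real N) * lin (Jk k) y (vv k s)"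
    by (simp add: lin_def sum_distrib_left)
  finally have P: "(\<Sum>e\<in>pairs N. ?f e) = (\<Sum>e\<in>Pk k. x e * of_int (s (fst e)) * of_int (s (snd e)))
     + of_int \<gamma> * sqrt (real N) * lin (Jk k) y (vv k s)" .
  have Q: "(\<Sum>i=1..N. (real_of_int (?\<sigma> i))\<^sup>2) = (of_int \<gamma>)\<^sup>2 + (\<Sum>i\<in>V - {k}. (of_int (s i))\<^sup>2)"
    using k unfolding V_def by (subst sum.remove[of _ k]) auto
  have L: "(\<Sum>i=1..N. real_of_int (?\<sigma> i)) = of_int \<gamma> + (\<Sum>i\<in>V - {k}. of_int (s i))"
    using k unfolding V_def by (subst sum.remove[of _ k]) auto
  have bN: "\<beta> / sqrt (real N) * (of_int \<gamma> * sqrt (real N) * z) = \<beta> * of_int \<gamma> * z" for z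
    using N1 by simp
  show ?thesis
    unfolding hamiltonian_def Hm_def case_prod_beta prod.collapse P Q L distrib_left bN
    by simp
qed

lemma mu_sum: "(\<Sum>s\<in>Om k. mu k x s) = 1"
proof -
  have "0 < (\<Sum>s\<in>Om k. exp (Hm k x s))" using finite_sets Om_ne by (intro sum_pos) auto
  then show ?thesis by (simp add: mu_def sum_divide_distrib[symmetric])
qed

lemma cavityI: "k \<in> V \<Longrightarrow> cavity (Om k) (mu k x) (Jk k) (vv k) \<Gamma> ww (real S) \<beta> p q"
proof
  assume k: "k \<in> V"
  show "finite (Om k)" "finite (Jk k)" "finite \<Gamma>" "\<Gamma> \<noteq> {}" using finite_sets Gamma_ne by auto
  show "0 \<le> mu k x s" for s unfolding mu_def by (intro divide_nonneg_nonneg sum_nonneg) auto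
  show "(\<Sum>s\<in>Om k. mu k x s) = 1" by (rule mu_sum)
  show "\<bar>lin (Jk k) (vv k s) (vv k s')\<bar> \<le> (real S)\<^sup>2" if "s \<in> Om k" "s' \<in> Om k" for s s'
  proof -
    have "\<bar>\<Sum>i\<in>V - {k}. real_of_int (s i) * of_int (s' i)\<bar> \<le> (\<Sum>i\<in>V - {k}. \<bar>real_of_int (s i) * of_int (s' i)\<bar>)" by (rule sum_abs)
    also have "\<dots> \<le> (\<Sum>i\<in>V - {k}. real S * real S)"
      unfolding abs_mult
      by (intro sum_mono mult_mono Gamma_abs Om_mem[OF that(1)] Om_mem[OF that(2)]) auto
    also have "\<dots> = real (card (V - {k})) * (real S)\<^sup>2" by (simp add: power2_eq_square)
    also have "\<dots> \<le> real N * (real S)\<^sup>2"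
      using card_mono[of V "V - {k}"] by (intro mult_right_mono) (auto simp: V_def)
    finally show ?thesis unfolding lin_vv[OF k] using N1 by (simp add: field_simps)
  qed
  show "\<bar>real_of_int \<gamma>\<bar> \<le> real S" if "\<gamma> \<in> \<Gamma>" for \<gamma> by (rule Gamma_abs[OF that])
  show "0 < ww \<gamma>" for \<gamma> by (simp add: ww_def)
  show "1 \<le> real S" using S1 by simp
  show "0 \<le> \<beta>" "\<beta> * (real S)\<^sup>2 \<le> 1" by (rule beta0, rule betaS)
  show "0 \<le> p" "p \<le> (real S)\<^sup>2" "0 \<le> q" "q \<le> (real S)\<^sup>2" using is_pq_bounds[OF pq] by auto
qed

end

context cavity
begin

lemma full2_diff: "full2 (\<lambda>s s' e. F s s' e - G s s' e) g = full2 F g - full2 G g"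
  unfolding full2_def by (simp add: left_diff_distrib sum_subtractf avg_diff diff_divide_distrib)

lemma full2_one: "full2 (\<lambda>_ _ _. 1) g = 1"
  using Zg_pos[of g] by (simp add: full2_def Zg_square[symmetric])

lemma full2_affine: "full2 (\<lambda>s s' e. a * F s s' e + c) g = a * full2 F g + c"
proof -
  have "full2 (\<lambda>s s' e. a * F s s' e + c) g = a * full2 F g + c * full2 (\<lambda>_ _ _. 1) g"
    unfolding full2_def
    by (simp add: distrib_right sum.distrib sum_distrib_left[symmetric] mult.assoc avg_add avg_cmult add_divide_distrib)
  then show ?thesis by (simp add: full2_one)
qed

lemma full2_mono:
  assumes "\<And>s s' e. s \<in> \<Omega> \<Longrightarrow> s' \<in> \<Omega> \<Longrightarrow> e \<in> \<Gamma>\<times>\<Gamma> \<Longrightarrow> F s s' e \<le> G s s' e"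
  shows "full2 F g \<le> full2 G g"
  unfolding full2_def
proof (intro divide_right_mono avg_mono sum_mono mult_right_mono assms mult_nonneg_nonneg)
  show "e \<in> \<Gamma>\<times>\<Gamma> \<Longrightarrow> 0 \<le> Wt s (fst e) g" "e \<in> \<Gamma>\<times>\<Gamma> \<Longrightarrow> 0 \<le> Wt s (snd e) g" for e s
    using Wt_pos by (auto simp: less_imp_le mem_Times_iff)
qed auto

text \<open>The majorant \<open>G\<close> may also depend on the removed spins, as it must when
  overlaps of the remaining spins are bounded by those of the full system.\<close>

lemma W_le_full:
  assumes G: "\<And>s s' e. s \<in> \<Omega> \<Longrightarrow> s' \<in> \<Omega> \<Longrightarrow> e \<in> \<Gamma>\<times>\<Gamma> \<Longrightarrow> (d s s')\<^sup>2 + (\<epsilon> s)\<^sup>2 \<le> G s s' e"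
  shows "W \<le> 6 * exp 8 * (\<integral>g. full2 G g \<partial>P)"
proof -
  have "W = avg2 (\<lambda>s s'. (d s s')\<^sup>2 + (\<epsilon> s)\<^sup>2)" by (simp add: W_def avg_add)
  also have "\<dots> \<le> 6 * exp 8 * (\<integral>g. full2 (\<lambda>s s' e. (d s s')\<^sup>2 + (\<epsilon> s)\<^sup>2) g \<partial>P)"
    by (rule cavity_le_full) simp
  also have "\<dots> \<le> 6 * exp 8 * (\<integral>g. full2 G g \<partial>P)"
    by (intro mult_left_mono integral_mono full2_integrable full2_mono G) auto
  finally show ?thesis .
qed

text \<open>Given the mean field, the two replicas of the removed spin are independent.\<close>

lemma eavg_product:
  "eavg (\<Gamma>\<times>\<Gamma>) w2 cc (\<lambda>e. a (fst e) * a' (snd e)) x = eavg \<Gamma> wt t a x * eavg \<Gamma> wt t a' x"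
proof -
  have "ef.Z x = (\<Sum>\<gamma>\<in>\<Gamma>. wt \<gamma> * exp (t \<gamma> * x)) * (\<Sum>\<gamma>\<in>\<Gamma>. wt \<gamma> * exp (t \<gamma> * x))"
    unfolding sum_product sum.cartesian_product
    by (intro sum.cong) (auto simp: w2_def cc_def exp_add[symmetric] algebra_simps)
  moreover have "(\<Sum>e\<in>\<Gamma>\<times>\<Gamma>. a (fst e) * a' (snd e) * (w2 e * exp (cc e * x)))
    = (\<Sum>\<gamma>\<in>\<Gamma>. a \<gamma> * (wt \<gamma> * exp (t \<gamma> * x))) * (\<Sum>\<gamma>\<in>\<Gamma>. a' \<gamma> * (wt \<gamma> * exp (t \<gamma> * x)))"
    unfolding sum_product sum.cartesian_product
    by (intro sum.cong) (auto simp: w2_def cc_def exp_add[symmetric] algebra_simps)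
  ultimately show ?thesis by (simp add: eavg_def)
qed

lemma eavg_one: "eavg \<Gamma> wt t (\<lambda>_. 1) x = 1"
  using ef1.Z_pos[of x] by (simp add: eavg_def)

text \<open>The error \<open>\<delta>\<close> leaves room for test functions built from overlaps of
  the full system, which differ slightly from a product of a function of the remaining spins and one
  of the removed spins.\<close>

lemma full2_test:
  assumes Phi: "\<And>e. e \<in> \<Gamma>\<times>\<Gamma> \<Longrightarrow> \<bar>\<Phi> e\<bar> \<le> L\<^sup>2"
    and c: "c = (\<integral>x. eavg (\<Gamma>\<times>\<Gamma>) w2 cc \<Phi> (sqrt q * x) \<partial>stdN)"
    and f: "\<And>s s'. s \<in> \<Omega> \<Longrightarrow> s' \<in> \<Omega> \<Longrightarrow> \<bar>f s s'\<bar> \<le> \<eta> s s'"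
    and B: "b \<le> B" "0 < B"
    and F: "\<And>s s' e. s \<in> \<Omega> \<Longrightarrow> s' \<in> \<Omega> \<Longrightarrow> e \<in> \<Gamma>\<times>\<Gamma> \<Longrightarrow> \<bar>F s s' e - f s s' * (\<Phi> e - c)\<bar> \<le> \<delta>"
  shows "(\<integral>g. full2 F g \<partial>P) \<le> 1056 * exp 38 * L^4 * nG^4 * B * W + \<delta>"
proof -
  interpret T: cavity_test \<Omega> \<mu> J v \<Gamma> w L b p q \<Phi> f c B
    by unfold_locales (use assms in auto)
  let ?H = "full2 (\<lambda>s s' e. f s s' * (\<Phi> e - c))"
  have "(\<integral>g. full2 F g \<partial>P) \<le> (\<integral>g. ?H g + \<delta> \<partial>P)"
  proof (intro integral_mono full2_integrable Bochner_Integration.integrable_add P.integrable_const)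
    fix g
    have "full2 F g - ?H g \<le> \<delta>"
      unfolding full2_diff[symmetric] by (rule order_trans[OF abs_ge_self full2_bound[OF F]])
    then show "full2 F g \<le> ?H g + \<delta>" by simp
  qed
  also have "\<dots> = (\<integral>g. ?H g \<partial>P) + \<delta>"
    using P.prob_space by (simp add: full2_integrable)
  finally show ?thesis using T.H_expectation unfolding T.H_def by linarith
qed

end

context ghatak_sherrington
begin

definition "Zm k x = (\<Sum>s\<in>Om k. exp (Hm k x s))"
definition "fluct = gibbs2 (\<lambda>\<sigma> \<tau>. (R \<sigma> \<tau> - q)\<^sup>2 + (R \<sigma> \<sigma> - p)\<^sup>2)"
definition "nS = real (card \<Gamma>)"
text \<open>The product of \<open>1056 * exp 38\<close> from \<open>H_expectation\<close> and
  \<open>6 * exp 8\<close> from \<open>cavity_le_full\<close>, with the powers of \<open>S\<close>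
  and of the number of spin values.\<close>

definition "K1 = 6336 * exp 46 * real S ^ 4 * nS ^ 4"
abbreviation "PJ k \<equiv> PiM (Jk k) (\<lambda>_. stdN)"
abbreviation "\<Delta> \<equiv> D + \<beta>\<^sup>2 / 2 * (p - q)"

lemma Zm_pos: "0 < Zm k x"
  unfolding Zm_def using finite_sets Om_ne by (intro sum_pos) auto

end

section \<open>One site of the model, with the couplings away from it frozen\<close>

locale cavity_site = ghatak_sherrington +
  fixes k :: nat and x :: "nat \<times> nat \<Rightarrow> real"
  assumes k: "k \<in> V"
begin

sublocale c: cavity "Om k" "mu k x" "Jk k" "vv k" \<Gamma> ww "real S" \<beta> p q
  by (rule cavityI[OF k])

lemma exp_Ham: "exp (Ham (mg k x y) (s(k := \<gamma>))) = Zm k x * (mu k x s * c.Wt s \<gamma> y)"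
  using Zm_pos[of k x]
  by (simp add: Ham_split[OF k] mu_def Zm_def[symmetric] c.Wt_def ww_def exp_add mult_ac)

lemma Zp_eq: "Zp (mg k x y) = Zm k x * c.Zg y"
  unfolding partition_fn_def sum_configs[OF k] exp_Ham c.Zg_def c.avg_def sum_distrib_left ..

lemma gibbs2_eq: "gibbs2 F (mg k x y) = c.full2 (\<lambda>s s' e. F (s(k := fst e)) (s'(k := snd e))) y"
proof -
  have "(\<Sum>\<sigma>\<in>C. \<Sum>\<tau>\<in>C. F \<sigma> \<tau> * (exp (Ham (mg k x y) \<sigma>) * exp (Ham (mg k x y) \<tau>)))
    = (\<Sum>s\<in>Om k. \<Sum>\<gamma>\<in>\<Gamma>. \<Sum>s'\<in>Om k. \<Sum>\<gamma>'\<in>\<Gamma>. F (s(k := \<gamma>)) (s'(k := \<gamma>')) *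
        (Zm k x * (mu k x s * c.Wt s \<gamma> y) * (Zm k x * (mu k x s' * c.Wt s' \<gamma>' y))))"
    unfolding sum_configs[OF k] exp_Ham ..
  also have "\<dots> = (\<Sum>s\<in>Om k. \<Sum>s'\<in>Om k. \<Sum>\<gamma>\<in>\<Gamma>. \<Sum>\<gamma>'\<in>\<Gamma>. F (s(k := \<gamma>)) (s'(k := \<gamma>')) *
        (Zm k x * (mu k x s * c.Wt s \<gamma> y) * (Zm k x * (mu k x s' * c.Wt s' \<gamma>' y))))"
    by (intro sum.cong refl sum.swap)
  also have "\<dots> = (Zm k x)\<^sup>2 * c.avg2 (\<lambda>s s'. \<Sum>e\<in>\<Gamma>\<times>\<Gamma>. F (s(k := fst e)) (s'(k := snd e)) * (c.Wt s (fst e) y * c.Wt s' (snd e) y))"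
    unfolding c.avg_def sum.cartesian_product case_prod_beta sum_distrib_left
    by (intro sum.cong refl) (simp add: power2_eq_square mult_ac)
  finally show ?thesis
    unfolding gibbs2_def c.full2_def Zp_eq using Zm_pos[of k x] by (simp add: power_mult_distrib)
qed

lemma gibbs_avg_eq: "gibbs_avg S N \<beta> D h (mg k x y) f = (\<Sum>\<gamma>\<in>\<Gamma>. c.avg (\<lambda>s. f (s(k := \<gamma>)) * c.Wt s \<gamma> y)) / c.Zg y"
proof -
  have "(\<Sum>\<sigma>\<in>C. f \<sigma> * exp (Ham (mg k x y) \<sigma>)) = (\<Sum>s\<in>Om k. \<Sum>\<gamma>\<in>\<Gamma>. f (s(k := \<gamma>)) * (Zm k x * (mu k x s * c.Wt s \<gamma> y)))"
    unfolding sum_configs[OF k] exp_Ham ..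
  also have "\<dots> = Zm k x * (\<Sum>\<gamma>\<in>\<Gamma>. c.avg (\<lambda>s. f (s(k := \<gamma>)) * c.Wt s \<gamma> y))"
    unfolding c.avg_def sum_distrib_left by (subst sum.swap) (intro sum.cong refl, simp add: mult_ac)
  finally show ?thesis
    unfolding gibbs_avg_def Zp_eq using Zm_pos[of k x] by simp
qed

text \<open>The Gaussian moment contributes \<beta>^2 (p - q) / 2 as a coefficient of \<gamma>^2,
  which merges with that of D; this is how \<open>\<Delta>\<close> arises.\<close>

lemma wt_exp: "c.wt \<gamma> * exp (\<beta> * real_of_int \<gamma> * z) = exp (real_of_int \<gamma> * (\<beta> * z + h) + (real_of_int \<gamma>)\<^sup>2 * \<Delta>)"
  unfolding c.wt_def ww_def exp_add[symmetric] c.r_def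
  by (simp add: power_mult_distrib algebra_simps)

lemma eavg_mag: "eavg \<Gamma> c.wt (\<lambda>\<gamma>. \<beta> * real_of_int \<gamma>) real_of_int z = num_mag S (\<beta> * z + h) \<Delta> / den1 S (\<beta> * z + h) \<Delta>"
  unfolding eavg_def wt_exp num_mag_eq den1_eq \<Gamma>_def ..

lemma eavg_sq: "eavg \<Gamma> c.wt (\<lambda>\<gamma>. \<beta> * real_of_int \<gamma>) (\<lambda>\<gamma>. (real_of_int \<gamma>)\<^sup>2) z = num_sq S (\<beta> * z + h) \<Delta> / den1 S (\<beta> * z + h) \<Delta>"
  unfolding eavg_def wt_exp num_sq_eq den1_eq \<Gamma>_def ..

text \<open>The squared one-spin mean is read as a mean over two independent spins in the same
  field, which is the form that \<open>c_eq\<close> asks for.\<close>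

lemma q_eq: "q = (\<integral>z. eavg (\<Gamma>\<times>\<Gamma>) c.w2 c.cc (\<lambda>e. real_of_int (fst e) * real_of_int (snd e)) (sqrt q * z) \<partial>stdN)"
proof -
  have "q = (\<integral>z. (num_mag S (sqrt q * \<beta> * z + h) \<Delta> / den1 S (sqrt q * \<beta> * z + h) \<Delta>)\<^sup>2 \<partial>stdN)"
    using pq unfolding is_pq_def by blast
  then show ?thesis unfolding c.eavg_product eavg_mag by (simp only: power2_eq_square mult_ac)
qed

text \<open>The trivial observable 1 on the second replica brings a one-replica quantity into the
  two-replica form.\<close>

lemma p_eq: "p = (\<integral>z. eavg (\<Gamma>\<times>\<Gamma>) c.w2 c.cc (\<lambda>e. (real_of_int (fst e))\<^sup>2 * 1) (sqrt q * z) \<partial>stdN)"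
proof -
  have "p = (\<integral>z. num_sq S (sqrt q * \<beta> * z + h) \<Delta> / den1 S (sqrt q * \<beta> * z + h) \<Delta> \<partial>stdN)"
    using pq unfolding is_pq_def by blast
  then show ?thesis
    unfolding c.eavg_product[of "\<lambda>\<gamma>. (real_of_int \<gamma>)\<^sup>2" "\<lambda>_. 1"] eavg_sq c.eavg_one
    by (simp only: mult_1_right) (simp only: mult_ac)
qed

lemma R_upd: "R (s(k := \<gamma>)) (s'(k := \<gamma>')) - q = c.d s s' + of_int \<gamma> * of_int \<gamma>' / real N"
  "R (s(k := \<gamma>)) (s(k := \<gamma>)) - p = c.\<epsilon> s + (of_int \<gamma>)\<^sup>2 / real N"
  by (simp_all add: R_update[OF k] c.d_def c.\<epsilon>_def power2_eq_square)

text \<open>Each overlap of the remaining spins differs from the full one by at most S^2 / N, and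
  u^2 \<le> 2 (u + v)^2 + 2 v^2. The two overlaps together give 4 S^4 / N^2.\<close>

lemma W_bound: "c.W \<le> 6 * exp 8 * (\<integral>y. 2 * fluct (mg k x y) + 4 * real S ^ 4 / (real N)\<^sup>2 \<partial>PJ k)"
proof -
  let ?A = "\<lambda>s s' e. (R (s(k := fst e)) (s'(k := snd e)) - q)\<^sup>2 + (R (s(k := fst e)) (s(k := fst e)) - p)\<^sup>2"
  have "2 * fluct (mg k x y) + 4 * real S ^ 4 / (real N)\<^sup>2 = c.full2 (\<lambda>s s' e. 2 * ?A s s' e + 4 * real S ^ 4 / (real N)\<^sup>2) y" for y
    unfolding c.full2_affine fluct_def gibbs2_eq ..
  moreover have "c.W \<le> 6 * exp 8 * (\<integral>y. c.full2 (\<lambda>s s' e. 2 * ?A s s' e + 4 * real S ^ 4 / (real N)\<^sup>2) y \<partial>PJ k)"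
  proof (rule c.W_le_full)
    fix s s' e assume "e \<in> \<Gamma>\<times>\<Gamma>"
    then have g: "\<bar>real_of_int (fst e)\<bar> \<le> real S" "\<bar>real_of_int (snd e)\<bar> \<le> real S" by (auto intro: Gamma_abs)
    define a where "a = real_of_int (fst e) * of_int (snd e) / real N"
    define a' where "a' = (real_of_int (fst e))\<^sup>2 / real N"
    have sq: "u\<^sup>2 \<le> 2 * (u + v)\<^sup>2 + 2 * v\<^sup>2" for u v :: real
    proof -
      have "0 \<le> (u + 2 * v)\<^sup>2" by simp
      then show ?thesis by (simp add: power2_eq_square algebra_simps)
    qed
    have aa: "a\<^sup>2 \<le> real S ^ 4 / (real N)\<^sup>2" "a'\<^sup>2 \<le> real S ^ 4 / (real N)\<^sup>2"
    proof -
      have "\<bar>real_of_int (fst e) * of_int (snd e)\<bar> \<le> (real S)\<^sup>2"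
        unfolding abs_mult power2_eq_square using g by (intro mult_mono) auto
      then have "(real_of_int (fst e) * of_int (snd e))\<^sup>2 \<le> ((real S)\<^sup>2)\<^sup>2"
        by (intro abs_le_square_iff[THEN iffD1]) simp
      then show "a\<^sup>2 \<le> real S ^ 4 / (real N)\<^sup>2"
        unfolding a_def power_divide by (intro divide_right_mono) auto
      have "\<bar>(real_of_int (fst e))\<^sup>2\<bar> \<le> (real S)\<^sup>2"
        using g by (simp add: abs_le_square_iff[symmetric])
      then have "((real_of_int (fst e))\<^sup>2)\<^sup>2 \<le> ((real S)\<^sup>2)\<^sup>2"
        by (intro abs_le_square_iff[THEN iffD1]) simp
      then show "a'\<^sup>2 \<le> real S ^ 4 / (real N)\<^sup>2"
        unfolding a'_def power_divide by (intro divide_right_mono) auto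
    qed
    show "(c.d s s')\<^sup>2 + (c.\<epsilon> s)\<^sup>2 \<le> 2 * ?A s s' e + 4 * real S ^ 4 / (real N)\<^sup>2"
      unfolding R_upd a_def[symmetric] a'_def[symmetric]
      using sq[of "c.d s s'" a] sq[of "c.\<epsilon> s" a'] aa by (simp add: algebra_simps)
  qed
  ultimately show ?thesis by simp
qed

lemma nG_nS: "c.nG = nS" by (simp add: c.nG_def nS_def)

text \<open>Apply \<open>full2_test\<close> with \<open>f\<close> the overlap deviation of the
  remaining spins. The site's own share of the full overlap leaves the error (u - c0) u / N with u
  and c0 at most S^2 in absolute value.\<close>

lemma site_test_bounds:
  assumes B: "\<beta> \<le> B" "0 < B"
  defines "I \<equiv> (\<integral>y. 2 * fluct (mg k x y) + 4 * real S ^ 4 / (real N)\<^sup>2 \<partial>PJ k)"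
  shows "(\<integral>y. gibbs2 (\<lambda>\<sigma> \<tau>. (of_int (\<sigma> k) * of_int (\<tau> k) - q) * (R \<sigma> \<tau> - q)) (mg k x y) \<partial>PJ k) \<le> K1 * B * I + 2 * real S ^ 4 / real N"
    and "(\<integral>y. gibbs2 (\<lambda>\<sigma> \<tau>. ((of_int (\<sigma> k))\<^sup>2 - p) * (R \<sigma> \<sigma> - p)) (mg k x y) \<partial>PJ k) \<le> K1 * B * I + 2 * real S ^ 4 / real N"
proof -
  have KW: "1056 * exp 38 * real S ^ 4 * c.nG ^ 4 * B * c.W \<le> K1 * B * I"
  proof -
    have "1056 * exp 38 * real S ^ 4 * c.nG ^ 4 * B * c.W \<le> 1056 * exp 38 * real S ^ 4 * c.nG ^ 4 * B * (6 * exp 8 * I)"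
      using W_bound B unfolding I_def by (intro mult_left_mono) auto
    also have "\<dots> = K1 * B * I"
      using exp_add[of 38 "8::real"] by (simp add: K1_def nG_nS mult_ac)
    finally show ?thesis .
  qed
  have S2: "\<bar>real_of_int \<gamma> * of_int \<gamma>'\<bar> \<le> (real S)\<^sup>2" if "\<gamma> \<in> \<Gamma>" "\<gamma>' \<in> \<Gamma>" for \<gamma> \<gamma>'
    unfolding abs_mult power2_eq_square using that by (intro mult_mono Gamma_abs) auto
  have S2': "\<bar>(real_of_int \<gamma>)\<^sup>2\<bar> \<le> (real S)\<^sup>2" if "\<gamma> \<in> \<Gamma>" for \<gamma>
    using S2[OF that that] by (simp add: power2_eq_square)
  have err: "\<bar>(u - c0) * (u / real N)\<bar> \<le> 2 * real S ^ 4 / real N" if "\<bar>u\<bar> \<le> (real S)\<^sup>2" "\<bar>c0\<bar> \<le> (real S)\<^sup>2" for u c0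
  proof -
    have "\<bar>u - c0\<bar> * \<bar>u\<bar> \<le> (2 * (real S)\<^sup>2) * (real S)\<^sup>2"
      using that by (intro mult_mono) auto
    then show ?thesis using N1 by (simp add: abs_mult divide_right_mono power4_eq_xxxx power2_eq_square mult.assoc)
  qed
  have pqb: "\<bar>q\<bar> \<le> (real S)\<^sup>2" "\<bar>p\<bar> \<le> (real S)\<^sup>2" using is_pq_bounds[OF pq] by auto
  have "(\<integral>y. gibbs2 (\<lambda>\<sigma> \<tau>. (of_int (\<sigma> k) * of_int (\<tau> k) - q) * (R \<sigma> \<tau> - q)) (mg k x y) \<partial>PJ k)
    \<le> 1056 * exp 38 * real S ^ 4 * c.nG ^ 4 * B * c.W + 2 * real S ^ 4 / real N"
    unfolding gibbs2_eq
  proof (rule c.full2_test[OF _ q_eq _ B])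
    show "\<bar>real_of_int (fst e) * real_of_int (snd e)\<bar> \<le> (real S)\<^sup>2" if "e \<in> \<Gamma>\<times>\<Gamma>" for e
      using that S2 by auto
    show "\<bar>c.d s s'\<bar> \<le> c.\<eta> s s'" for s s' by (rule c.d_le)
    fix s s' e assume e: "e \<in> \<Gamma>\<times>\<Gamma>"
    have "(real_of_int ((s(k := fst e)) k) * real_of_int ((s'(k := snd e)) k) - q) * (R (s(k := fst e)) (s'(k := snd e)) - q)
      - c.d s s' * (real_of_int (fst e) * real_of_int (snd e) - q)
      = (real_of_int (fst e) * real_of_int (snd e) - q) * (real_of_int (fst e) * real_of_int (snd e) / real N)"
      unfolding R_upd by (simp add: algebra_simps)
    then show "\<bar>(real_of_int ((s(k := fst e)) k) * real_of_int ((s'(k := snd e)) k) - q) * (R (s(k := fst e)) (s'(k := snd e)) - q)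
      - c.d s s' * (real_of_int (fst e) * real_of_int (snd e) - q)\<bar> \<le> 2 * real S ^ 4 / real N"
      using err[OF S2 pqb(1)] e by (simp only: mem_Times_iff)
  qed
  then show "(\<integral>y. gibbs2 (\<lambda>\<sigma> \<tau>. (of_int (\<sigma> k) * of_int (\<tau> k) - q) * (R \<sigma> \<tau> - q)) (mg k x y) \<partial>PJ k) \<le> K1 * B * I + 2 * real S ^ 4 / real N"
    using KW by linarith
  have "(\<integral>y. gibbs2 (\<lambda>\<sigma> \<tau>. ((of_int (\<sigma> k))\<^sup>2 - p) * (R \<sigma> \<sigma> - p)) (mg k x y) \<partial>PJ k)
    \<le> 1056 * exp 38 * real S ^ 4 * c.nG ^ 4 * B * c.W + 2 * real S ^ 4 / real N"
    unfolding gibbs2_eq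
  proof (rule c.full2_test[OF _ p_eq _ B])
    show "\<bar>(real_of_int (fst e))\<^sup>2 * 1\<bar> \<le> (real S)\<^sup>2" if "e \<in> \<Gamma>\<times>\<Gamma>" for e
      using that S2' by auto
    show "\<bar>c.\<epsilon> s\<bar> \<le> c.\<eta> s s'" for s s' by (rule c.d_le)
    fix s s' e assume e: "e \<in> \<Gamma>\<times>\<Gamma>"
    have "((real_of_int ((s(k := fst e)) k))\<^sup>2 - p) * (R (s(k := fst e)) (s(k := fst e)) - p)
      - c.\<epsilon> s * ((real_of_int (fst e))\<^sup>2 * 1 - p)
      = ((real_of_int (fst e))\<^sup>2 - p) * ((real_of_int (fst e))\<^sup>2 / real N)"
      unfolding R_upd by (simp add: algebra_simps)
    then show "\<bar>((real_of_int ((s(k := fst e)) k))\<^sup>2 - p) * (R (s(k := fst e)) (s(k := fst e)) - p)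
      - c.\<epsilon> s * ((real_of_int (fst e))\<^sup>2 * 1 - p)\<bar> \<le> 2 * real S ^ 4 / real N"
      using err[OF S2' pqb(2)] e by (simp only: mem_Times_iff)
  qed
  then show "(\<integral>y. gibbs2 (\<lambda>\<sigma> \<tau>. ((of_int (\<sigma> k))\<^sup>2 - p) * (R \<sigma> \<sigma> - p)) (mg k x y) \<partial>PJ k) \<le> K1 * B * I + 2 * real S ^ 4 / real N"
    using KW by linarith
qed

end

section \<open>Overlap concentration and the TAP equations\<close>

context ghatak_sherrington
begin

abbreviation "\<D> \<equiv> disorder N"

sublocale \<D>: prob_space \<D>
  unfolding disorder_def by (rule prob_space_PiM_stdN)

lemma component_measurable: "e \<in> pairs N \<Longrightarrow> (\<lambda>g. g e) \<in> borel_measurable \<D>"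
  unfolding disorder_def using measurable_component_singleton[of e "pairs N" "\<lambda>_. stdN"]
  by (simp add: measurable_cong_sets[OF refl sets_stdN])

lemma Ham_measurable [measurable]: "(\<lambda>g. Ham g \<sigma>) \<in> borel_measurable \<D>"
  unfolding hamiltonian_def case_prod_beta prod.collapse
  by (intro borel_measurable_add borel_measurable_times borel_measurable_sum borel_measurable_const component_measurable)

lemma Zp_measurable [measurable]: "Zp \<in> borel_measurable \<D>"
  unfolding partition_fn_def by measurable

lemma gibbs_avg_measurable [measurable]: "(\<lambda>g. gibbs_avg S N \<beta> D h g f) \<in> borel_measurable \<D>"
  unfolding gibbs_avg_def by measurable

lemma gibbs2_measurable [measurable]: "gibbs2 F \<in> borel_measurable \<D>"
  unfolding gibbs2_def by measurable

text \<open>Crude and dependent on N, but it makes every two-replica average integrable.\<close>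

lemma gibbs2_bounded: "\<bar>gibbs2 F g\<bar> \<le> (\<Sum>e\<in>C\<times>C. \<bar>F (fst e) (snd e)\<bar>)"
proof -
  let ?w = "\<lambda>e. exp (Ham g (fst e)) * exp (Ham g (snd e))"
  have "gibbs2 F g = (\<Sum>e\<in>C\<times>C. F (fst e) (snd e) * ?w e) / (\<Sum>e\<in>C\<times>C. ?w e)"
    unfolding gibbs2_def partition_fn_def power2_eq_square sum_product sum.cartesian_product case_prod_beta ..
  also have "\<bar>\<dots>\<bar> \<le> (\<Sum>e\<in>C\<times>C. \<bar>F (fst e) (snd e)\<bar>)"
  proof (rule weighted_mean_bound)
    show "\<bar>F (fst e) (snd e)\<bar> \<le> (\<Sum>e\<in>C\<times>C. \<bar>F (fst e) (snd e)\<bar>)" if "e \<in> C\<times>C" for e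
      using that finite_sets by (intro member_le_sum[of e _ "\<lambda>e. \<bar>F (fst e) (snd e)\<bar>"]) auto
  qed (auto simp: finite_sets intro!: sum_nonneg)
  finally show ?thesis .
qed

lemma gibbs2_integrable: "integrable \<D> (gibbs2 F)"
  by (rule \<D>.integrable_const_bound) (auto intro: gibbs2_bounded)

lemma
  fixes F :: "(nat \<times> nat \<Rightarrow> real) \<Rightarrow> real"
  assumes F: "integrable \<D> F"
  shows split_integrable: "integrable (PiM (Pk k) (\<lambda>_. stdN)) (\<lambda>x. \<integral>y. F (mg k x y) \<partial>PJ k)"
    and split_integral: "(\<integral>g. F g \<partial>\<D>) = (\<integral>x. (\<integral>y. F (mg k x y) \<partial>PJ k) \<partial>PiM (Pk k) (\<lambda>_. stdN))"
proof -
  have un: "Pk k \<union> Jk k = pairs N" "Pk k \<inter> Jk k = {}" by (auto simp: Pk_def Jk_def)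
  have F': "integrable (PiM (Pk k \<union> Jk k) (\<lambda>_. stdN)) F" using F by (simp add: un disorder_def)
  show "(\<integral>g. F g \<partial>\<D>) = (\<integral>x. (\<integral>y. F (mg k x y) \<partial>PJ k) \<partial>PiM (Pk k) (\<lambda>_. stdN))"
    using stdN_prod.product_integral_fold[OF un(2) finite_sets(2)[of k] finite_sets(1)[of k] F']
    by (simp add: un disorder_def mg_def)
  interpret A: prob_space "PiM (Pk k) (\<lambda>_. stdN)" by (rule prob_space_PiM_stdN)
  interpret B: prob_space "PJ k" by (rule prob_space_PiM_stdN)
  interpret AB: pair_sigma_finite "PiM (Pk k) (\<lambda>_. stdN)" "PJ k" ..
  have "integrable (distr (PiM (Pk k) (\<lambda>_. stdN) \<Otimes>\<^sub>M PJ k) (PiM (Pk k \<union> Jk k) (\<lambda>_. stdN)) (merge (Pk k) (Jk k))) F"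
    unfolding stdN_prod.distr_merge[OF un(2) finite_sets(2)[of k] finite_sets(1)[of k]] by (rule F')
  then have "integrable (PiM (Pk k) (\<lambda>_. stdN) \<Otimes>\<^sub>M PJ k) (\<lambda>z. F (merge (Pk k) (Jk k) z))"
    by (subst (asm) integrable_distr_eq) (use F' in auto)
  then show "integrable (PiM (Pk k) (\<lambda>_. stdN)) (\<lambda>x. \<integral>y. F (mg k x y) \<partial>PJ k)"
    unfolding mg_def by (rule AB.integrable_fst')
qed

text \<open>Fubini: an estimate for every frozen \<open>x\<close> with constants independent of
  \<open>x\<close> survives integration over the couplings away from \<open>k\<close>.\<close>

lemma split_mono:
  fixes F G :: "(nat \<times> nat \<Rightarrow> real) \<Rightarrow> real" and a c :: real
  assumes F: "integrable \<D> F" and G: "integrable \<D> G"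
    and le: "\<And>x. (\<integral>y. F (mg k x y) \<partial>PJ k) \<le> a * (\<integral>y. G (mg k x y) \<partial>PJ k) + c"
  shows "(\<integral>g. F g \<partial>\<D>) \<le> a * (\<integral>g. G g \<partial>\<D>) + c"
proof -
  interpret A: prob_space "PiM (Pk k) (\<lambda>_. stdN)" by (rule prob_space_PiM_stdN)
  have "(\<integral>g. F g \<partial>\<D>) \<le> (\<integral>x. a * (\<integral>y. G (mg k x y) \<partial>PJ k) + c \<partial>PiM (Pk k) (\<lambda>_. stdN))"
    unfolding split_integral[OF F, of k]
  proof (rule integral_mono[OF split_integrable[OF F] _ le])
    show "integrable (PiM (Pk k) (\<lambda>_. stdN)) (\<lambda>x. a * (\<integral>y. G (mg k x y) \<partial>PJ k) + c)"
      by (intro Bochner_Integration.integrable_add integrable_mult_right split_integrable[OF G] A.integrable_const)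
  qed
  also have "\<dots> = a * (\<integral>g. G g \<partial>\<D>) + c"
    unfolding split_integral[OF G, of k] using A.prob_space
    by (simp add: split_integrable[OF G])
  finally show ?thesis .
qed

definition "mean_fluct = (\<integral>g. fluct g \<partial>\<D>)"

lemma fluct_integrable: "integrable \<D> fluct"
  unfolding fluct_def by (rule gibbs2_integrable)

lemma fluct_bound_integrable: "integrable \<D> (\<lambda>g. 2 * fluct g + 4 * real S ^ 4 / (real N)\<^sup>2)"
  by (intro Bochner_Integration.integrable_add integrable_mult_right fluct_integrable \<D>.integrable_const)

lemma fluct_bound_integral: "(\<integral>g. 2 * fluct g + 4 * real S ^ 4 / (real N)\<^sup>2 \<partial>\<D>) = 2 * mean_fluct + 4 * real S ^ 4 / (real N)\<^sup>2"
  using \<D>.prob_space by (simp add: fluct_integrable mean_fluct_def)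

text \<open>Only one factor of each square is written as an average over sites; the other stays an
  overlap deviation. This matches the test functions of \<open>site_test_bounds\<close>.\<close>

lemma fluct_eq: "fluct g = (\<Sum>k\<in>V. gibbs2 (\<lambda>\<sigma> \<tau>. (of_int (\<sigma> k) * of_int (\<tau> k) - q) * (R \<sigma> \<tau> - q)) g
    + gibbs2 (\<lambda>\<sigma> \<tau>. ((of_int (\<sigma> k))\<^sup>2 - p) * (R \<sigma> \<sigma> - p)) g) / real N"
proof -
  have cV: "real (card V) = real N" by (simp add: V_def)
  have 1: "(\<Sum>k\<in>V. (of_int (\<sigma> k) * of_int (\<tau> k) - a) * z) / real N = (R \<sigma> \<tau> - a) * z" for \<sigma> \<tau> a z
    using N1 by (simp add: sum_distrib_right[symmetric] sum_subtractf cV R_def diff_divide_distrib left_diff_distrib)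
  have "(R \<sigma> \<tau> - q)\<^sup>2 + (R \<sigma> \<sigma> - p)\<^sup>2 = (\<Sum>k\<in>V. (of_int (\<sigma> k) * of_int (\<tau> k) - q) * (R \<sigma> \<tau> - q)
      + ((of_int (\<sigma> k))\<^sup>2 - p) * (R \<sigma> \<sigma> - p)) / real N" for \<sigma> \<tau>
    unfolding sum.distrib add_divide_distrib power2_eq_square 1 ..
  then have "fluct g = gibbs2 (\<lambda>\<sigma> \<tau>. (\<Sum>k\<in>V. (of_int (\<sigma> k) * of_int (\<tau> k) - q) * (R \<sigma> \<tau> - q)
      + ((of_int (\<sigma> k))\<^sup>2 - p) * (R \<sigma> \<sigma> - p)) / real N) g"
    unfolding fluct_def by presburger
  also have "\<dots> = (\<Sum>k\<in>V. gibbs2 (\<lambda>\<sigma> \<tau>. (of_int (\<sigma> k) * of_int (\<tau> k) - q) * (R \<sigma> \<tau> - q)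
      + ((of_int (\<sigma> k))\<^sup>2 - p) * (R \<sigma> \<sigma> - p)) g) / real N"
  proof -
    have lin: "gibbs2 (\<lambda>\<sigma> \<tau>. (\<Sum>k\<in>V. F k \<sigma> \<tau>) / real N) g = (\<Sum>k\<in>V. gibbs2 (F k) g) / real N" for F
    proof -
      have "(\<Sum>\<sigma>\<in>C. \<Sum>\<tau>\<in>C. (\<Sum>k\<in>V. F k \<sigma> \<tau>) / real N * (exp (Ham g \<sigma>) * exp (Ham g \<tau>)))
        = (\<Sum>k\<in>V. \<Sum>\<sigma>\<in>C. \<Sum>\<tau>\<in>C. F k \<sigma> \<tau> * (exp (Ham g \<sigma>) * exp (Ham g \<tau>))) / real N"
        by (subst sum.swap, subst sum.swap)
           (simp add: sum_distrib_right sum_divide_distrib)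
      then show ?thesis unfolding gibbs2_def by (simp add: sum_divide_distrib mult.commute)
    qed
    show ?thesis by (rule lin)
  qed
  also have "\<dots> = (\<Sum>k\<in>V. gibbs2 (\<lambda>\<sigma> \<tau>. (of_int (\<sigma> k) * of_int (\<tau> k) - q) * (R \<sigma> \<tau> - q)) g
    + gibbs2 (\<lambda>\<sigma> \<tau>. ((of_int (\<sigma> k))\<^sup>2 - p) * (R \<sigma> \<sigma> - p)) g) / real N"
    by (simp add: gibbs2_def distrib_right sum.distrib add_divide_distrib)
  finally show ?thesis .
qed

lemma K1_pos: "0 < K1"
  using S1 finite_sets(4) Gamma_ne by (simp add: K1_def nS_def card_gt_0_iff)

lemma mean_fluct_bound:
  assumes small: "8 * K1 * \<beta> \<le> 1"
  shows "mean_fluct \<le> 10 * real S ^ 4 / real N"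
proof -
  \<comment> \<open>Two tests, each returning twice \<open>mean_fluct\<close> with coefficient 1/8,
    give \<open>mean_fluct / 2\<close> in total, which can be absorbed on the left.\<close>
  define B where "B = 1 / (8 * K1)"
  have B: "\<beta> \<le> B" "0 < B" "K1 * B = 1 / 8" using small K1_pos by (simp_all add: B_def field_simps)
  let ?X = "1 / 8 * (2 * mean_fluct + 4 * real S ^ 4 / (real N)\<^sup>2) + 2 * real S ^ 4 / real N"
  let ?F = "\<lambda>k. gibbs2 (\<lambda>\<sigma> \<tau>. (of_int (\<sigma> k) * of_int (\<tau> k) - q) * (R \<sigma> \<tau> - q))"
  let ?G = "\<lambda>k. gibbs2 (\<lambda>\<sigma> \<tau>. ((of_int (\<sigma> k))\<^sup>2 - p) * (R \<sigma> \<sigma> - p))"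
  have site: "(\<integral>g. ?F k g \<partial>\<D>) \<le> ?X" "(\<integral>g. ?G k g \<partial>\<D>) \<le> ?X" if "k \<in> V" for k
  proof -
    have s: "cavity_site S N \<beta> D h p q k" using that by unfold_locales
    show "(\<integral>g. ?F k g \<partial>\<D>) \<le> ?X"
      unfolding fluct_bound_integral[symmetric] B(3)[symmetric]
      by (rule split_mono[OF gibbs2_integrable fluct_bound_integrable cavity_site.site_test_bounds(1)[OF s B(1,2)]])
    show "(\<integral>g. ?G k g \<partial>\<D>) \<le> ?X"
      unfolding fluct_bound_integral[symmetric] B(3)[symmetric]
      by (rule split_mono[OF gibbs2_integrable fluct_bound_integrable cavity_site.site_test_bounds(2)[OF s B(1,2)]])
  qed
  have "mean_fluct = (\<Sum>k\<in>V. (\<integral>g. ?F k g \<partial>\<D>) + (\<integral>g. ?G k g \<partial>\<D>)) / real N"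
    unfolding mean_fluct_def fluct_eq by (simp add: gibbs2_integrable Bochner_Integration.integral_sum)
  also have "\<dots> \<le> (\<Sum>k\<in>V. 2 * ?X) / real N"
  proof (intro divide_right_mono sum_mono)
    show "(\<integral>g. ?F k g \<partial>\<D>) + (\<integral>g. ?G k g \<partial>\<D>) \<le> 2 * ?X" if "k \<in> V" for k
      using add_mono[OF site[OF that]] by (simp only: mult_2)
  qed simp
  also have "\<dots> = 2 * ?X" using N1 by (simp add: V_def)
  finally have E: "mean_fluct \<le> 2 * ?X" .
  define u v where "u = real S ^ 4 / (real N)\<^sup>2" and "v = real S ^ 4 / real N"
  have "2 * ?X = mean_fluct / 2 + u + 4 * v" by (simp add: u_def v_def)
  moreover have "u \<le> v"
    unfolding u_def v_def using N1 by (intro divide_left_mono) (auto simp: power2_eq_square)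
  ultimately have "mean_fluct \<le> 10 * v" using E by linarith
  then show ?thesis by (simp add: v_def)
qed

lemma fluct_bound_bound:
  assumes "8 * K1 * \<beta> \<le> 1"
  shows "(\<integral>g. 2 * fluct g + 4 * real S ^ 4 / (real N)\<^sup>2 \<partial>\<D>) \<le> 24 * real S ^ 4 / real N"
proof -
  have "real S ^ 4 / (real N)\<^sup>2 \<le> real S ^ 4 / real N"
    using N1 by (intro divide_left_mono) (auto simp: power2_eq_square)
  then have "4 * real S ^ 4 / (real N)\<^sup>2 \<le> 4 * real S ^ 4 / real N" by simp
  moreover have "2 * mean_fluct \<le> 20 * real S ^ 4 / real N" using mean_fluct_bound[OF assms] by simp
  ultimately have "2 * mean_fluct + 4 * real S ^ 4 / (real N)\<^sup>2 \<le> 20 * real S ^ 4 / real N + 4 * real S ^ 4 / real N"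
    by (rule add_mono[rotated])
  then show ?thesis unfolding fluct_bound_integral by (simp add: add_divide_distrib[symmetric])
qed

abbreviation "m g i \<equiv> gibbs_avg S N \<beta> D h g (\<lambda>\<sigma>. of_int (\<sigma> i))"
text \<open>The corrected field of the theorem, as a function of the whole disorder;
  \<open>zeta_eq\<close> identifies it with the one-site \<open>\<xi>\<close>.\<close>

definition "\<zeta> g = 1 / sqrt (real N) * (\<Sum>i=1..N-1. g (i, N) * m g i) - \<beta> * (p - q) * m g N"

lemma N_in_V: "N \<in> V" using N1 by (simp add: V_def)

text \<open>At the last site every coupling has N as its second index, so its field involves only
  \<open>g (i, N)\<close>. For N = 1 both sides are empty.\<close>

lemma Jk_N: "Jk N = (\<lambda>i. (i, N)) ` {1..N-1}"
  by (auto simp: Jk_def pairs_def image_iff)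

lemma \<zeta>_measurable [measurable]: "\<zeta> \<in> borel_measurable \<D>"
  unfolding \<zeta>_def
  by (intro borel_measurable_diff borel_measurable_times borel_measurable_sum borel_measurable_const
      gibbs_avg_measurable component_measurable) (use N1 in \<open>auto simp: pairs_def\<close>)

end

section \<open>The two equations at the last site\<close>

context cavity_site
begin

lemma m_self: "gibbs_avg S N \<beta> D h (mg k x y) (\<lambda>\<sigma>. f (\<sigma> k)) = c.mean1 f y"
  unfolding gibbs_avg_eq c.mean1_def by (simp add: c.avg_cmult)

lemma field_eq:
  assumes kN: "k = N"
  shows "1 / sqrt (real N) * (\<Sum>i=1..N-1. mg k x y (i, N) * m (mg k x y) i) = c.field y"
proof -
  have "1 / sqrt (real N) * (\<Sum>i=1..N-1. mg k x y (i, N) * m (mg k x y) i)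
    = (\<Sum>i=1..N-1. \<Sum>\<gamma>\<in>\<Gamma>. c.avg (\<lambda>s. (y (i, N) * (of_int (s i) / sqrt (real N))) * c.Wt s \<gamma> y)) / c.Zg y"
    unfolding sum_distrib_left sum_divide_distrib
  proof (intro sum.cong refl)
    fix i assume i: "i \<in> {1..N-1}"
    have "(i, N) \<in> Jk k" using i unfolding kN Jk_N by auto
    then have a: "mg k x y (i, N) = y (i, N)" by (simp add: mg_def merge_def Pk_def)
    have b: "(s(k := \<gamma>)) i = s i" for s :: "nat \<Rightarrow> int" and \<gamma> using i kN by auto
    have "c.avg (\<lambda>s. (y (i, N) * (of_int (s i) / sqrt (real N))) * c.Wt s \<gamma> y)
       = y (i, N) / sqrt (real N) * c.avg (\<lambda>s. of_int (s i) * c.Wt s \<gamma> y)" for \<gamma>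
      unfolding c.avg_cmult[symmetric] by (intro c.avg_cong) simp
    then show "1 / sqrt (real N) * (mg k x y (i, N) * m (mg k x y) i)
      = (\<Sum>\<gamma>\<in>\<Gamma>. c.avg (\<lambda>s. (y (i, N) * (of_int (s i) / sqrt (real N))) * c.Wt s \<gamma> y) / c.Zg y)"
      unfolding a gibbs_avg_eq b by (simp add: sum_distrib_left[symmetric] sum_divide_distrib[symmetric])
  qed
  also have "\<dots> = (\<Sum>\<gamma>\<in>\<Gamma>. c.avg (\<lambda>s. lin (Jk k) y (vv k s) * c.Wt s \<gamma> y)) / c.Zg y"
  proof -
    have "lin (Jk k) y (vv k s) = (\<Sum>i=1..N-1. y (i, N) * (of_int (s i) / sqrt (real N)))" for s
      unfolding lin_def kN Jk_N
      by (subst sum.reindex) (auto simp: inj_on_def vv_def oth_def intro!: sum.cong)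
    then show ?thesis by (subst sum.swap) (simp add: sum_distrib_right c.avg_sum)
  qed
  finally show ?thesis unfolding c.field_def .
qed

lemma zeta_eq:
  assumes kN: "k = N"
  shows "\<zeta> (mg k x y) = c.\<xi> y"
proof -
  have "m (mg k x y) N = c.mean1 real_of_int y"
    using m_self[of y real_of_int] unfolding kN by simp
  then show ?thesis unfolding \<zeta>_def field_eq[OF kN] c.\<xi>_def c.r_def by (simp only:)
qed

text \<open>The common bound S^2 for the spin and its square allows one constant for both equations:
  18432 \<open>exp 21\<close> is 3072 \<open>exp 13\<close> times 6 \<open>exp 8\<close>. The
  summand 0 fits the shape of \<open>split_mono\<close>.\<close>

lemma site_tap:
  assumes kN: "k = N"
  defines "I \<equiv> (\<integral>y. 2 * fluct (mg k x y) + 4 * real S ^ 4 / (real N)\<^sup>2 \<partial>PJ k)"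
  shows "(\<integral>y. (m (mg k x y) N - num_mag S (\<beta> * \<zeta> (mg k x y) + h) \<Delta> / den1 S (\<beta> * \<zeta> (mg k x y) + h) \<Delta>)\<^sup>2 \<partial>PJ k)
      \<le> 18432 * exp 21 * nS\<^sup>2 * real S ^ 4 * I + 0"
    and "(\<integral>y. (gibbs_avg S N \<beta> D h (mg k x y) (\<lambda>\<sigma>. (of_int (\<sigma> N))\<^sup>2) - num_sq S (\<beta> * \<zeta> (mg k x y) + h) \<Delta> / den1 S (\<beta> * \<zeta> (mg k x y) + h) \<Delta>)\<^sup>2 \<partial>PJ k)
      \<le> 18432 * exp 21 * nS\<^sup>2 * real S ^ 4 * I + 0"
proof -
  have S2: "real S \<le> (real S)\<^sup>2" using S1 by (simp add: power2_eq_square)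
  have W: "3072 * exp 13 * c.nG\<^sup>2 * ((real S)\<^sup>2)\<^sup>2 * c.W \<le> 18432 * exp 21 * nS\<^sup>2 * real S ^ 4 * I + 0"
  proof -
    have "3072 * exp 13 * c.nG\<^sup>2 * ((real S)\<^sup>2)\<^sup>2 * c.W \<le> 3072 * exp 13 * c.nG\<^sup>2 * ((real S)\<^sup>2)\<^sup>2 * (6 * exp 8 * I)"
      using W_bound unfolding I_def by (intro mult_left_mono) auto
    also have "\<dots> = 18432 * exp 21 * nS\<^sup>2 * real S ^ 4 * I + 0"
      using exp_add[of 13 "8::real"] by (simp add: nG_nS mult_ac)
    finally show ?thesis .
  qed
  have m_N: "m (mg k x y) N = c.mean1 real_of_int y"
    and m2_N: "gibbs_avg S N \<beta> D h (mg k x y) (\<lambda>\<sigma>. (of_int (\<sigma> N))\<^sup>2) = c.mean1 (\<lambda>\<gamma>. (real_of_int \<gamma>)\<^sup>2) y" for y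
    using m_self[of y real_of_int] m_self[of y "\<lambda>\<gamma>. (real_of_int \<gamma>)\<^sup>2"] unfolding kN by simp_all
  show "(\<integral>y. (m (mg k x y) N - num_mag S (\<beta> * \<zeta> (mg k x y) + h) \<Delta> / den1 S (\<beta> * \<zeta> (mg k x y) + h) \<Delta>)\<^sup>2 \<partial>PJ k)
      \<le> 18432 * exp 21 * nS\<^sup>2 * real S ^ 4 * I + 0"
    unfolding zeta_eq[OF kN] eavg_mag[symmetric] m_N
    by (rule order_trans[OF c.tap[of "(real S)\<^sup>2" real_of_int] W])
       (use order_trans[OF Gamma_abs S2] in auto)
  show "(\<integral>y. (gibbs_avg S N \<beta> D h (mg k x y) (\<lambda>\<sigma>. (of_int (\<sigma> N))\<^sup>2) - num_sq S (\<beta> * \<zeta> (mg k x y) + h) \<Delta> / den1 S (\<beta> * \<zeta> (mg k x y) + h) \<Delta>)\<^sup>2 \<partial>PJ k)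
      \<le> 18432 * exp 21 * nS\<^sup>2 * real S ^ 4 * I + 0"
    unfolding zeta_eq[OF kN] eavg_sq[symmetric] m2_N
    by (rule order_trans[OF c.tap[of "(real S)\<^sup>2" "\<lambda>\<gamma>. (real_of_int \<gamma>)\<^sup>2"] W])
       (use Gamma_abs in \<open>auto simp: abs_le_square_iff[symmetric]\<close>)
qed

end

context ghatak_sherrington
begin

theorem tap_equations:
  assumes small: "8 * K1 * \<beta> \<le> 1"
  shows "(\<integral>g. (m g N - num_mag S (\<beta> * \<zeta> g + h) \<Delta> / den1 S (\<beta> * \<zeta> g + h) \<Delta>)\<^sup>2 \<partial>\<D>)
      \<le> 442368 * exp 21 * nS\<^sup>2 * real S ^ 8 / real N" (is "(\<integral>g. ?F g \<partial>\<D>) \<le> ?K")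
    and "(\<integral>g. (gibbs_avg S N \<beta> D h g (\<lambda>\<sigma>. (of_int (\<sigma> N))\<^sup>2) - num_sq S (\<beta> * \<zeta> g + h) \<Delta> / den1 S (\<beta> * \<zeta> g + h) \<Delta>)\<^sup>2 \<partial>\<D>)
      \<le> 442368 * exp 21 * nS\<^sup>2 * real S ^ 8 / real N" (is "(\<integral>g. ?G g \<partial>\<D>) \<le> ?K")
proof -
  have s: "cavity_site S N \<beta> D h p q N" using N_in_V by unfold_locales
  have ga: "\<bar>gibbs_avg S N \<beta> D h g f\<bar> \<le> B" if "0 \<le> B" "\<And>\<sigma>. \<sigma> \<in> C \<Longrightarrow> \<bar>f \<sigma>\<bar> \<le> B" for g f B
    unfolding gibbs_avg_def partition_fn_def by (rule weighted_mean_bound) (use finite_sets that in auto)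
  have CN: "\<bar>real_of_int (\<sigma> N)\<bar> \<le> real S" if "\<sigma> \<in> C" for \<sigma>
    using that N1 by (intro Gamma_abs) (auto simp: configs_def \<Gamma>_def PiE_iff)
  have sqb: "(u - v)\<^sup>2 \<le> (2 * B)\<^sup>2" if "\<bar>u\<bar> \<le> B" "\<bar>v\<bar> \<le> B" for u v B :: real
    using that by (intro abs_le_square_iff[THEN iffD1]) auto
  have mM: "\<bar>m g N\<bar> \<le> real S" for g by (rule ga) (use CN in auto)
  have mS: "\<bar>gibbs_avg S N \<beta> D h g (\<lambda>\<sigma>. (of_int (\<sigma> N))\<^sup>2)\<bar> \<le> (real S)\<^sup>2" for g
    by (rule ga) (use CN in \<open>auto simp: abs_le_square_iff[symmetric]\<close>)
  have iF: "integrable \<D> ?F"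
  proof (rule \<D>.integrable_const_bound[of _ "(2 * real S)\<^sup>2"])
    show "?F \<in> borel_measurable \<D>" unfolding num_mag_eq den1_eq by measurable
    show "AE g in \<D>. norm (?F g) \<le> (2 * real S)\<^sup>2" using sqb[OF mM mag_bound] by simp
  qed
  have iG: "integrable \<D> ?G"
  proof (rule \<D>.integrable_const_bound[of _ "(2 * (real S)\<^sup>2)\<^sup>2"])
    show "?G \<in> borel_measurable \<D>" unfolding num_sq_eq den1_eq by measurable
    show "AE g in \<D>. norm (?G g) \<le> (2 * (real S)\<^sup>2)\<^sup>2" using sqb[OF mS sq_bounds(1)] by simp
  qed
  \<comment> \<open>Multiplying by the 24 S^4 / N of \<open>fluct_bound_bound\<close> gives 442368
    and the eighth power of S.\<close>
  let ?c = "18432 * exp 21 * nS\<^sup>2 * real S ^ 4"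
  have U: "?c * (\<integral>g. 2 * fluct g + 4 * real S ^ 4 / (real N)\<^sup>2 \<partial>\<D>) + 0 \<le> ?K"
  proof -
    have "?c * (\<integral>g. 2 * fluct g + 4 * real S ^ 4 / (real N)\<^sup>2 \<partial>\<D>) \<le> ?c * (24 * real S ^ 4 / real N)"
      by (intro mult_left_mono fluct_bound_bound small) auto
    also have "\<dots> = ?K" using power_add[of "real S" 4 4] by simp
    finally show ?thesis by simp
  qed
  show "(\<integral>g. ?F g \<partial>\<D>) \<le> ?K"
    by (rule order_trans[OF split_mono[OF iF fluct_bound_integrable cavity_site.site_tap(1)[OF s refl]] U])
  show "(\<integral>g. ?G g \<partial>\<D>) \<le> ?K"
    by (rule order_trans[OF split_mono[OF iG fluct_bound_integrable cavity_site.site_tap(2)[OF s refl]] U])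
qed

lemma nS_eq: "nS = 2 * real S + 1"
  by (simp add: nS_def \<Gamma>_def)

end

theorem theorem1:
  fixes S :: nat and \<beta>tilde :: real
  assumes "S \<ge> 1"
    and "\<beta>tilde > 0"
    and "\<forall>\<beta> h D. 0 \<le> \<beta> \<and> \<beta> < \<beta>tilde \<and> 0 \<le> h \<longrightarrow> (\<exists>!pq. is_pq S \<beta> D h (fst pq) (snd pq))"
  shows "\<exists>K > 0. \<exists>\<beta>hat > 0. \<forall>\<beta> h D p q N.
           0 \<le> \<beta> \<and> \<beta> < \<beta>hat \<and> \<beta> < \<beta>tilde \<and> 0 \<le> h \<and> is_pq S \<beta> D h p q \<and> N \<ge> 1 \<longrightarrow>
           (let m = (\<lambda>g i. gibbs_avg S N \<beta> D h g (\<lambda>\<sigma>. of_int (\<sigma> i)));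
                m2 = (\<lambda>g. gibbs_avg S N \<beta> D h g (\<lambda>\<sigma>. (of_int (\<sigma> N))\<^sup>2));
                \<xi> = (\<lambda>g. 1 / sqrt (real N) * (\<Sum>i=1..N-1. g (i, N) * m g i) - \<beta> * (p - q) * m g N);
                \<Delta> = D + \<beta>\<^sup>2 / 2 * (p - q)
            in (\<integral>g. (m g N - num_mag S (\<beta> * \<xi> g + h) \<Delta> / den1 S (\<beta> * \<xi> g + h) \<Delta>)\<^sup>2 \<partial>disorder N)
                 \<le> K / sqrt (real N)
             \<and> (\<integral>g. (m2 g - num_sq S (\<beta> * \<xi> g + h) \<Delta> / den1 S (\<beta> * \<xi> g + h) \<Delta>)\<^sup>2 \<partial>disorder N)
                 \<le> K / sqrt (real N))"
proof -
  \<comment> \<open>The number of spin values, so that \<open>\<kappa>\<close> and \<open>K\<close>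
    are \<open>K1\<close> and the constant of \<open>tap_equations\<close> written before \<beta>,
    h, D and N are fixed.\<close>
  define n where "n = 2 * real S + 1"
  define \<kappa> where "\<kappa> = 6336 * exp 46 * real S ^ 4 * n ^ 4"
  define K where "K = 442368 * exp 21 * n\<^sup>2 * real S ^ 8"
  have S1: "1 \<le> real S" using assms(1) by simp
  have n1: "1 \<le> n" by (simp add: n_def)
  have \<kappa>_ge: "(real S)\<^sup>2 \<le> \<kappa>" "0 < \<kappa>"
  proof -
    have "1 * 1 * (real S)\<^sup>2 * 1 \<le> 6336 * exp 46 * real S ^ 4 * n ^ 4"
      using S1 n1 by (intro mult_mono) (auto intro: power_increasing)
    then show "(real S)\<^sup>2 \<le> \<kappa>" by (simp add: \<kappa>_def)
    then show "0 < \<kappa>" using S1 by (smt (verit) one_le_power)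
  qed
  have "0 < K" using S1 n1 by (auto simp: K_def)
  moreover have "0 < 1 / (8 * \<kappa>)" using \<kappa>_ge by simp
  moreover have "(let m = (\<lambda>g i. gibbs_avg S N \<beta> D h g (\<lambda>\<sigma>. of_int (\<sigma> i)));
                m2 = (\<lambda>g. gibbs_avg S N \<beta> D h g (\<lambda>\<sigma>. (of_int (\<sigma> N))\<^sup>2));
                \<xi> = (\<lambda>g. 1 / sqrt (real N) * (\<Sum>i=1..N-1. g (i, N) * m g i) - \<beta> * (p - q) * m g N);
                \<Delta> = D + \<beta>\<^sup>2 / 2 * (p - q)
            in (\<integral>g. (m g N - num_mag S (\<beta> * \<xi> g + h) \<Delta> / den1 S (\<beta> * \<xi> g + h) \<Delta>)\<^sup>2 \<partial>disorder N)
                 \<le> K / sqrt (real N)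
             \<and> (\<integral>g. (m2 g - num_sq S (\<beta> * \<xi> g + h) \<Delta> / den1 S (\<beta> * \<xi> g + h) \<Delta>)\<^sup>2 \<partial>disorder N)
                 \<le> K / sqrt (real N))"
    if H: "0 \<le> \<beta> \<and> \<beta> < 1 / (8 * \<kappa>) \<and> \<beta> < \<beta>tilde \<and> 0 \<le> h \<and> is_pq S \<beta> D h p q \<and> N \<ge> 1"
    for \<beta> h D p q :: real and N :: nat
  proof -
    have small: "8 * \<kappa> * \<beta> \<le> 1" using H \<kappa>_ge by (simp add: field_simps)
    \<comment> \<open>Since \<open>\<kappa>\<close> is at least S^2, the contraction condition also
      implies the bound on the exponents; the single threshold \<open>1 / (8 * \<kappa>)\<close>
      suffices.\<close>
    have "\<beta> * (real S)\<^sup>2 \<le> \<beta> * (8 * \<kappa>)" using H \<kappa>_ge by (intro mult_left_mono) auto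
    then have bS: "\<beta> * (real S)\<^sup>2 \<le> 1" using small by (simp add: mult_ac)
    interpret ghatak_sherrington S N \<beta> D h p q by unfold_locales (use H bS assms(1) in auto)
    have "8 * K1 * \<beta> \<le> 1" using small by (simp add: K1_def \<kappa>_def nS_eq n_def)
    note T = tap_equations[OF this, unfolded nS_eq, folded n_def, folded K_def, unfolded \<zeta>_def]
    \<comment> \<open>The bound obtained is of order 1/N and is weakened here to the stated
      rate.\<close>
    have "sqrt (real N) \<le> real N" using H by (intro real_le_lsqrt) (auto simp: power2_eq_square)
    then have "K / real N \<le> K / sqrt (real N)" using \<open>0 < K\<close> H by (intro divide_left_mono) auto
    then show ?thesis unfolding Let_def using T by (meson order_trans)
  qed
  ultimately show ?thesis by blast
qed

end
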